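(* Let $A(z)$ be an exponential polynomial of the form $$A(z)=H_1(z)e^{\zeta_1z^n}+\cdots+H_m(z)e^{\zeta_mz^n},$$ where $n$ and $m$ are positive integers, the functions $H_j\not\equiv 0$ are either exponential polynomials of order $<n$ or ordinary polynomials in $z$, and $\zeta_1,\dots,\zeta_m$ are pairwise distinct nonzero complex numbers. Let $W=\{\bar\zeta_1,\ldots,\bar\zeta_m\}$ and $W_0=W\cup\{0\}$, and suppose that $$C(\operatorname{co}(W_0))>4\,C(\operatorname{co}(W)).$$ Then every nontrivial solution $f$ of $f''+A(z)f=0$ satisfies $\lambda(f)\ge n$.
   Context: An exponential polynomial is an entire function of the form $P_1(z)e^{Q_1(z)}+\cdots+P_k(z)e^{Q_k(z)}$ with $P_j,Q_j$ polynomials. $\operatorname{co}(W)$ is the convex hull of a finite set $W\subset\mathbb{C}$, and $C(\operatorname{co}(W))$ is its circumference (perimeter), where the circumference of a line segment is twice its length and that of a single point is $0$. $\lambda(f)$ is the exponent of convergence of the zeros of $f$. *)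

theory Defs
  imports "HOL-Complex_Analysis.Complex_Analysis"
begin

definition exponential_polynomial :: "(complex \<Rightarrow> complex) \<Rightarrow> bool" where
  "exponential_polynomial f \<longleftrightarrow>
     (\<exists>(k::nat) (P :: nat \<Rightarrow> complex poly) (Q :: nat \<Rightarrow> complex poly).
        \<forall>z. f z = (\<Sum>j=1..k. poly (P j) z * exp (poly (Q j) z)))"

definition max_modulus :: "(complex \<Rightarrow> complex) \<Rightarrow> real \<Rightarrow> real" where
  "max_modulus f r = (SUP z\<in>sphere 0 r. norm (f z))"

definition log_plus :: "real \<Rightarrow> real" where
  "log_plus x = ln (max 1 x)"

text \<open>The order of growth of an entire function. The truncated logarithms only matter for
  constant functions, which get order 0.\<close>

definition entire_order :: "(complex \<Rightarrow> complex) \<Rightarrow> ereal" where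
  "entire_order f = Limsup at_top (\<lambda>r. ereal (log_plus (log_plus (max_modulus f r)) / ln r))"

text \<open>The exponent of convergence of the zeros of an entire function \<open>f \<noteq> 0\<close>: zeros are counted
  with multiplicity, and the value is \<open>\<infinity>\<close> if no exponent makes the series converge.\<close>

definition zeros_exponent :: "(complex \<Rightarrow> complex) \<Rightarrow> ereal" where
  "zeros_exponent f =
     Inf {ereal s | s. s > 0 \<and>
       (\<lambda>z. real_of_int (zorder f z) * norm z powr (- s)) summable_on {z. f z = 0 \<and> z \<noteq> 0}}"

text \<open>The perimeter of a convex polygon, degenerate ones included: the sum of the lengths of
  the edges if the polygon has nonempty interior, and otherwise (segment or point) twice the
  length. The diameter of a segment is its length.\<close>

definition circumference :: "complex set \<Rightarrow> real" where
  "circumference S =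
     (if aff_dim S = 2 then (\<Sum>e | e edge_of S. diameter e) else 2 * diameter S)"

lemma circumference_singleton: "circumference {a} = 0"
  by (simp add: circumference_def)

lemma circumference_segment: "circumference (closed_segment a b) = 2 * dist a b"
proof -
  have "aff_dim (closed_segment a b) \<noteq> 2"
    by (simp add: segment_convex_hull aff_dim_convex_hull aff_dim_2)
  moreover have "diameter (closed_segment a b) = dist a b"
  proof (rule antisym)
    have "norm (x - y) \<le> dist a b" if "x \<in> closed_segment a b" "y \<in> closed_segment a b" for x y
      using dist_decreases_closed_segment[OF that(2), of x] dist_in_closed_segment[OF that(1)]
      by (auto simp: dist_norm)
    then show "diameter (closed_segment a b) \<le> dist a b"
      by (intro diameter_le) auto
    show "dist a b \<le> diameter (closed_segment a b)"
      by (rule diameter_bounded_bound) (auto simp: bounded_closed_segment)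
  qed
  ultimately show ?thesis
    by (simp add: circumference_def)
qed

end

theory Submission
  imports Defs
begin

text \<open>
  Suppose that a nontrivial solution \<open>f\<close> has fewer zeros than claimed, and put \<open>y = f' / f\<close> and
  \<open>w = A' / A\<close>, so that \<open>y' + y\<^sup>2 = - A\<close>. By the argument of Clunie's lemma, the functions
  \<open>D = 2 y' - w y\<close> and \<open>E = 4 D - w\<^sup>2 + 2 w'\<close> are polynomially bounded on suitable circles, and the
  identity \<open>y E = w D - 2 D'\<close> bounds \<open>y E\<close> as well. On such circles \<open>y\<close> is at least of size
  \<open>\<bar>A\<bar>\<^bsup>1/2\<^esup>\<close> where \<open>A\<close> is large, so \<open>ln \<bar>E\<bar> \<le> - ln\<^sup>+ \<bar>A\<bar> / 2\<close> up to a logarithmic term. If \<open>E \<noteq> 0\<close>, then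
  Jensen's formula for the entire function \<open>f\<^sup>2 A\<^sup>2 E\<close> shows that the circular mean of
  \<open>2 ln \<bar>A\<bar> - ln\<^sup>+ \<bar>A\<bar> / 2\<close> is at least \<open>- o(r\<^sup>n)\<close>. Since \<open>ln \<bar>A\<bar>\<close> is at most \<open>r\<^sup>n\<close> times the support
  function of \<open>W\<close> up to \<open>o(r\<^sup>n)\<close>, and the perimeter is the integral of the support function, this gives
  \<open>2 C(co W) - C(co W\<^sub>0) / 2 \<ge> 0\<close>. If \<open>E = 0\<close>, the identity forces \<open>D\<^sup>2 = c A\<close>; then \<open>A\<close> is
  polynomially bounded although it decays exponentially in a sector (when \<open>c = 0\<close>, use \<open>w\<^sup>2 = d A\<close> instead).
\<close>

section \<open>Means over circles\<close>

text \<open>The obstacle is that \<open>f\<close> may have infinite order, so \<open>y\<close> has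
  no evident polynomial bound; only its logarithmic derivative \<open>q\<close> gets one, in two
  passes. The differential equation bounds ln |f| by the exponential of a polynomial, and f'/f
  likewise on suitable circles. Only the logarithm of that crude bound matters afterwards: with
  Jensen's formula for \<open>f\<close> and \<open>deriv f\<close> it bounds the mean of the
  absolute value of ln |f'/f|, and this mean together with zero counts is all that an estimate of
  \<open>q\<close> requires. \<open>D\<close> arises by differentiating the Riccati equation,
  eliminating \<open>A\<close> and collecting what is free of \<open>y\<close>; \<open>E\<close>
  arises by the same step applied to \<open>D\<close>. That both \<open>E\<close> and
  \<open>y * E\<close> are small is what makes \<open>E\<close> tiny where \<open>y\<close> is
  large. The scarcity of zeros enters twice: coarsely in the bounds for \<open>q\<close>, and
  sharply at the end, because the mean of ln |f| is governed by the zeros alone, however fast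
  \<open>f\<close> grows. The factor 4 in the hypothesis is the exponent 2 of A in f^2 A^2 E divided
  by the exponent 1/2 with which \<open>E\<close> decays.\<close>

definition circle_mean :: "(complex \<Rightarrow> real) \<Rightarrow> real \<Rightarrow> real" where
  "circle_mean u r = integral {0..2*pi} (\<lambda>t. u (of_real r * cis t)) / (2*pi)"

abbreviation mean_log :: "(complex \<Rightarrow> complex) \<Rightarrow> real \<Rightarrow> real" where
  "mean_log P r \<equiv> circle_mean (\<lambda>z. ln (norm (P z))) r"

abbreviation mean_log_ratio :: "(complex \<Rightarrow> complex) \<Rightarrow> (complex \<Rightarrow> complex) \<Rightarrow> real \<Rightarrow> real" where
  "mean_log_ratio P Q r \<equiv> circle_mean (\<lambda>z. \<bar>ln (norm (P z)) - ln (norm (Q z))\<bar>) r"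

lemma circle_mean_integrable:
  fixes u :: "complex \<Rightarrow> real"
  assumes "continuous_on (sphere 0 r) u" "r > 0"
  shows "(\<lambda>t. u (of_real r * cis t)) integrable_on {0..2*pi}"
proof (rule integrable_continuous_real)
  show "continuous_on {0..2*pi} (\<lambda>t. u (of_real r * cis t))"
    by (rule continuous_on_compose2[OF assms(1)]) (use assms in \<open>auto simp: norm_mult intro!: continuous_intros\<close>)
qed

lemma circle_mean_mono:
  assumes "continuous_on (sphere 0 r) u" "continuous_on (sphere 0 r) v" "r > 0"
    and "\<And>z. norm z = r \<Longrightarrow> u z \<le> v z"
  shows "circle_mean u r \<le> circle_mean v r"
  unfolding circle_mean_def
  by (intro divide_right_mono integral_le circle_mean_integrable assms)
     (use assms in \<open>auto simp: norm_mult\<close>)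

lemma circle_mean_const [simp]: "circle_mean (\<lambda>_. c) r = c"
  by (simp add: circle_mean_def)

lemma circle_mean_add:
  assumes "continuous_on (sphere 0 r) u" "continuous_on (sphere 0 r) v" "r > 0"
  shows "circle_mean (\<lambda>z. u z + v z) r = circle_mean u r + circle_mean v r"
  using assms by (simp add: circle_mean_def integral_add circle_mean_integrable add_divide_distrib)

lemma circle_mean_diff:
  assumes "continuous_on (sphere 0 r) u" "continuous_on (sphere 0 r) v" "r > 0"
  shows "circle_mean (\<lambda>z. u z - v z) r = circle_mean u r - circle_mean v r"
  using assms by (simp add: circle_mean_def integral_diff circle_mean_integrable diff_divide_distrib)

lemma circle_mean_cmult: "circle_mean (\<lambda>z. c * u z) r = c * circle_mean u r"
  by (simp add: circle_mean_def)

lemma circle_mean_sum: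
  assumes "\<And>i. i \<in> I \<Longrightarrow> continuous_on (sphere 0 r) (u i)" "r > 0" "finite I"
  shows "circle_mean (\<lambda>z. \<Sum>i\<in>I. u i z) r = (\<Sum>i\<in>I. circle_mean (u i) r)"
  using assms by (simp add: circle_mean_def integral_sum circle_mean_integrable sum_divide_distrib)

lemma circle_mean_cong:
  assumes "\<And>z. norm z = r \<Longrightarrow> u z = v z" "r > 0"
  shows "circle_mean u r = circle_mean v r"
  unfolding circle_mean_def using assms by (simp add: norm_mult)

lemma circle_mean_le_const:
  assumes "continuous_on (sphere 0 r) u" "r > 0" and "\<And>z. norm z = r \<Longrightarrow> u z \<le> c"
  shows "circle_mean u r \<le> c"
  using circle_mean_mono[OF assms(1) continuous_on_const assms(2), of c] assms by simp

text \<open>Cauchy's formula expresses the derivative through \<open>v\<close>; adding an integral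
  that vanishes replaces \<open>v\<close> by \<open>v + cnj v\<close>, which is twice the real part.
  The result is the derivative of the Schwarz integral formula.\<close>

lemma Cauchy_kernel_deriv:
  assumes v: "v holomorphic_on ball 0 R'" and R: "0 < R" "R < R'" and z: "norm z < R"
  shows "((\<lambda>t. 2 * of_real (Re (v (of_real R * cis t))) * (of_real R * cis t)
            / (of_real R * cis t - z)^2) has_integral 2 * of_real pi * deriv v z) {0..2*pi}"
proof -
  define W where "W = (\<lambda>t. of_real R * cis t :: complex)"
  have W: "norm (W t) = R" for t using R by (simp add: W_def norm_mult)
  have Wz: "W t - z \<noteq> 0" for t using W[of t] z by auto
  have cont: "continuous_on (cball 0 R) v"
    by (rule holomorphic_on_imp_continuous_on, rule holomorphic_on_subset[OF v]) (use R in auto)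
  have holb: "v holomorphic_on ball 0 R"
    by (rule holomorphic_on_subset[OF v]) (use R in auto)
  have zb: "z \<in> ball 0 R" using z by simp
  have I1: "((\<lambda>t. v (W t) * W t / (W t - z)^2) has_integral 2 * of_real pi * deriv v z) {0..2*pi}"
  proof -
    note C = Cauchy_derivative_integral_circlepath[OF cont holb zb]
    have "((\<lambda>u. v u / (u - z)\<^sup>2) has_contour_integral 2 * of_real pi * \<i> * deriv v z) (circlepath 0 R)"
      using has_contour_integral_integral[OF C(1)] DERIV_imp_deriv[OF C(2)] by simp
    hence "((\<lambda>t. v (W t) / (W t - z)\<^sup>2 * R * \<i> * cis t) has_integral 2 * of_real pi * \<i> * deriv v z) {0..2*pi}"
      unfolding circlepath_def by (subst (asm) has_contour_integral_part_circlepath_iff) (auto simp: W_def)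
    from has_integral_mult_right[OF this, of "-\<i>"] show ?thesis
      by (simp add: W_def algebra_simps)
  qed
  have nz: "of_real R^2 - cnj z * w \<noteq> 0" if "norm w \<le> R" for w
  proof
    assume "of_real R^2 - cnj z * w = 0"
    hence "norm (of_real R^2 :: complex) = norm (cnj z * w)" by simp
    hence "R * R = norm z * norm w" by (simp add: norm_mult norm_power power2_eq_square)
    also have "\<dots> \<le> norm z * R" using that by (intro mult_left_mono) auto
    also have "\<dots> < R * R" using z R by simp
    finally show False by simp
  qed
  \<comment> \<open>The pole is reflected in the circle to a point outside the disc, so Cauchy's
    theorem applies. On the circle \<open>cnj (W t) = R^2 / W t\<close>, hence conjugation turns
    this kernel back into \<open>W t / (W t - z)^2\<close>.\<close>
  have I2: "((\<lambda>t. v (W t) * W t * of_real R^2 / (of_real R^2 - cnj z * W t)^2) has_integral 0) {0..2*pi}"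
  proof -
    have "((\<lambda>w. v w * of_real R^2 / (of_real R^2 - cnj z * w)^2) has_contour_integral 0) (circlepath 0 R)"
    proof (rule Cauchy_theorem_convex[where S="cball 0 R" and K="{}"])
      show "continuous_on (cball 0 R) (\<lambda>w. v w * of_real R^2 / (of_real R^2 - cnj z * w)^2)"
        by (intro continuous_intros cont) (use nz in auto)
      show "(\<lambda>w. v w * of_real R^2 / (of_real R^2 - cnj z * w)^2) field_differentiable at x"
        if "x \<in> interior (cball 0 R) - {}" for x
        by (intro derivative_intros holomorphic_on_imp_differentiable_at[OF v]) (use that R nz[of x] in auto)
    qed (use R in auto)
    hence "((\<lambda>t. v (W t) * of_real R^2 / (of_real R^2 - cnj z * W t)^2 * R * \<i> * cis t) has_integral 0) {0..2*pi}"
      unfolding circlepath_def by (subst (asm) has_contour_integral_part_circlepath_iff) (auto simp: W_def)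
    from has_integral_mult_right[OF this, of "-\<i>"] show ?thesis
      by (simp add: W_def algebra_simps)
  qed
  have "((\<lambda>t. cnj (v (W t) * W t * of_real R^2 / (of_real R^2 - cnj z * W t)^2)) has_integral cnj 0) {0..2*pi}"
    using has_integral_linear[OF I2 bounded_linear_cnj] by (simp add: o_def)
  also have "(\<lambda>t. cnj (v (W t) * W t * of_real R^2 / (of_real R^2 - cnj z * W t)^2)) =
             (\<lambda>t. cnj (v (W t)) * W t / (W t - z)^2)"
  proof
    fix t
    have WW: "cnj (W t) * W t = of_real R^2"
      by (simp add: W_def cis_cnj cis_mult power2_eq_square)
    have W0: "W t \<noteq> 0" using W[of t] R by auto
    have cW: "cnj (W t) = of_real R^2 / W t" using WW W0 by (simp add: field_simps)
    have R0: "(of_real R::complex) \<noteq> 0" using R by simp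
    have e: "of_real R^2 - z * cnj (W t) = of_real R^2 * (W t - z) / W t"
      unfolding cW using W0 by (simp add: field_simps)
    have "cnj (W t) * of_real R^2 / (of_real R^2 - z * cnj (W t))^2 = W t / (W t - z)^2"
      unfolding e unfolding cW using W0 R0 Wz[of t]
      by (simp add: power2_eq_square power_mult_distrib power_divide)
    thus "cnj (v (W t) * W t * of_real R^2 / (of_real R^2 - cnj z * W t)^2) = cnj (v (W t)) * W t / (W t - z)^2"
      by (simp add: mult.assoc flip: times_divide_eq_right)
  qed
  finally have I3: "((\<lambda>t. cnj (v (W t)) * W t / (W t - z)^2) has_integral 0) {0..2*pi}" by simp
  have "((\<lambda>t. v (W t) * W t / (W t - z)^2 + cnj (v (W t)) * W t / (W t - z)^2) has_integral
     2 * of_real pi * deriv v z + 0) {0..2*pi}"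
    by (rule has_integral_add[OF I1 I3])
  also have "(\<lambda>t. v (W t) * W t / (W t - z)^2 + cnj (v (W t)) * W t / (W t - z)^2) =
    (\<lambda>t. 2 * of_real (Re (v (W t))) * W t / (W t - z)^2)"
    using complex_add_cnj by (simp add: fun_eq_iff flip: add_divide_distrib distrib_right)
  finally show ?thesis by (simp add: W_def)
qed

text \<open>With \<open>v\<close> a logarithm of a zero-free function, \<open>Re v\<close> is a log
  modulus: a logarithmic derivative is controlled by the mean of the absolute log modulus on a
  larger circle. Unlike a supremum, such a mean is within reach of Jensen's formula.\<close>

lemma norm_deriv_le_circle_mean_Re:
  assumes v: "v holomorphic_on ball 0 R'" and R: "0 < R" "R < R'" and z: "norm z < R"
  shows "norm (deriv v z) \<le> 2 * R / (R - norm z)^2 * circle_mean (\<lambda>w. \<bar>Re (v w)\<bar>) R"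
proof -
  let ?g = "\<lambda>t. 2 * R / (R - norm z)^2 * \<bar>Re (v (of_real R * cis t))\<bar>"
  let ?f = "\<lambda>t. 2 * of_real (Re (v (of_real R * cis t))) * (of_real R * cis t) / (of_real R * cis t - z)^2"
  note I = Cauchy_kernel_deriv[OF assms]
  have cont: "continuous_on (sphere 0 R) v"
    by (rule holomorphic_on_imp_continuous_on, rule holomorphic_on_subset[OF v]) (use R in auto)
  have c: "(\<lambda>t. \<bar>Re (v (of_real R * cis t))\<bar>) integrable_on {0..2*pi}"
    by (rule circle_mean_integrable[of R "\<lambda>z. \<bar>Re (v z)\<bar>"]) (intro continuous_intros cont R)+
  have "norm (integral {0..2*pi} ?f) \<le> integral {0..2*pi} ?g"
  proof (rule integral_norm_bound_integral)
    show "?f integrable_on {0..2*pi}" using I by blast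
    show "?g integrable_on {0..2*pi}" by (subst real_scaleR_def[symmetric], rule integrable_cmul[OF c])
    fix t assume "t \<in> {0..2*pi}"
    let ?w = "of_real R * cis t"
    have w: "norm ?w = R" using R by (simp add: norm_mult)
    have d: "R - norm z \<le> norm (?w - z)" using norm_triangle_ineq2[of ?w z] w by simp
    have "norm (?f t) = 2 * R * \<bar>Re (v ?w)\<bar> / norm (?w - z)^2"
      using R by (simp add: norm_divide norm_mult norm_power)
    also have "\<dots> \<le> 2 * R * \<bar>Re (v ?w)\<bar> / (R - norm z)^2"
      using d R z by (intro divide_left_mono power_mono mult_nonneg_nonneg mult_pos_pos zero_less_power) auto
    finally show "norm (?f t) \<le> ?g t" by simp
  qed
  moreover have "integral {0..2*pi} ?f = 2 * of_real pi * deriv v z" using I by blast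
  moreover have "integral {0..2*pi} ?g = 2 * R / (R - norm z)^2 * (2 * pi * circle_mean (\<lambda>w. \<bar>Re (v w)\<bar>) R)"
    by (simp add: circle_mean_def)
  ultimately have "norm (2 * of_real pi * deriv v z) \<le> 2 * R / (R - norm z)^2 * (2 * pi * circle_mean (\<lambda>w. \<bar>Re (v w)\<bar>) R)"
    by (simp only:)
  hence "2 * pi * norm (deriv v z) \<le> 2 * pi * (2 * R / (R - norm z)^2 * circle_mean (\<lambda>w. \<bar>Re (v w)\<bar>) R)"
    by (simp add: norm_mult mult_ac)
  thus ?thesis by (subst (asm) mult_le_cancel_left_pos) auto
qed

lemma circle_mean_Re:
  assumes v: "v holomorphic_on ball 0 R'" and R: "0 < R" "R < R'"
  shows "circle_mean (\<lambda>w. Re (v w)) R = Re (v 0)"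
proof -
  define W where "W = (\<lambda>t. of_real R * cis t :: complex)"
  have W0: "W t \<noteq> 0" for t using R by (simp add: W_def)
  have cont: "continuous_on (cball 0 R) v"
    by (rule holomorphic_on_imp_continuous_on, rule holomorphic_on_subset[OF v]) (use R in auto)
  have holb: "v holomorphic_on ball 0 R"
    by (rule holomorphic_on_subset[OF v]) (use R in auto)
  have "((\<lambda>u. v u / (u - 0)) has_contour_integral 2 * of_real pi * \<i> * v 0) (circlepath 0 R)"
    by (rule Cauchy_integral_circlepath[OF cont holb]) (use R in auto)
  hence "((\<lambda>t. v (W t) / W t * R * \<i> * cis t) has_integral 2 * of_real pi * \<i> * v 0) {0..2*pi}"
    unfolding circlepath_def by (subst (asm) has_contour_integral_part_circlepath_iff) (auto simp: W_def)
  also have "(\<lambda>t. v (W t) / W t * R * \<i> * cis t) = (\<lambda>t. \<i> * v (W t))"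
    using R by (simp add: W_def field_simps fun_eq_iff)
  finally have "((\<lambda>t. -\<i> * (\<i> * v (W t))) has_integral -\<i> * (2 * of_real pi * \<i> * v 0)) {0..2*pi}"
    by (rule has_integral_mult_right)
  moreover have "-\<i> * (2 * of_real pi * \<i> * v 0) = 2 * of_real pi * v 0" "(\<lambda>t. -\<i> * (\<i> * v (W t))) = (\<lambda>t. v (W t))"
    by (simp_all add: algebra_simps)
  ultimately have "((\<lambda>t. v (W t)) has_integral (2 * of_real pi * v 0)) {0..2*pi}" by (simp only:)
  from has_integral_linear[OF this bounded_linear_Re]
  have "((\<lambda>t. Re (v (W t))) has_integral (2 * pi * Re (v 0))) {0..2*pi}"
    by (simp add: o_def)
  hence "integral {0..2*pi} (\<lambda>t. Re (v (W t))) = 2 * pi * Re (v 0)" by blast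
  thus ?thesis by (simp add: circle_mean_def W_def)
qed

lemma circle_mean_ln_dist:
  assumes "norm a < R"
  shows "circle_mean (\<lambda>z. ln (norm (z - a))) R = ln R"
proof (cases "a = 0")
  case True
  thus ?thesis using circle_mean_cong[of R "\<lambda>z. ln (norm z)" "\<lambda>_. ln R"] assms by simp
next
  case a: False
  have R: "R > 0" using assms norm_ge_zero[of a] by linarith
  define c where "c = cnj a / R"
  have c: "norm c < 1" using assms R by (simp add: c_def norm_divide)
  define R' where "R' = R\<^sup>2 / norm a"
  have R': "R < R'" using assms R a by (simp add: R'_def field_simps power2_eq_square)
  \<comment> \<open>on the circle, \<open>\<bar>z - a\<bar> = \<bar>R - cnj a z / R\<bar>\<close>, whose logarithm is harmonic inside\<close>
  define v where "v = (\<lambda>z. Ln (1 - cnj a * z / R^2))"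
  have small: "norm (cnj a * z / R^2) < 1" if "z \<in> ball 0 R'" for z
    using that R a by (simp add: norm_mult norm_divide R'_def field_simps norm_power)
  have re: "Re (1 - cnj a * z / R^2) > 0" if "z \<in> ball 0 R'" for z
    using small[OF that] complex_Re_le_cmod[of "cnj a * z / R^2"] by simp
  have v: "v holomorphic_on ball 0 R'" unfolding v_def
    using re by (intro holomorphic_intros) (use R in \<open>auto simp: complex_nonpos_Reals_iff, fastforce\<close>)
  have eq: "ln (norm (z - a)) = Re (v z) + ln R" if "norm z = R" for z
  proof -
    have zz: "z * cnj z = of_real R^2" using that by (simp add: complex_norm_square[symmetric])
    have z0: "z \<noteq> 0" using that R by auto
    have "1 - cnj a * z / R^2 = z / R^2 * cnj (z - a)"
      using zz R z0 by (simp add: field_simps)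
    hence "norm (1 - cnj a * z / R^2) = norm (z - a) / R"
      using that R by (simp add: norm_mult norm_divide norm_power power2_eq_square del: complex_cnj_diff)
    moreover have "1 - cnj a * z / R^2 \<noteq> 0" using re[of z] that R' by (metis less_irrefl mem_ball_0 zero_complex.sel(1))
    moreover have "z \<noteq> a" using that assms by auto
    ultimately show ?thesis using R by (simp add: v_def Re_Ln ln_div)
  qed
  have cont: "continuous_on (sphere 0 R) v"
    by (rule holomorphic_on_imp_continuous_on, rule holomorphic_on_subset[OF v]) (use R' in auto)
  have "circle_mean (\<lambda>z. ln (norm (z - a))) R = circle_mean (\<lambda>z. Re (v z) + ln R) R"
    using eq R by (intro circle_mean_cong) auto
  also have "\<dots> = circle_mean (\<lambda>z. Re (v z)) R + ln R"
    by (subst circle_mean_add) (auto intro!: continuous_intros cont R)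
  also have "circle_mean (\<lambda>z. Re (v z)) R = Re (v 0)" by (rule circle_mean_Re[OF v R R'])
  finally show ?thesis by (simp add: v_def)
qed

section \<open>Zeros of entire functions and Jensen's formula\<close>

abbreviation zeros_in :: "(complex \<Rightarrow> complex) \<Rightarrow> real \<Rightarrow> complex set" where
  "zeros_in P R \<equiv> {a \<in> ball 0 R. P a = 0}"

lemma entire_finite_zeros:
  assumes "P holomorphic_on UNIV" "\<exists>z. P z \<noteq> 0"
  shows "finite {a \<in> cball 0 R. P a = 0}" "finite (zeros_in P R)"
proof -
  show *: "finite {a \<in> cball 0 R. P a = 0}"
  proof (cases "P constant_on UNIV")
    case True
    then obtain c where "\<And>z. P z = c" by (auto simp: constant_on_def)
    with assms(2) show ?thesis by auto
  next
    case False
    thus ?thesis using assms by (intro holomorphic_compact_finite_zeros[of P UNIV]) auto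
  qed
  show "finite (zeros_in P R)" by (rule finite_subset[OF _ *]) auto
qed

lemma entire_zorder:
  assumes "P holomorphic_on UNIV" "\<exists>z. P z \<noteq> 0"
  obtains r g where "r > 0" "g holomorphic_on cball a r"
    "\<And>w. w \<in> cball a r \<Longrightarrow> P w = g w * (w - a) ^ nat (zorder P a) \<and> g w \<noteq> 0"
    "if P a = 0 then zorder P a > 0 else zorder P a = 0"
proof -
  have "(if P a = 0 then zorder P a > 0 else zorder P a = 0) \<and> (\<exists>r. r > 0 \<and> cball a r \<subseteq> UNIV \<and>
      zor_poly P a holomorphic_on cball a r \<and>
      (\<forall>w\<in>cball a r. P w = zor_poly P a w * (w - a) ^ nat (zorder P a) \<and> zor_poly P a w \<noteq> 0))"
    by (rule zorder_exist_zero) (use assms in auto)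
  thus ?thesis using that by blast
qed

lemma entire_zorder_pos:
  assumes "P holomorphic_on UNIV" "\<exists>z. P z \<noteq> 0" "P a = 0"
  shows "zorder P a > 0"
  using entire_zorder[OF assms(1,2), of a] assms(3) by metis

text \<open>The unintegrated counting function n(R, 1/P) of Nevanlinna theory, for the open
  disc.\<close>

definition zero_count :: "(complex \<Rightarrow> complex) \<Rightarrow> real \<Rightarrow> real" where
  "zero_count P R = (\<Sum>a \<in> zeros_in P R. real_of_int (zorder P a))"

lemma zero_count_mono:
  assumes "P holomorphic_on UNIV" "\<exists>z. P z \<noteq> 0" "r \<le> R"
  shows "zero_count P r \<le> zero_count P R"
  unfolding zero_count_def
  by (intro sum_mono2 entire_finite_zeros assms)
     (use assms entire_zorder_pos[OF assms(1,2)] in \<open>force simp: less_imp_le\<close>)+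

lemma card_zeros_le_zero_count:
  assumes "P holomorphic_on UNIV" "\<exists>z. P z \<noteq> 0"
  shows "real (card (zeros_in P R)) \<le> zero_count P R"
proof -
  have "(\<Sum>a \<in> zeros_in P R. 1) \<le> zero_count P R"
    unfolding zero_count_def
    by (intro sum_mono) (use entire_zorder_pos[OF assms] in \<open>force simp: int_one_le_iff_zero_less\<close>)
  thus ?thesis by simp
qed

lemma zero_count_nonneg:
  assumes "P holomorphic_on UNIV" "\<exists>z. P z \<noteq> 0"
  shows "zero_count P R \<ge> 0"
  using card_zeros_le_zero_count[OF assms, of R] by linarith

lemma zero_count_eq_nat:
  assumes "P holomorphic_on UNIV" "\<exists>z. P z \<noteq> 0"
  shows "zero_count P R = (\<Sum>a \<in> zeros_in P R. real (nat (zorder P a)))"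
  unfolding zero_count_def
  by (intro sum.cong) (use entire_zorder_pos[OF assms] in \<open>force simp: of_nat_nat\<close>)+

text \<open>Circle means of ln |P| are estimated on such circles only: there the integrand is
  continuous, and the conventional value of \<open>ln\<close> at 0 never enters.\<close>

definition zero_free :: "(complex \<Rightarrow> complex) \<Rightarrow> real \<Rightarrow> bool" where
  "zero_free P R \<longleftrightarrow> (\<forall>z. norm z = R \<longrightarrow> P z \<noteq> 0)"

text \<open>Dividing out the finitely many zeros leaves a zero-free function on a ball, which has a
  holomorphic logarithm there. The ball is larger than the disc so that \<open>v\<close> is
  holomorphic across the circle itself.\<close>

lemma entire_factorization_ball:
  assumes P: "P holomorphic_on UNIV" "\<exists>z. P z \<noteq> 0"
    and R: "R > 0" and zf: "zero_free P R"
  obtains R' v where "R' > R" "v holomorphic_on ball 0 R'"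
    "\<And>z. z \<in> ball 0 R' \<Longrightarrow> P z = (\<Prod>a\<in>zeros_in P R. (z - a) ^ nat (zorder P a)) * exp (v z)"
proof -
  have nz: "P z \<noteq> 0" if "norm z = R" for z using zf that by (auto simp: zero_free_def)
  define Z where "Z = zeros_in P R"
  define F where "F = (\<lambda>z. \<Prod>a\<in>Z. (z - a) ^ nat (zorder P a))"
  have fZ: "finite Z" unfolding Z_def by (rule entire_finite_zeros[OF P])
  \<comment> \<open>The next larger modulus of a zero limits how far the ball may grow;
    \<open>R+1\<close> keeps the set nonempty and confines the search to a compact disc.\<close>
  define T where "T = insert (R+1) (norm ` {a \<in> cball 0 (R+1). P a = 0 \<and> norm a > R})"
  have fT: "finite T" unfolding T_def
    by (intro finite.insertI finite_imageI finite_subset[OF _ entire_finite_zeros(1)[OF P, of "R+1"]]) auto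
  define R' where "R' = Min T"
  have RR': "R' > R" unfolding R'_def by (subst Min_gr_iff[OF fT]) (auto simp: T_def)
  have R'le: "R' \<le> R + 1" unfolding R'_def by (rule Min_le[OF fT]) (auto simp: T_def)
  have zeros: "P z = 0 \<longleftrightarrow> z \<in> Z" if "z \<in> ball 0 R'" for z
  proof
    assume 0: "P z = 0"
    have "norm z \<le> R"
    proof (rule ccontr)
      assume "\<not> norm z \<le> R"
      hence "norm z \<in> T" using 0 that R'le by (auto simp: T_def)
      hence "R' \<le> norm z" unfolding R'_def by (rule Min_le[OF fT])
      thus False using that by auto
    qed
    moreover have "norm z \<noteq> R" using nz 0 by auto
    ultimately show "z \<in> Z" using 0 by (auto simp: Z_def)
  qed (auto simp: Z_def)
  have F: "F holomorphic_on A" for A unfolding F_def by (intro holomorphic_intros)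
  have F0: "F z = 0 \<longleftrightarrow> z \<in> Z" for z
    unfolding F_def using fZ entire_zorder_pos[OF P] by (auto simp: Z_def)
  have zo: "zorder F z = zorder P z" if z: "z \<in> ball 0 R'" for z
    proof (cases "z \<in> Z")
      case False
      hence "F z \<noteq> 0" "P z \<noteq> 0" using F0 zeros[OF z] by auto
      moreover have "F analytic_on {z}" "P analytic_on {z}"
        using F[of UNIV] P(1) analytic_on_holomorphic by (metis open_UNIV subset_UNIV)+
      ultimately show ?thesis by (simp add: zorder_eq_0I)
    next
      case True
      define g where "g = (\<lambda>w. \<Prod>a\<in>Z-{z}. (w - a) ^ nat (zorder P a))"
      have "zorder F z = zorder P z"
      proof (rule zorder_eqI[of UNIV z g])
        show "g holomorphic_on UNIV" unfolding g_def by (intro holomorphic_intros)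
        show "g z \<noteq> 0" unfolding g_def using fZ by auto
        fix w assume "w \<noteq> z"
        have pos: "zorder P z > 0" using True entire_zorder_pos[OF P] by (auto simp: Z_def)
        have "F w = (w - z) ^ nat (zorder P z) * g w"
          unfolding F_def g_def by (rule prod.remove[OF fZ True])
        also have "(w - z) ^ nat (zorder P z) = (w - z) powi (zorder P z)"
          using pos by (simp add: power_int_def)
        finally show "F w = g w * (w - z) powi (zorder P z)" by simp
      qed auto
      thus ?thesis .
    qed
  have PF: "F z = 0 \<longleftrightarrow> P z = 0" if "z \<in> ball 0 R'" for z
    using zeros[OF that] F0 by auto
  have Ph: "P holomorphic_on ball 0 R'" using P(1) by (rule holomorphic_on_subset) auto
  obtain h where h: "h holomorphic_on ball 0 R'" "\<And>z. z \<in> ball 0 R' \<Longrightarrow> h z \<noteq> 0"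
      "\<And>z. z \<in> ball 0 R' \<Longrightarrow> P z = h z * F z"
    by (rule holomorphic_zorder_factorization[OF Ph open_ball connected_ball F PF zo]) (assumption | rule that)+
  have z0b: "0 \<in> ball 0 R'" using RR' R by auto
  obtain v where v: "v holomorphic_on ball 0 R'" "\<And>x. x \<in> ball 0 R' \<Longrightarrow> exp (v x) = h x"
    using holomorphic_logarithm_exists[OF convex_ball open_ball h(1,2) z0b] by metis
  show ?thesis
  proof (rule that[OF RR' v(1)])
    fix z :: complex assume z: "z \<in> ball 0 R'"
    show "P z = (\<Prod>a\<in>zeros_in P R. (z - a) ^ nat (zorder P a)) * exp (v z)"
      unfolding v(2)[OF z] h(3)[OF z] by (simp add: F_def Z_def)
  qed
qed

lemma prod_linear_factors_deriv:
  assumes "finite Z" "z \<notin> Z"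
  shows "((\<lambda>z. \<Prod>a\<in>Z. (z - a) ^ m a) has_field_derivative
           (\<Prod>a\<in>Z. (z - a) ^ m a) * (\<Sum>a\<in>Z. of_nat (m a) / (z - a))) (at (z::complex))"
  using assms
proof (induction Z rule: finite_induct)
  case (insert b Z)
  have nz: "z - b \<noteq> 0" using insert by auto
  have e: "of_nat (m b) * (z - b) ^ (m b - 1) = (z - b) ^ m b * (of_nat (m b) / (z - b))"
    using nz by (cases "m b") auto
  have "((\<lambda>z. (z - b) ^ m b) has_field_derivative (z - b) ^ m b * (of_nat (m b) / (z - b))) (at z)"
    by (subst e[symmetric]) (auto intro!: derivative_eq_intros)
  from DERIV_mult[OF this insert.IH] insert.prems insert.hyps show ?case
    by (simp add: algebra_simps)
qed auto

lemma ln_norm_factorization: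
  assumes "finite Z" "z \<notin> Z"
  shows "ln (norm ((\<Prod>a\<in>Z. (z - a) ^ m a) * exp v)) = (\<Sum>a\<in>Z. real (m a) * ln (norm (z - a))) + Re v"
proof -
  have "(\<Prod>a\<in>Z. (z - a) ^ m a) \<noteq> 0" using assms by auto
  hence "ln (norm ((\<Prod>a\<in>Z. (z - a) ^ m a) * exp v)) = ln (norm (\<Prod>a\<in>Z. (z - a) ^ m a)) + Re v"
    by (simp add: norm_mult ln_mult)
  also have "ln (norm (\<Prod>a\<in>Z. (z - a) ^ m a)) = (\<Sum>a\<in>Z. real (m a) * ln (norm (z - a)))"
    using assms by (subst prod_norm[symmetric], subst ln_prod) (auto simp: norm_power ln_realpow)
  finally show ?thesis .
qed

text \<open>In the factorization each linear factor has log mean \<open>ln R\<close>, and the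
  exponential contributes \<open>Re (v 0)\<close>. The factorization changes with \<open>R\<close>;
  comparing it at the origin with the quotient of \<open>P\<close> by its power of \<open>z\<close>
  replaces \<open>Re (v 0)\<close> by a constant \<open>c\<close> that is the same for all
  \<open>R\<close>.\<close>

lemma Jensen_formula:
  assumes P: "P holomorphic_on UNIV" "\<exists>z. P z \<noteq> 0"
  shows "\<exists>c \<rho> :: real. 0 < \<rho> \<and> \<rho> \<le> 1 \<and> (\<forall>a. P a = 0 \<longrightarrow> a \<noteq> 0 \<longrightarrow> norm a \<ge> \<rho>) \<and>
    (\<forall>R>0. zero_free P R \<longrightarrow>
      mean_log P R = c + real (nat (zorder P 0)) * ln R +
        (\<Sum>a\<in>zeros_in P R - {0}. real (nat (zorder P a)) * (ln R - ln (norm a))))"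
proof -
  obtain \<rho> g where \<rho>: "\<rho> > 0" "g holomorphic_on cball 0 \<rho>"
    "\<And>w. w \<in> cball 0 \<rho> \<Longrightarrow> P w = g w * w ^ nat (zorder P 0) \<and> g w \<noteq> 0"
    "if P 0 = 0 then zorder P 0 > 0 else zorder P 0 = 0"
    using entire_zorder[OF P, of 0] by (metis diff_zero)
  have main: "mean_log P R = ln (norm (g 0)) + real (nat (zorder P 0)) * ln R +
        (\<Sum>a\<in>zeros_in P R - {0}. real (nat (zorder P a)) * (ln R - ln (norm a)))"
    if R: "R > 0" and nz: "zero_free P R" for R
  proof -
    define Z where "Z = zeros_in P R"
    define m where "m = (\<lambda>a. nat (zorder P a))"
    have fZ: "finite Z" unfolding Z_def by (rule entire_finite_zeros[OF P])
    obtain R' v where R': "R' > R" and v: "v holomorphic_on ball 0 R'"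
      and fac: "\<And>z. z \<in> ball 0 R' \<Longrightarrow> P z = (\<Prod>a\<in>Z. (z - a) ^ m a) * exp (v z)"
      unfolding Z_def m_def using entire_factorization_ball[OF P R nz] by blast
    have contv: "continuous_on (sphere 0 R) v"
      by (rule holomorphic_on_imp_continuous_on, rule holomorphic_on_subset[OF v]) (use R' in auto)
    have "mean_log P R =
       circle_mean (\<lambda>z. (\<Sum>a\<in>Z. real (m a) * ln (norm (z - a))) + Re (v z)) R"
    proof (rule circle_mean_cong[OF _ R])
      fix z :: complex assume z: "norm z = R"
      have "z \<in> ball 0 R'" "z \<notin> Z" using z R' by (auto simp: Z_def)
      thus "ln (norm (P z)) = (\<Sum>a\<in>Z. real (m a) * ln (norm (z - a))) + Re (v z)"
        using fac ln_norm_factorization[OF fZ] by simp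
    qed
    also have "\<dots> = circle_mean (\<lambda>z. (\<Sum>a\<in>Z. real (m a) * ln (norm (z - a)))) R + circle_mean (\<lambda>z. Re (v z)) R"
      by (rule circle_mean_add) (auto intro!: continuous_intros contv R simp: Z_def)
    also have "circle_mean (\<lambda>z. Re (v z)) R = Re (v 0)" by (rule circle_mean_Re[OF v R R'])
    also have "circle_mean (\<lambda>z. (\<Sum>a\<in>Z. real (m a) * ln (norm (z - a)))) R = (\<Sum>a\<in>Z. real (m a) * ln R)"
      by (subst circle_mean_sum[OF _ R fZ]) (auto intro!: continuous_intros sum.cong simp: Z_def circle_mean_cmult circle_mean_ln_dist)
    also have "(\<Sum>a\<in>Z. real (m a) * ln R) = real (m 0) * ln R + (\<Sum>a\<in>Z-{0}. real (m a) * ln R)"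
    proof (cases "0 \<in> Z")
      case True thus ?thesis by (rule sum.remove[OF fZ])
    next
      case False
      hence "m 0 = 0" using \<rho>(4) R by (auto simp: Z_def m_def)
      thus ?thesis using False by simp
    qed
    finally have A: "mean_log P R = real (m 0) * ln R + (\<Sum>a\<in>Z-{0}. real (m a) * ln R) + Re (v 0)" .
    define h where "h = (\<lambda>z. (\<Prod>a\<in>Z-{0}. (z - a) ^ m a) * exp (v z))"
    \<comment> \<open>Near 0, but off 0, both functions are \<open>P\<close> divided by the same
      power of \<open>z\<close>; continuity extends the equality to 0.\<close>
    have "g 0 = h 0"
    proof (rule tendsto_unique[of "at 0"])
      have "h holomorphic_on ball 0 R'" unfolding h_def by (intro holomorphic_intros v)
      hence "continuous_on (ball 0 R') h" by (rule holomorphic_on_imp_continuous_on)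
      hence "isCont h 0" by (rule continuous_on_interior) (use R R' in auto)
      thus "h \<midarrow>0\<rightarrow> h 0" by (simp add: isCont_def)
      have "continuous_on (cball 0 \<rho>) g" using \<rho>(2) by (rule holomorphic_on_imp_continuous_on)
      hence "isCont g 0" by (rule continuous_on_interior) (use \<rho>(1) in auto)
      hence "g \<midarrow>0\<rightarrow> g 0" by (simp add: isCont_def)
      moreover have "eventually (\<lambda>z. g z = h z) (at 0)"
        unfolding eventually_at
      proof (intro exI conjI ballI impI)
        show "min \<rho> R' > 0" using \<rho> R R' by simp
        fix z :: complex assume z: "z \<noteq> 0 \<and> dist z 0 < min \<rho> R'"
        have "g z * z ^ m 0 = (\<Prod>a\<in>Z. (z - a) ^ m a) * exp (v z)"
        proof -
          have "z \<in> cball 0 \<rho>" "z \<in> ball 0 R'" using z by (auto simp: dist_norm)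
          thus ?thesis using \<rho>(3) fac unfolding m_def by metis
        qed
        also have "(\<Prod>a\<in>Z. (z - a) ^ m a) = z ^ m 0 * (\<Prod>a\<in>Z-{0}. (z - a) ^ m a)"
        proof (cases "0 \<in> Z")
          case True thus ?thesis by (subst prod.remove[OF fZ True]) simp
        next
          case False
          hence "m 0 = 0" using \<rho>(4) R by (auto simp: Z_def m_def)
          thus ?thesis using False by simp
        qed
        finally show "g z = h z" using z by (simp add: h_def mult_ac)
      qed
      ultimately show "h \<midarrow>0\<rightarrow> g 0" by (rule Lim_transform_eventually)
    qed auto
    hence "ln (norm (g 0)) = (\<Sum>a\<in>Z-{0}. real (m a) * ln (norm a)) + Re (v 0)"
      using ln_norm_factorization[of "Z - {0}" 0 m "v 0"] fZ by (simp add: h_def)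
    moreover have "(\<Sum>a\<in>Z-{0}. real (m a) * (ln R - ln (norm a))) =
        (\<Sum>a\<in>Z-{0}. real (m a) * ln R) - (\<Sum>a\<in>Z-{0}. real (m a) * ln (norm a))"
      by (simp add: right_diff_distrib sum_subtractf)
    ultimately show ?thesis using A unfolding Z_def m_def by linarith
  qed
  have "norm a \<ge> min \<rho> 1" if "P a = 0" "a \<noteq> 0" for a
    using \<rho>(3)[of a] that by (cases "a \<in> cball 0 \<rho>") auto
  thus ?thesis using \<rho>(1) main
    by (intro exI[of _ "ln (norm (g 0))"] exI[of _ "min \<rho> 1"]) auto
qed

text \<open>For \<open>R \<ge> 1\<close> the zeros contribute nonnegative terms, which bounds the
  mean from below; each term is at most its multiplicity times \<open>ln R - ln \<rho>\<close>,
  which bounds the mean from above; and a zero of modulus below \<open>R / 3\<close> contributes at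
  least its multiplicity because \<open>exp 1 \<le> 3\<close>.\<close>

lemma Jensen_bounds:
  assumes P: "P holomorphic_on UNIV" "\<exists>z. P z \<noteq> 0"
  shows "\<exists>C\<ge>0.
    (\<forall>R\<ge>1. zero_free P R \<longrightarrow> mean_log P R \<ge> - C \<and>
       mean_log P R \<le> C + zero_count P R * (ln R + C)) \<and>
    (\<forall>r\<ge>1. \<forall>R\<ge>3*r. zero_free P R \<longrightarrow>
       zero_count P r \<le> mean_log P R + C)"
proof -
  obtain c \<rho> where \<rho>: "0 < \<rho>" "\<rho> \<le> 1" "\<And>a. P a = 0 \<Longrightarrow> a \<noteq> 0 \<Longrightarrow> norm a \<ge> \<rho>"
    and J: "\<And>R. R > 0 \<Longrightarrow> zero_free P R \<Longrightarrow>
      mean_log P R = c + real (nat (zorder P 0)) * ln R +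
        (\<Sum>a\<in>zeros_in P R - {0}. real (nat (zorder P a)) * (ln R - ln (norm a)))"
    using Jensen_formula[OF P] by blast
  define C where "C = \<bar>c\<bar> - ln \<rho>"
  have ln\<rho>: "ln \<rho> \<le> 0" using \<rho> by simp
  have C: "C \<ge> 0" "C \<ge> - c" "C \<ge> c" "C \<ge> - ln \<rho>" using ln\<rho> by (auto simp: C_def)
  define m where "m = (\<lambda>a. real (nat (zorder P a)))"
  have count: "zero_count P R = m 0 + (\<Sum>a\<in>zeros_in P R - {0}. m a)" if "R > 0" for R
  proof (cases "P 0 = 0")
    case True
    thus ?thesis unfolding zero_count_eq_nat[OF P] m_def using that
      by (intro sum.remove entire_finite_zeros[OF P]) auto
  next
    case False
    hence "m 0 = 0" using entire_zorder[OF P, of 0] unfolding m_def by (metis nat_0 of_nat_0)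
    moreover have "(zeros_in P R) - {0} = zeros_in P R" using False by auto
    ultimately show ?thesis unfolding zero_count_eq_nat[OF P] m_def by simp
  qed
  have m0: "m a \<ge> 0" for a by (simp add: m_def)
  have J': "mean_log P R = c + m 0 * ln R +
        (\<Sum>a\<in>zeros_in P R - {0}. m a * (ln R - ln (norm a)))"
    if "R \<ge> 1" "zero_free P R" for R
    using J[of R] that unfolding m_def by linarith
  have lnm: "ln x \<le> ln y" if "0 < x" "x < y" for x y :: real using that by simp
  show ?thesis
  proof (intro exI[of _ C] conjI C(1) allI impI)
    fix R :: real assume R: "R \<ge> 1" and nz: "zero_free P R"
    have "0 \<le> (\<Sum>a\<in>zeros_in P R - {0}. m a * (ln R - ln (norm a)))"
      by (intro sum_nonneg mult_nonneg_nonneg m0) (auto simp: lnm)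
    moreover have "m 0 * ln R \<ge> 0" using m0 R by simp
    ultimately show "mean_log P R \<ge> - C"
      using J'[OF R nz] C by linarith
    have "(\<Sum>a\<in>zeros_in P R - {0}. m a * (ln R - ln (norm a))) \<le>
          (\<Sum>a\<in>zeros_in P R - {0}. m a * (ln R + C))"
    proof (intro sum_mono mult_left_mono m0)
      fix a assume "a \<in> zeros_in P R - {0}"
      hence "ln (norm a) \<ge> ln \<rho>" using \<rho> by (subst ln_le_cancel_iff) auto
      thus "ln R - ln (norm a) \<le> ln R + C" using C by simp
    qed
    moreover have "m 0 * ln R \<le> m 0 * (ln R + C)" using m0 C by (intro mult_left_mono) auto
    moreover have "zero_count P R * (ln R + C) = m 0 * (ln R + C) + (\<Sum>a\<in>zeros_in P R - {0}. m a * (ln R + C))"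
      using count[of R] R by (simp add: distrib_right sum_distrib_right)
    ultimately show "mean_log P R \<le> C + zero_count P R * (ln R + C)"
      using J'[OF R nz] C by linarith
  next
    fix r R :: real assume r: "r \<ge> 1" and R: "R \<ge> 3 * r" and nz: "zero_free P R"
    have one: "1 \<le> ln R - ln x" if "0 < x" "x \<le> r" for x
    proof -
      have "x * exp 1 \<le> r * 3" using that exp_le by (intro mult_mono) auto
      hence "ln (x * exp 1) \<le> ln R" using that R by (subst ln_le_cancel_iff) auto
      thus ?thesis using that by (simp add: ln_mult)
    qed
    have "(\<Sum>a\<in>zeros_in P r - {0}. m a) \<le> (\<Sum>a\<in>zeros_in P r - {0}. m a * (ln R - ln (norm a)))"
    proof (intro sum_mono)
      fix a assume "a \<in> zeros_in P r - {0}"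
      hence "1 \<le> ln R - ln (norm a)" by (intro one) auto
      thus "m a \<le> m a * (ln R - ln (norm a))" using m0 mult_left_mono by fastforce
    qed
    also have "\<dots> \<le> (\<Sum>a\<in>zeros_in P R - {0}. m a * (ln R - ln (norm a)))"
      using r R by (intro sum_mono2 finite_Diff entire_finite_zeros[OF P] mult_nonneg_nonneg m0) (auto simp: lnm)
    finally have "(\<Sum>a\<in>zeros_in P r - {0}. m a) \<le> \<dots>" .
    moreover have "m 0 \<le> m 0 * ln R" using one[of 1] r m0[of 0] mult_left_mono by fastforce
    ultimately show "zero_count P r \<le> mean_log P R + C"
      using J'[OF _ nz] R r C count[of r] by linarith
  qed
qed

section \<open>Logarithmic derivatives and linear differential equations\<close>

lemma log_deriv_factorization:
  assumes "finite Z" "z \<notin> Z" "open S" "z \<in> S" "v holomorphic_on S"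
    and eq: "\<And>w. w \<in> S \<Longrightarrow> P w = (\<Prod>a\<in>Z. (w - a) ^ m a) * exp (v w)"
  shows "deriv P z / P z = deriv v z + (\<Sum>a\<in>Z. of_nat (m a) / (z - a))"
proof -
  define F where "F = (\<lambda>w. \<Prod>a\<in>Z. (w - a) ^ m a)"
  have F: "(F has_field_derivative F z * (\<Sum>a\<in>Z. of_nat (m a) / (z - a))) (at z)"
    unfolding F_def by (rule prod_linear_factors_deriv) (use assms in auto)
  have v: "(v has_field_derivative deriv v z) (at z)"
    using assms by (metis holomorphic_derivI)
  have "((\<lambda>w. F w * exp (v w)) has_field_derivative
     F z * (\<Sum>a\<in>Z. of_nat (m a) / (z - a)) * exp (v z) + F z * (exp (v z) * deriv v z)) (at z)"
    by (rule derivative_eq_intros F v refl)+ (simp add: algebra_simps)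
  hence "(P has_field_derivative F z * (\<Sum>a\<in>Z. of_nat (m a) / (z - a)) * exp (v z) + F z * (exp (v z) * deriv v z)) (at z)"
    by (rule has_field_derivative_transform_within_open[OF _ assms(3,4)]) (simp add: eq F_def)
  hence "deriv P z = F z * exp (v z) * (deriv v z + (\<Sum>a\<in>Z. of_nat (m a) / (z - a)))"
    by (simp add: DERIV_imp_deriv algebra_simps)
  moreover have "P z = F z * exp (v z)" using eq assms(4) by (simp add: F_def)
  moreover have "F z \<noteq> 0" unfolding F_def using assms(1,2) by auto
  ultimately show ?thesis by simp
qed

lemma circle_mean_linear_logs:
  assumes "finite Z" "\<And>a. a \<in> Z \<Longrightarrow> norm a < R" "R > 0"
  shows "circle_mean (\<lambda>w. \<Sum>a\<in>Z. real (m a) * (L - ln (norm (w - a)))) R = (\<Sum>a\<in>Z. real (m a)) * (L - ln R)"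
proof -
  have nz: "w \<noteq> a" if "norm w = R" "a \<in> Z" for w a using assms(2)[OF that(2)] that(1) by auto
  have c: "continuous_on (sphere 0 R) (\<lambda>w. ln (norm (w - a)))" if "a \<in> Z" for a
    using nz[OF _ that] by (intro continuous_intros) auto
  have "circle_mean (\<lambda>w. \<Sum>a\<in>Z. real (m a) * (L - ln (norm (w - a)))) R =
        (\<Sum>a\<in>Z. circle_mean (\<lambda>w. real (m a) * (L - ln (norm (w - a)))) R)"
    by (rule circle_mean_sum) (auto intro!: continuous_intros c assms)
  also have "\<dots> = (\<Sum>a\<in>Z. real (m a) * (L - ln R))"
    by (intro sum.cong refl, subst circle_mean_cmult, subst circle_mean_diff)
       (auto intro!: continuous_intros c assms simp: circle_mean_ln_dist[OF assms(2)])
  finally show ?thesis by (simp add: sum_distrib_right)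
qed

text \<open>The quotient is treated as a whole: when \<open>Q\<close> is a solution of possibly
  infinite order and \<open>P\<close> its derivative, only ln |P / Q| is known to be small in mean.
  The zero-free part of \<open>P / Q\<close> has a logarithm, to which the bound through the real
  part applies; each zero adds a partial fraction of size at most \<open>B\<close>.\<close>

lemma log_deriv_bound:
  assumes P: "P holomorphic_on UNIV" "\<exists>z. P z \<noteq> 0" and Q: "Q holomorphic_on UNIV" "\<exists>z. Q z \<noteq> 0"
    and zf: "zero_free P R" "zero_free Q R"
    and R: "R \<ge> 1" and z: "norm z \<le> R / 2" and B: "B > 0"
    and far: "\<And>a. norm a < R \<Longrightarrow> P a = 0 \<or> Q a = 0 \<Longrightarrow> 1 / B \<le> norm (z - a)"
    and N: "zero_count P R + zero_count Q R \<le> N"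
    and M: "mean_log_ratio P Q R \<le> M"
  shows "norm (deriv P z / P z - deriv Q z / Q z) \<le> 8 * (M + 4 * R * N) + N * B"
proof -
  define ZP where "ZP = zeros_in P R"
  define ZQ where "ZQ = zeros_in Q R"
  define mP where "mP = (\<lambda>a. nat (zorder P a))"
  define mQ where "mQ = (\<lambda>a. nat (zorder Q a))"
  have R0: "R > 0" using R by simp
  have fin: "finite ZP" "finite ZQ" unfolding ZP_def ZQ_def using entire_finite_zeros P Q by auto
  have cP: "(\<Sum>a\<in>ZP. real (mP a)) = zero_count P R"
    unfolding ZP_def mP_def zero_count_eq_nat[OF P] ..
  have cQ: "(\<Sum>a\<in>ZQ. real (mQ a)) = zero_count Q R"
    unfolding ZQ_def mQ_def zero_count_eq_nat[OF Q] ..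
  obtain R1 vP where R1: "R1 > R" "vP holomorphic_on ball 0 R1"
    "\<And>z. z \<in> ball 0 R1 \<Longrightarrow> P z = (\<Prod>a\<in>ZP. (z - a) ^ mP a) * exp (vP z)"
    unfolding ZP_def mP_def using entire_factorization_ball[OF P R0 zf(1)] by blast
  obtain R2 vQ where R2: "R2 > R" "vQ holomorphic_on ball 0 R2"
    "\<And>z. z \<in> ball 0 R2 \<Longrightarrow> Q z = (\<Prod>a\<in>ZQ. (z - a) ^ mQ a) * exp (vQ z)"
    unfolding ZQ_def mQ_def using entire_factorization_ball[OF Q R0 zf(2)] by blast
  define R' where "R' = min R1 R2"
  have R': "R < R'" using R1 R2 by (simp add: R'_def)
  define v where "v = (\<lambda>w. vP w - vQ w)"
  have v: "v holomorphic_on ball 0 R'" unfolding v_def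
    by (intro holomorphic_intros holomorphic_on_subset[OF R1(2)] holomorphic_on_subset[OF R2(2)]) (auto simp: R'_def)
  have zR: "norm z < R" using z R by simp
  have nzP: "z \<notin> ZP" and nzQ: "z \<notin> ZQ" using far[of z] B zR by (auto simp: ZP_def ZQ_def)
  have contv: "continuous_on (sphere 0 R) v"
    by (rule holomorphic_on_imp_continuous_on, rule holomorphic_on_subset[OF v]) (use R' in auto)
  have contP: "continuous_on (sphere 0 R) (\<lambda>w. ln (norm (P w)))" "continuous_on (sphere 0 R) (\<lambda>w. ln (norm (Q w)))"
    using zf by (auto intro!: continuous_intros holomorphic_on_imp_continuous_on holomorphic_on_subset[OF P(1)]
      holomorphic_on_subset[OF Q(1)] simp: zero_free_def)
  \<comment> \<open>\<open>L\<close> is so large that \<open>L - ln (norm (w - a))\<close> dominates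
    the absolute value of the logarithm, while being affine in it. Its mean is therefore known
    exactly, and zeros of \<open>P\<close> or \<open>Q\<close> close to the circle do no
    harm.\<close>
  define L where "L = 2 * ln (2 * R)"
  define SP where "SP = (\<lambda>w. \<Sum>a\<in>ZP. real (mP a) * (L - ln (norm (w - a))))"
  define SQ where "SQ = (\<lambda>w. \<Sum>a\<in>ZQ. real (mQ a) * (L - ln (norm (w - a))))"
  have neq: "w \<noteq> a" if "norm w = R" "a \<in> ZP \<union> ZQ" for w a using that by (auto simp: ZP_def ZQ_def)
  have contS: "continuous_on (sphere 0 R) SP" "continuous_on (sphere 0 R) SQ"
    unfolding SP_def SQ_def using neq by (auto intro!: continuous_intros)
  have lnabs: "\<bar>ln (norm (w - a))\<bar> \<le> L - ln (norm (w - a))" if "norm w = R" "a \<in> ZP \<union> ZQ" for w a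
  proof -
    have "norm (w - a) \<le> 2 * R" using norm_triangle_ineq4[of w a] that by (auto simp: ZP_def ZQ_def)
    moreover have "norm (w - a) > 0" using neq[OF that] by simp
    ultimately have "ln (norm (w - a)) \<le> ln (2 * R)" using R by (subst ln_le_cancel_iff) auto
    moreover have "ln (2 * R) \<ge> 0" using R by simp
    ultimately show ?thesis unfolding L_def by linarith
  qed
  have Rev: "\<bar>Re (v w)\<bar> \<le> \<bar>ln (norm (P w)) - ln (norm (Q w))\<bar> + (SP w + SQ w)" if w: "norm w = R" for w
  proof -
    have wb: "w \<in> ball 0 R1" "w \<in> ball 0 R2" "w \<notin> ZP" "w \<notin> ZQ" using w R1 R2 by (auto simp: ZP_def ZQ_def)
    have "ln (norm (P w)) = (\<Sum>a\<in>ZP. real (mP a) * ln (norm (w - a))) + Re (vP w)"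
      using R1(3)[OF wb(1)] ln_norm_factorization[OF fin(1) wb(3)] by simp
    moreover have "ln (norm (Q w)) = (\<Sum>a\<in>ZQ. real (mQ a) * ln (norm (w - a))) + Re (vQ w)"
      using R2(3)[OF wb(2)] ln_norm_factorization[OF fin(2) wb(4)] by simp
    moreover have "\<bar>\<Sum>a\<in>ZP. real (mP a) * ln (norm (w - a))\<bar> \<le> SP w"
      unfolding SP_def by (rule order_trans[OF sum_abs sum_mono]) (auto simp: abs_mult intro!: mult_left_mono lnabs w)
    moreover have "\<bar>\<Sum>a\<in>ZQ. real (mQ a) * ln (norm (w - a))\<bar> \<le> SQ w"
      unfolding SQ_def by (rule order_trans[OF sum_abs sum_mono]) (auto simp: abs_mult intro!: mult_left_mono lnabs w)
    ultimately show ?thesis unfolding v_def by simp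
  qed
  let ?N = "zero_count P R + zero_count Q R"
  let ?M = "mean_log_ratio P Q R"
  have N0: "zero_count P R \<ge> 0" "zero_count Q R \<ge> 0" using zero_count_nonneg P Q by auto
  have "circle_mean (\<lambda>w. \<bar>Re (v w)\<bar>) R \<le> circle_mean (\<lambda>w. \<bar>ln (norm (P w)) - ln (norm (Q w))\<bar> + (SP w + SQ w)) R"
    by (rule circle_mean_mono) (auto intro!: continuous_intros contv contP contS R0 Rev)
  also have "\<dots> = ?M + (circle_mean SP R + circle_mean SQ R)"
    by (subst circle_mean_add, (auto intro!: continuous_intros contP contS R0)[3])+ simp
  also have "circle_mean SP R = zero_count P R * (L - ln R)"
    unfolding SP_def cP[symmetric] by (rule circle_mean_linear_logs[OF fin(1) _ R0]) (auto simp: ZP_def)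
  also have "circle_mean SQ R = zero_count Q R * (L - ln R)"
    unfolding SQ_def cQ[symmetric] by (rule circle_mean_linear_logs[OF fin(2) _ R0]) (auto simp: ZQ_def)
  also have "?M + (zero_count P R * (L - ln R) + zero_count Q R * (L - ln R)) = ?M + ?N * (L - ln R)"
    by (simp add: algebra_simps)
  also have "\<dots> \<le> ?M + ?N * L" using N0 R by (intro add_left_mono mult_left_mono) auto
  finally have mean: "circle_mean (\<lambda>w. \<bar>Re (v w)\<bar>) R \<le> ?M + ?N * L" .
  have mean0: "circle_mean (\<lambda>w. \<bar>Re (v w)\<bar>) R \<ge> 0"
  proof -
    have "continuous_on (sphere 0 R) (\<lambda>w. \<bar>Re (v w)\<bar>)" by (intro continuous_intros contv)
    thus ?thesis using circle_mean_mono[of R "\<lambda>_. 0" "\<lambda>w. \<bar>Re (v w)\<bar>"] R0 by simp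
  qed
  have "norm (deriv v z) \<le> 2 * R / (R - norm z)^2 * circle_mean (\<lambda>w. \<bar>Re (v w)\<bar>) R"
    by (rule norm_deriv_le_circle_mean_Re[OF v R0 R' zR])
  also have "\<dots> \<le> 2 * R / (R / 2)^2 * (?M + ?N * L)"
    by (intro mult_mono divide_left_mono power_mono mean mean0 mult_pos_pos zero_less_power) (use z R in auto)
  also have "2 * R / (R / 2)^2 = 8 / R" using R by (simp add: power2_eq_square field_simps)
  finally have dv: "norm (deriv v z) \<le> 8 / R * (?M + ?N * L)" .
  have zb: "z \<in> ball 0 R1" "z \<in> ball 0 R2" "z \<in> ball 0 R'" using zR R' R1 R2 by auto
  have "deriv v z = deriv vP z - deriv vQ z" unfolding v_def
    by (intro deriv_diff) (use R1(2) R2(2) zb in \<open>auto intro!: holomorphic_on_imp_differentiable_at[OF _ open_ball]\<close>)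
  hence "deriv P z / P z - deriv Q z / Q z =
      deriv v z + (\<Sum>a\<in>ZP. of_nat (mP a) / (z - a)) - (\<Sum>a\<in>ZQ. of_nat (mQ a) / (z - a))"
    using log_deriv_factorization[OF fin(1) nzP open_ball zb(1) R1(2,3)]
      log_deriv_factorization[OF fin(2) nzQ open_ball zb(2) R2(2,3)] by simp
  hence "norm (deriv P z / P z - deriv Q z / Q z) \<le>
     norm (deriv v z) + norm (\<Sum>a\<in>ZP. of_nat (mP a) / (z - a)) + norm (\<Sum>a\<in>ZQ. of_nat (mQ a) / (z - a))"
    by (simp only:) (rule order_trans[OF norm_triangle_ineq4 add_right_mono[OF norm_triangle_ineq]])
  moreover have termle: "norm (of_nat k / (z - a)) \<le> real k * B" if "norm a < R" "P a = 0 \<or> Q a = 0" for k a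
  proof -
    have "real k / norm (z - a) \<le> real k / (1 / B)" using far[OF that] B by (intro divide_left_mono mult_pos_pos) (auto intro: less_le_trans[rotated])
    thus ?thesis by (simp add: norm_divide)
  qed
  moreover have "norm (\<Sum>a\<in>ZP. of_nat (mP a) / (z - a)) \<le> (\<Sum>a\<in>ZP. real (mP a) * B)"
    by (intro sum_norm_le termle) (auto simp: ZP_def)
  moreover have "norm (\<Sum>a\<in>ZQ. of_nat (mQ a) / (z - a)) \<le> (\<Sum>a\<in>ZQ. real (mQ a) * B)"
    by (intro sum_norm_le termle) (auto simp: ZQ_def)
  ultimately have *: "norm (deriv P z / P z - deriv Q z / Q z) \<le> 8 / R * (?M + ?N * L) + ?N * B" using dv cP cQ
    by (simp add: sum_distrib_right[symmetric] distrib_right)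
  have "continuous_on (sphere 0 R) (\<lambda>w. \<bar>ln (norm (P w)) - ln (norm (Q w))\<bar>)" by (intro continuous_intros contP)
  hence M0: "0 \<le> ?M" using circle_mean_mono[of R "\<lambda>_. 0" "\<lambda>w. \<bar>ln (norm (P w)) - ln (norm (Q w))\<bar>"] R0 by simp
  have L: "0 \<le> L" "L \<le> 4 * R" using ln_le_minus_one[of "2 * R"] R by (auto simp: L_def)
  have "?N * L \<le> N * (4 * R)" using N N0 L by (intro mult_mono) auto
  hence "8 / R * (?M + ?N * L) \<le> 8 * (M + 4 * R * N)"
    using M M0 N0 L R by (intro mult_mono) (auto simp: divide_le_eq mult_ac)
  moreover have "?N * B \<le> N * B" using N B by (intro mult_right_mono) auto
  ultimately show ?thesis using * by linarith
qed

lemma log_deriv_bound_entire: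
  assumes P: "P holomorphic_on UNIV" "\<exists>z. P z \<noteq> 0" and zf: "zero_free P R"
    and R: "R \<ge> 1" and z: "norm z \<le> R / 2" and B: "B > 0"
    and far: "\<And>a. norm a < R \<Longrightarrow> P a = 0 \<Longrightarrow> 1 / B \<le> norm (z - a)"
    and N: "zero_count P R \<le> N" and M: "circle_mean (\<lambda>w. \<bar>ln (norm (P w))\<bar>) R \<le> M"
  shows "norm (deriv P z / P z) \<le> 8 * (M + 4 * R * N) + N * B"
  using log_deriv_bound[OF P, of "\<lambda>_. 1" R z B N M] assms by (simp add: zero_free_def zero_count_def)

text \<open>Pigeonhole: \<open>N + 1\<close> intervals of length \<open>2 * h\<close> fill the range
  from \<open>R\<close> to \<open>2 * R\<close>, and one of them has no point of \<open>S\<close> in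
  its interior. Its middle half keeps the distance \<open>h / 2\<close> from \<open>S\<close> and is
  infinite, so the points of \<open>T\<close> can be avoided too; \<open>T\<close> may be
  arbitrarily large, but it is avoided without a margin.\<close>

lemma radius_avoiding_points:
  fixes S T :: "real set"
  assumes "finite S" "card S \<le> N" "finite T" "R > 0"
  shows "\<exists>r. R \<le> r \<and> r \<le> 2 * R \<and> (\<forall>s\<in>S. \<bar>s - r\<bar> \<ge> R / (4 * (real N + 1))) \<and> r \<notin> T"
proof -
  define h where "h = R / (2 * (real N + 1))"
  have h: "h > 0" using assms by (simp add: h_def)
  have "\<exists>i\<le>N. \<forall>s\<in>S. \<bar>s - (R + (2 * real i + 1) * h)\<bar> \<ge> h"
  proof (rule ccontr)
    assume "\<not> ?thesis"
    hence *: "\<And>i. i \<le> N \<Longrightarrow> \<exists>s\<in>S. \<bar>s - (R + (2 * real i + 1) * h)\<bar> < h" by (meson not_le)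
    \<comment> \<open>If every interval contained a point of \<open>S\<close>, the index of the
      interval could be read off from the point, which maps \<open>S\<close> onto
      \<open>N + 1\<close> indices.\<close>
    have "{..N} \<subseteq> (\<lambda>s. nat \<lfloor>(s - R) / (2 * h)\<rfloor>) ` S"
    proof
      fix i assume "i \<in> {..N}"
      then obtain s where s: "s \<in> S" "\<bar>s - (R + (2 * real i + 1) * h)\<bar> < h" using * by auto
      have "real i \<le> (s - R) / (2 * h)" "(s - R) / (2 * h) < real i + 1"
        using s(2) h by (auto simp: field_simps abs_less_iff)
      hence "\<lfloor>(s - R) / (2 * h)\<rfloor> = int i" by linarith
      thus "i \<in> (\<lambda>s. nat \<lfloor>(s - R) / (2 * h)\<rfloor>) ` S" using s(1) by force
    qed
    hence "card {..N} \<le> card S" using surj_card_le[OF assms(1)] by blast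
    thus False using assms(2) by simp
  qed
  then obtain i where i: "i \<le> N" "\<And>s. s \<in> S \<Longrightarrow> \<bar>s - (R + (2 * real i + 1) * h)\<bar> \<ge> h" by auto
  define c where "c = R + (2 * real i + 1) * h"
  have "infinite {c - h/2 <..< c + h/2}" using h by (simp add: infinite_Ioo)
  hence "\<not> {c - h/2 <..< c + h/2} \<subseteq> T" using assms(3) finite_subset by blast
  then obtain r where "r \<in> {c - h/2 <..< c + h/2}" "r \<notin> T" by blast
  hence r: "c - h/2 < r" "r < c + h/2" "r \<notin> T" by auto
  have "(2 * real i + 2) * h \<le> (2 * (real N + 1)) * h" using i(1) h by (intro mult_right_mono) auto
  also have "\<dots> = R" by (simp add: h_def)
  finally have "(2 * real i + 2) * h \<le> R" .
  moreover have "real i * h \<ge> 0" using h by simp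
  moreover have "(2 * real i + 2) * h = 2 * (real i * h) + 2 * h" "c = R + 2 * (real i * h) + h"
    by (simp_all add: c_def algebra_simps)
  ultimately have "R \<le> r" "r \<le> 2 * R" using r h by linarith+
  moreover have "\<bar>s - r\<bar> \<ge> R / (4 * (real N + 1))" if "s \<in> S" for s
  proof -
    have "R / (4 * (real N + 1)) = h / 2" by (simp add: h_def)
    thus ?thesis using i(2)[OF that] r unfolding c_def by linarith
  qed
  ultimately show ?thesis using r(3) by blast
qed

lemma zero_freeI:
  assumes "r \<notin> norm ` {a \<in> cball 0 R. P a = 0}" "r \<le> R"
  shows "zero_free P r"
  using assms by (auto simp: zero_free_def)

lemma exists_zero_free_radius:
  assumes P: "P holomorphic_on UNIV" "\<exists>z. P z \<noteq> 0" and R: "R > 0"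
  shows "\<exists>r\<ge>R. r \<le> 2 * R \<and> zero_free P r"
  using radius_avoiding_points[of "{}" 0 "norm ` {a \<in> cball 0 (2*R). P a = 0}" R] R
    entire_finite_zeros(1)[OF P, of "2*R"] zero_freeI[of _ "2*R" P] by auto

text \<open>Gronwall's inequality along the segment from 0 to \<open>z\<close> for the energy |f|^2
  + |f'|^2, whose logarithmic derivative is at most \<open>norm z * (1 + M)\<close>. As
  \<open>M\<close> will be exponential in a power of \<open>R\<close>, the bound is doubly
  exponential and leaves room for infinite order.\<close>

lemma linear_ode_growth:
  assumes f: "f holomorphic_on UNIV" and ode: "\<And>z. deriv (deriv f) z + A z * f z = 0"
    and A: "\<And>z. norm z \<le> R \<Longrightarrow> norm (A z) \<le> M" and M: "M \<ge> 0" and z: "norm z \<le> R"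
  shows "(norm (f z))\<^sup>2 + (norm (deriv f z))\<^sup>2 \<le> ((norm (f 0))\<^sup>2 + (norm (deriv f 0))\<^sup>2) * exp (R * (1 + M))"
proof -
  define c where "c = norm z * (1 + M)"
  define u where "u = (\<lambda>t::real. f (of_real t * z))"
  define u' where "u' = (\<lambda>t::real. deriv f (of_real t * z))"
  define V where "V = (\<lambda>t. u t \<bullet> u t + u' t \<bullet> u' t)"
  have f': "deriv f holomorphic_on UNIV" using f by (rule holomorphic_deriv) auto
  have der: "((\<lambda>t. g (of_real t * z)) has_vector_derivative z * deriv g (of_real t * z)) (at t)"
    if "g holomorphic_on UNIV" for g :: "complex \<Rightarrow> complex" and t :: real
  proof -
    have "((\<lambda>t. of_real t * z) has_vector_derivative z) (at t)"
      by (auto intro!: derivative_eq_intros)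
    moreover have "(g has_field_derivative deriv g (of_real t * z)) (at (of_real t * z))"
      using holomorphic_derivI[OF that] by auto
    ultimately have "(g \<circ> (\<lambda>t. of_real t * z) has_vector_derivative z * deriv g (of_real t * z)) (at t)"
      by (rule field_vector_diff_chain_at)
    thus ?thesis by (simp add: o_def)
  qed
  have du: "(u has_vector_derivative z * u' t) (at t)" for t
    unfolding u_def u'_def by (rule der[OF f])
  have du': "(u' has_vector_derivative z * (- A (of_real t * z) * u t)) (at t)" for t
  proof -
    have "deriv (deriv f) (of_real t * z) = - A (of_real t * z) * u t"
      using ode[of "of_real t * z"] by (simp add: u_def add_eq_0_iff)
    thus ?thesis unfolding u'_def using der[OF f', of t] by simp
  qed
  have dV: "(V has_real_derivative 2 * (u t \<bullet> (z * u' t)) + 2 * (u' t \<bullet> (z * (- A (of_real t * z) * u t)))) (at t)" for t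
    unfolding V_def
    using du[of t] du'[of t] unfolding has_vector_derivative_def has_field_derivative_def
    by (auto intro!: derivative_eq_intros simp: fun_eq_iff inner_commute algebra_simps)
  have "V 1 * exp (- c * 1) \<le> V 0 * exp (- c * 0)"
  proof (rule DERIV_nonpos_imp_nonincreasing[of 0 1 "\<lambda>t. V t * exp (- c * t)"])
    fix t :: real assume t: "0 \<le> t" "t \<le> 1"
    define D where "D = 2 * (u t \<bullet> (z * u' t)) + 2 * (u' t \<bullet> (z * (- A (of_real t * z) * u t)))"
    have tz: "norm (of_real t * z) \<le> R"
      using t z mult_left_le_one_le[of "norm z" t] by (simp add: norm_mult)
    have "u t \<bullet> (z * u' t) \<le> norm (u t) * (norm z * norm (u' t))"
      using norm_cauchy_schwarz[of "u t" "z * u' t"] by (simp add: norm_mult)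
    moreover have "u' t \<bullet> (z * (- A (of_real t * z) * u t)) \<le> norm (u' t) * (norm z * (norm (A (of_real t * z)) * norm (u t)))"
      using norm_cauchy_schwarz[of "u' t" "z * (- A (of_real t * z) * u t)"] by (simp add: norm_mult)
    moreover have "norm (u' t) * (norm z * (norm (A (of_real t * z)) * norm (u t))) \<le> norm (u' t) * (norm z * (M * norm (u t)))"
      by (intro mult_left_mono mult_right_mono A tz) auto
    ultimately have "D \<le> c * (2 * (norm (u t) * norm (u' t)))"
      unfolding D_def c_def by (simp add: algebra_simps)
    also have "\<dots> \<le> c * V t"
      using sum_squares_bound[of "norm (u t)" "norm (u' t)"] M
      by (intro mult_left_mono) (auto simp: V_def c_def power2_norm_eq_inner mult.assoc)
    finally have "D - c * V t \<le> 0" by simp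
    moreover have "((\<lambda>t. V t * exp (- c * t)) has_real_derivative (D - c * V t) * exp (- c * t)) (at t)"
      using dV[of t] unfolding D_def by (auto intro!: derivative_eq_intros simp: algebra_simps)
    ultimately show "\<exists>y. ((\<lambda>t. V t * exp (- c * t)) has_real_derivative y) (at t) \<and> y \<le> 0"
      by (intro exI[of _ "(D - c * V t) * exp (- c * t)"]) (auto simp: mult_nonpos_nonneg)
  qed auto
  hence "V 1 \<le> V 0 * exp c" by (simp add: exp_minus field_simps)
  also have "\<dots> \<le> V 0 * exp (R * (1 + M))"
    using z M by (intro mult_left_mono) (auto simp: c_def V_def intro!: mult_right_mono)
  finally show ?thesis by (simp add: V_def u_def u'_def power2_norm_eq_inner)
qed

section \<open>Cauchy's formula for the perimeter of a convex polygon\<close>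

text \<open>Every point strictly between an interior point and a point of the closure is interior,
  so a ray cannot meet the frontier twice.\<close>

lemma ray_frontier_unique:
  fixes S :: "'a::euclidean_space set"
  assumes S: "convex S" "bounded S" and a: "a \<in> interior S" and l: "l \<noteq> 0"
  shows "\<exists>d>0. \<forall>s\<ge>0. a + s *\<^sub>R l \<in> frontier S \<longleftrightarrow> s = d"
proof -
  obtain d where d: "0 < d" "a + d *\<^sub>R l \<in> frontier S"
    and int: "\<And>e. 0 \<le> e \<Longrightarrow> e < d \<Longrightarrow> a + e *\<^sub>R l \<in> interior S"
    using ray_to_frontier[OF S(2) a l] by metis
  have "s = d" if s: "s \<ge> 0" "a + s *\<^sub>R l \<in> frontier S" for s
  proof (rule ccontr)
    assume "s \<noteq> d"
    then consider "s < d" | "s > d" by linarith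
    thus False
    proof cases
      case 1 thus ?thesis using int[OF s(1)] s(2) by (auto simp: frontier_def)
    next
      case 2
      have "a + s *\<^sub>R l \<in> closure S" using s(2) by (auto simp: frontier_def)
      from in_interior_closure_convex_segment[OF S(1) a this]
      have sub: "open_segment a (a + s *\<^sub>R l) \<subseteq> interior S" .
      have "a + d *\<^sub>R l = (1 - d/s) *\<^sub>R a + (d/s) *\<^sub>R (a + s *\<^sub>R l)"
        using 2 d(1) by (simp add: algebra_simps)
      hence "a + d *\<^sub>R l \<in> open_segment a (a + s *\<^sub>R l)"
        unfolding in_segment using 2 d(1) l by (auto intro!: exI[of _ "d/s"])
      with sub d(2) show False by (auto simp: frontier_def)
    qed
  qed
  thus ?thesis using d by blast
qed

lemma orthogonal_complex_multiple:
  fixes w u :: complex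
  assumes "w \<bullet> u = 0" "u \<noteq> 0"
  shows "\<exists>s. w = s *\<^sub>R (\<i> * u)"
proof -
  define N where "N = (Re u)^2 + (Im u)^2"
  have N: "N \<noteq> 0" using assms(2) by (simp add: N_def complex_eq_iff sum_power2_eq_zero_iff)
  have h: "Re w * Re u + Im w * Im u = 0" using assms(1) by (simp add: inner_complex_def)
  define s where "s = (Im w * Re u - Re w * Im u) / N"
  have "N * Re w = N * (- s * Im u)" "N * Im w = N * (s * Re u)"
    using N h unfolding s_def by (simp_all add: N_def) (algebra+)
  hence "Re w = - s * Im u" "Im w = s * Re u" using N by (metis mult_left_cancel)+
  thus ?thesis by (intro exI[of _ s]) (simp add: complex_eq_iff)
qed

lemma polygon_edges:
  fixes S :: "complex set"
  assumes S: "polytope S" "aff_dim S = 2"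
  shows "finite {e. e edge_of S}" "frontier S = \<Union>{e. e edge_of S}"
    and "\<And>e. e edge_of S \<Longrightarrow> \<exists>a b. e = closed_segment a b" "interior S \<noteq> {}"
proof -
  show "finite {e. e edge_of S}"
    by (rule finite_subset[OF _ finite_polytope_faces[OF S(1)]]) (auto simp: edge_of_def)
  show int: "interior S \<noteq> {}"
  proof -
    have "affine hull S = UNIV" using S(2) aff_dim_eq_full[of S] by simp
    hence "rel_interior S = interior S" by (rule rel_interior_interior)
    moreover have "S \<noteq> {}" using S(2) by auto
    ultimately show ?thesis using rel_interior_eq_empty[OF polytope_imp_convex[OF S(1)]] by simp
  qed
  have "frontier S = rel_frontier S"
    using int by (simp add: rel_frontier_def frontier_def rel_interior_nonempty_interior)
  also have "\<dots> = \<Union>{F. F facet_of S}" by (rule rel_frontier_of_polyhedron[OF polytope_imp_polyhedron[OF S(1)]])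
  also have "{F. F facet_of S} = {e. e edge_of S}" using S(2) by (auto simp: facet_of_def edge_of_def)
  finally show "frontier S = \<Union>{e. e edge_of S}" .
  show "\<exists>a b. e = closed_segment a b" if e: "e edge_of S" for e
  proof (rule compact_convex_collinear_segment[of e])
    show "compact e" using face_of_imp_compact polytope_imp_convex polytope_imp_compact S(1) e by (auto simp: edge_of_def)
    show "convex e" using face_of_imp_convex e by (auto simp: edge_of_def)
    show "collinear e" using e by (simp add: edge_of_def collinear_aff_dim)
    show "e \<noteq> {}" using e by (auto simp: edge_of_def)
  qed blast
qed

text \<open>The line at level \<open>t\<close> passes through the interior, as vertices lie strictly
  on both sides of it, and so leaves the polygon at exactly two points. Neither is a vertex, so each
  lies on a single edge; an edge containing both would contain an interior point.\<close>

lemma line_meets_two_edges: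
  fixes V :: "complex set"
  assumes V: "finite V" "aff_dim (convex hull V) = 2" and u: "u \<noteq> 0"
    and lo: "x \<in> V" "x \<bullet> u < t" and hi: "y \<in> V" "t < y \<bullet> u" and t: "t \<notin> (\<lambda>v. v \<bullet> u) ` V"
  shows "card {e. e edge_of (convex hull V) \<and> t \<in> (\<lambda>v. v \<bullet> u) ` e} = 2"
proof -
  define S where "S = convex hull V"
  have poly: "polytope S" unfolding S_def using V(1) by (rule polytope_convex_hull)
  have dim: "aff_dim S = 2" using V by (simp add: S_def)
  note E = polygon_edges[OF poly dim]
  have conv: "convex S" by (simp add: S_def)
  have bdd: "bounded S" using poly by (simp add: polytope_imp_bounded)
  have cl: "S \<subseteq> closure (interior S)"
    using convex_closure_interior[OF conv E(4)] closure_subset by auto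
  have xS: "x \<in> S" "y \<in> S" using lo hi hull_subset[of V convex] by (auto simp: S_def)
  have near: "\<exists>x'\<in>interior S. x' \<in> U" if "open U" "z \<in> U" "z \<in> S" for z U
    using that cl closure_iff_nhds_not_empty[of z "interior S"] by blast
  have op: "open {z::complex. z \<bullet> u < t}" "open {z::complex. z \<bullet> u > t}"
    by (intro open_Collect_less continuous_intros)+
  obtain x' where x': "x' \<in> interior S" "x' \<bullet> u < t" using near[OF op(1) _ xS(1)] lo by auto
  obtain y' where y': "y' \<in> interior S" "y' \<bullet> u > t" using near[OF op(2) _ xS(2)] hi by auto
  obtain p where p: "p \<in> interior S" "p \<bullet> u = t"
  proof -
    define \<tau> where "\<tau> = (t - x' \<bullet> u) / (y' \<bullet> u - x' \<bullet> u)"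
    have \<tau>: "0 \<le> \<tau>" "\<tau> \<le> 1" using x' y' by (auto simp: \<tau>_def field_simps)
    have "((1 - \<tau>) *\<^sub>R x' + \<tau> *\<^sub>R y') \<bullet> u = x' \<bullet> u + \<tau> * (y' \<bullet> u - x' \<bullet> u)"
      by (simp add: inner_add_left algebra_simps)
    also have "\<dots> = t" using x' y' by (simp add: \<tau>_def)
    finally have "((1 - \<tau>) *\<^sub>R x' + \<tau> *\<^sub>R y') \<bullet> u = t" .
    moreover have "(1 - \<tau>) *\<^sub>R x' + \<tau> *\<^sub>R y' \<in> interior S"
      using \<tau> x'(1) y'(1) convexD_alt[OF convex_interior[OF conv]] by blast
    ultimately show ?thesis by (rule that[rotated])
  qed
  define l where "l = \<i> * u"
  have l: "l \<noteq> 0" using u by (simp add: l_def)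
  have lu: "l \<bullet> u = 0" by (simp add: l_def inner_complex_def)
  obtain d1 where d1: "d1 > 0" "\<And>s. s \<ge> 0 \<Longrightarrow> p + s *\<^sub>R l \<in> frontier S \<longleftrightarrow> s = d1"
    using ray_frontier_unique[OF conv bdd p(1) l] by blast
  have "- l \<noteq> 0" using l by simp
  from ray_frontier_unique[OF conv bdd p(1) this]
  obtain d2 where d2: "d2 > 0" "\<And>s. s \<ge> 0 \<Longrightarrow> p + s *\<^sub>R (- l) \<in> frontier S \<longleftrightarrow> s = d2" by blast
  define p1 where "p1 = p + d1 *\<^sub>R l"
  define p2 where "p2 = p + d2 *\<^sub>R (- l)"
  have front: "z \<in> frontier S \<and> z \<bullet> u = t \<longleftrightarrow> z = p1 \<or> z = p2" for z
  proof
    assume z: "z \<in> frontier S \<and> z \<bullet> u = t"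
    hence "(z - p) \<bullet> u = 0" using p by (simp add: inner_diff_left)
    from orthogonal_complex_multiple[OF this u] obtain s where "z - p = s *\<^sub>R l" by (auto simp: l_def)
    hence s: "z = p + s *\<^sub>R l" by (simp add: algebra_simps)
    show "z = p1 \<or> z = p2"
    proof (cases "s \<ge> 0")
      case True thus ?thesis using d1(2)[of s] z s by (auto simp: p1_def)
    next
      case False thus ?thesis using d2(2)[of "-s"] z s by (auto simp: p2_def)
    qed
  next
    assume "z = p1 \<or> z = p2"
    thus "z \<in> frontier S \<and> z \<bullet> u = t" using d1 d2 p(2) lu
      by (auto simp: p1_def p2_def inner_add_left inner_diff_left)
  qed
  \<comment> \<open>Two distinct edges can only meet in a face of dimension 0, that is in a vertex,
    and no vertex has level \<open>t\<close>.\<close>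
  have uniq: "e = e'" if e: "e edge_of S" "e' edge_of S" "q \<in> e" "q \<in> e'" "q \<bullet> u = t" for e e' q
  proof (rule ccontr)
    assume ne: "e \<noteq> e'"
    have fe: "e face_of S" "e' face_of S" "aff_dim e = 1" "aff_dim e' = 1" using e by (auto simp: edge_of_def)
    have I: "e \<inter> e' face_of S" using fe by (intro face_of_Int)
    have Ie: "e \<inter> e' face_of e" "e \<inter> e' face_of e'"
      using face_of_face fe(1,2) I by auto
    have "e \<inter> e' \<noteq> e \<or> e \<inter> e' \<noteq> e'" using ne by auto
    hence "aff_dim (e \<inter> e') < 1"
      using face_of_aff_dim_lt[OF face_of_imp_convex[OF fe(1)] Ie(1)]
            face_of_aff_dim_lt[OF face_of_imp_convex[OF fe(2)] Ie(2)] fe by auto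
    moreover have "aff_dim (e \<inter> e') \<ge> 0" using e(3,4) by (metis IntI aff_dim_negative_iff empty_iff not_le)
    ultimately obtain a where "e \<inter> e' = {a}" using aff_dim_eq_0[of "e \<inter> e'"] by auto
    hence "{q} face_of S" using I e(3,4) by auto
    hence "q \<in> V" unfolding S_def face_of_singleton by (rule extreme_point_of_convex_hull)
    thus False using t e(5) by auto
  qed
  have "p1 \<in> frontier S" "p2 \<in> frontier S" "p1 \<bullet> u = t" "p2 \<bullet> u = t" using front by auto
  then obtain e1 e2 where e: "e1 edge_of S" "p1 \<in> e1" "e2 edge_of S" "p2 \<in> e2" using E(2) by auto
  have "e1 \<noteq> e2"
  proof
    assume "e1 = e2"
    hence cs: "closed_segment p1 p2 \<subseteq> e1" using e face_of_imp_convex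
      by (intro closed_segment_subset) (auto simp: edge_of_def)
    have "p = (1 - d1/(d1+d2)) *\<^sub>R p1 + (d1/(d1+d2)) *\<^sub>R p2"
    proof -
      have c: "(1 - d1/(d1+d2)) * d1 = (d1/(d1+d2)) * d2" using d1(1) d2(1) by (simp add: field_simps)
      have "(1 - d1/(d1+d2)) *\<^sub>R p1 + (d1/(d1+d2)) *\<^sub>R p2 =
         p + ((1 - d1/(d1+d2)) * d1 - (d1/(d1+d2)) * d2) *\<^sub>R l"
      proof -
        have "(1 - k) *\<^sub>R p1 + k *\<^sub>R p2 = p + ((1 - k) * d1 - k * d2) *\<^sub>R l" for k
          unfolding p1_def p2_def by (simp add: algebra_simps)
        thus ?thesis .
      qed
      thus ?thesis using c by simp
    qed
    hence "p \<in> closed_segment p1 p2" unfolding in_segment using d1(1) d2(1)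
      by (intro exI[of _ "d1/(d1+d2)"]) auto
    hence "p \<in> frontier S" using cs E(2) e by blast
    thus False using p(1) by (auto simp: frontier_def)
  qed
  moreover have "{e. e edge_of S \<and> t \<in> (\<lambda>v. v \<bullet> u) ` e} = {e1, e2}"
  proof (intro equalityI subsetI)
    fix e' assume "e' \<in> {e. e edge_of S \<and> t \<in> (\<lambda>v. v \<bullet> u) ` e}"
    then obtain q where q: "e' edge_of S" "q \<in> e'" "q \<bullet> u = t" by auto
    hence "q = p1 \<or> q = p2" using front[of q] E(2) by auto
    thus "e' \<in> {e1, e2}" using uniq[OF q(1) e(1) q(2)] uniq[OF q(1) e(3) q(2)] e q(3) by auto
  next
    fix e' assume "e' \<in> {e1, e2}"
    moreover have "t \<in> (\<lambda>v. v \<bullet> u) ` e1" by (rule rev_image_eqI[OF e(2)]) (simp add: \<open>p1 \<bullet> u = t\<close>)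
    moreover have "t \<in> (\<lambda>v. v \<bullet> u) ` e2" by (rule rev_image_eqI[OF e(4)]) (simp add: \<open>p2 \<bullet> u = t\<close>)
    ultimately show "e' \<in> {e. e edge_of S \<and> t \<in> (\<lambda>v. v \<bullet> u) ` e}" using e by auto
  qed
  ultimately show ?thesis by (simp add: S_def)
qed

text \<open>Double counting over the levels: integrating the indicator of the projection of one edge
  gives its projected length, while all edges together cover almost every level exactly
  twice.\<close>

lemma sum_edge_projections:
  fixes V :: "complex set"
  assumes V: "finite V" "V \<noteq> {}" "aff_dim (convex hull V) = 2" and u: "u \<noteq> 0"
    and eab: "\<And>e. e edge_of (convex hull V) \<Longrightarrow> e = closed_segment (p e) (q e)"
  shows "(\<Sum>e | e edge_of (convex hull V). \<bar>(p e - q e) \<bullet> u\<bar>) = 2 * (Max ((\<lambda>v. v \<bullet> u) ` V) - Min ((\<lambda>v. v \<bullet> u) ` V))"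
proof -
  define S where "S = convex hull V"
  define \<pi> where "\<pi> = (\<lambda>v::complex. v \<bullet> u)"
  define M where "M = Max (\<pi> ` V)"
  define m where "m = Min (\<pi> ` V)"
  have poly: "polytope S" unfolding S_def using V(1) by (rule polytope_convex_hull)
  have E: "finite {e. e edge_of S}" using polygon_edges[OF poly] V by (simp add: S_def)
  have bnd: "m \<le> \<pi> x \<and> \<pi> x \<le> M" if "x \<in> S" for x
  proof -
    have "S \<subseteq> {x. x \<bullet> u \<le> M} \<inter> {x. x \<bullet> u \<ge> m}" unfolding S_def
    proof (rule hull_minimal)
      show "V \<subseteq> {x. x \<bullet> u \<le> M} \<inter> {x. x \<bullet> u \<ge> m}" using V by (auto simp: M_def m_def \<pi>_def)
      show "convex ({x. x \<bullet> u \<le> M} \<inter> {x. x \<bullet> u \<ge> m})"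
        by (intro convex_Int) (simp_all add: inner_commute[of _ u] convex_halfspace_le convex_halfspace_ge)
    qed
    thus ?thesis using that by (auto simp: \<pi>_def)
  qed
  define lo where "lo = (\<lambda>e. min (\<pi> (p e)) (\<pi> (q e)))"
  define hi where "hi = (\<lambda>e. max (\<pi> (p e)) (\<pi> (q e)))"
  have img: "\<pi> ` e = {lo e..hi e}" if "e edge_of S" for e
  proof -
    have "linear \<pi>" unfolding \<pi>_def by (intro bounded_linear.linear bounded_linear_inner_left)
    hence "\<pi> ` e = closed_segment (\<pi> (p e)) (\<pi> (q e))"
      using eab[of e] that closed_segment_linear_image[of \<pi> "p e" "q e"] by (simp add: S_def)
    also have "\<dots> = {lo e..hi e}" by (auto simp: lo_def hi_def closed_segment_eq_real_ivl)
    finally show ?thesis .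
  qed
  have sub: "{lo e..hi e} \<subseteq> {m..M}" if "e edge_of S" for e
  proof -
    have "e \<subseteq> S" using that edge_of_imp_subset by blast
    thus ?thesis using bnd unfolding img[OF that, symmetric] by auto
  qed
  have "((\<lambda>t. \<Sum>e | e edge_of S. if t \<in> {lo e..hi e} then 1 else (0::real)) has_integral
     (\<Sum>e | e edge_of S. \<bar>(p e - q e) \<bullet> u\<bar>)) {m..M}"
  proof (rule has_integral_sum[OF E])
    fix e assume "e \<in> {e. e edge_of S}"
    hence e: "e edge_of S" by simp
    have "((\<lambda>t. 1::real) has_integral (hi e - lo e)) {lo e..hi e}"
    proof -
      have "lo e \<le> hi e" by (auto simp: lo_def hi_def)
      thus ?thesis using has_integral_const_real[of "1::real" "lo e" "hi e"] by simp
    qed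
    moreover have "hi e - lo e = \<bar>(p e - q e) \<bullet> u\<bar>"
      by (simp add: hi_def lo_def \<pi>_def inner_diff_left max_def min_def)
    ultimately show "((\<lambda>t. if t \<in> {lo e..hi e} then 1 else (0::real)) has_integral \<bar>(p e - q e) \<bullet> u\<bar>) {m..M}"
      by (subst has_integral_restrict[OF sub[OF e]]) simp
  qed
  moreover have "((\<lambda>t. \<Sum>e | e edge_of S. if t \<in> {lo e..hi e} then 1 else (0::real)) has_integral 2 * (M - m)) {m..M}"
  \<comment> \<open>The exceptional levels are those of the vertices, where the number of edges met
    may differ from 2.\<close>
  proof (rule has_integral_spike_finite[of "\<pi> ` V"])
    show "finite (\<pi> ` V)" using V by simp
    have "m \<le> M" unfolding m_def M_def using V by (meson Max_ge Min_le finite_imageI image_is_empty order_trans Max_in)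
    thus "((\<lambda>t. 2::real) has_integral 2 * (M - m)) {m..M}"
      using has_integral_const_real[of "2::real" m M] by (simp add: mult.commute)
    fix t assume t: "t \<in> {m..M} - \<pi> ` V"
    have "m \<in> \<pi> ` V" "M \<in> \<pi> ` V" unfolding m_def M_def using V by (auto intro!: Min_in Max_in)
    then obtain x y where xy: "x \<in> V" "y \<in> V" "\<pi> x = m" "\<pi> y = M" by auto
    hence "\<pi> x < t" "t < \<pi> y" using t by (force simp: less_le)+
    hence c: "card {e. e edge_of S \<and> t \<in> \<pi> ` e} = 2" unfolding S_def \<pi>_def
      by (intro line_meets_two_edges[OF V(1,3) u xy(1) _ xy(2)]) (use t in \<open>auto simp: \<pi>_def\<close>)
    have "(\<Sum>e | e edge_of S. if t \<in> {lo e..hi e} then 1 else (0::real)) =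
          (\<Sum>e | e edge_of S. if t \<in> \<pi> ` e then 1 else (0::real))"
      using img by (intro sum.cong) auto
    also have "\<dots> = real (card ({e. e edge_of S} \<inter> {e. t \<in> \<pi> ` e}))"
      by (subst sum.If_cases[OF E]) simp
    also have "{e. e edge_of S} \<inter> {e. t \<in> \<pi> ` e} = {e. e edge_of S \<and> t \<in> \<pi> ` e}" by auto
    finally show "(\<Sum>e | e edge_of S. if t \<in> {lo e..hi e} then 1 else (0::real)) = 2" using c by simp
  qed
  ultimately show ?thesis unfolding S_def M_def m_def \<pi>_def by (rule has_integral_unique)
qed

section \<open>Integrals of periodic functions and mean projections of segments\<close>

lemmas integral_combine_Icc = Henstock_Kurzweil_Integration.integral_combine

lemma integral_periodic_shift:
  fixes g :: "real \<Rightarrow> real"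
  assumes g: "continuous_on UNIV g" "\<And>x. g (x + p) = g x" and bc: "b \<le> c" "c \<le> b + p"
  shows "integral {b..b+p} g = integral {c..c+p} g"
proof -
  have int: "g integrable_on {x..y}" for x y
    by (intro integrable_continuous_real continuous_on_subset[OF g(1)]) auto
  have "integral {b..b+p} g = integral {b..c} g + integral {c..b+p} g"
    using bc integral_combine_Icc[of b c "b+p" g] int by simp
  also have "integral {b..c} g = integral {b+p..c+p} g"
    using integral_shift_real_ivl[of "b+p" p "c+p" g] g(2) by simp
  also have "integral {b+p..c+p} g + integral {c..b+p} g = integral {c..c+p} g"
    using bc integral_combine_Icc[of c "b+p" "c+p" g] int by simp
  finally show ?thesis .
qed

text \<open>For functions on the circle the stretch is the effect of \<open>z ^ n\<close>, which
  runs around the circle \<open>n\<close> times.\<close>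

lemma integral_periodic_stretch:
  fixes g :: "real \<Rightarrow> real"
  assumes g: "continuous_on UNIV g" "\<And>x. g (x + p) = g x" and p: "p > 0" and n: "n > 0"
  shows "integral {0..p} (\<lambda>x. g (real n * x)) = integral {0..p} g"
proof -
  have int: "g integrable_on {x..y}" for x y
    by (intro integrable_continuous_real continuous_on_subset[OF g(1)]) auto
  have per: "integral {real k * p..real k * p + p} g = integral {0..p} g" for k
  proof (induction k)
    case (Suc k)
    thus ?case using integral_periodic_shift[OF g, of "real k * p" "real (Suc k) * p"] p by (simp add: algebra_simps)
  qed simp
  have mult: "integral {0..real k * p} g = real k * integral {0..p} g" for k
  proof (induction k)
    case (Suc k)
    have "integral {0..real (Suc k) * p} g = integral {0..real k * p} g + integral {real k * p..real k * p + p} g"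
      using p integral_combine_Icc[of 0 "real k * p" "real k * p + p" g] int by (simp add: algebra_simps)
    thus ?case using Suc per by (simp add: algebra_simps)
  qed simp
  have "(g has_integral real n * integral {0..p} g) {0..real n * p}"
    using int[of 0 "real n * p"] mult[of n] by (simp add: has_integral_iff)
  from has_integral_stretch_real[OF this, of "real n"] n
  have "((\<lambda>x. g (real n * x)) has_integral integral {0..p} g) ((\<lambda>x. x / real n) ` {0..real n * p})"
    by simp
  also have "(\<lambda>x. x / real n) ` {0..real n * p} = {0..p}"
    using n p by (subst image_divide_atLeastAtMost) auto
  finally show ?thesis by blast
qed

lemma integral_abs_cos: "integral {0..2*pi} (\<lambda>t. \<bar>cos t\<bar>) = 4"
proof -
  have "((\<lambda>t. \<bar>cos t\<bar>) has_integral (sin (pi/2) - sin (-pi/2))) {-pi/2..pi/2}"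
  proof (rule has_integral_eq)
    show "(cos has_integral (sin (pi/2) - sin (-pi/2))) {-pi/2..pi/2}"
      by (rule fundamental_theorem_of_calculus) (auto intro!: derivative_eq_intros simp flip: has_real_derivative_iff_has_vector_derivative)
  qed (use cos_ge_zero in auto)
  moreover have "((\<lambda>t. \<bar>cos t\<bar>) has_integral ((- sin (3*pi/2)) - (- sin (pi/2)))) {pi/2..3*pi/2}"
  proof (rule has_integral_eq)
    show "((\<lambda>t. - cos t) has_integral ((- sin (3*pi/2)) - (- sin (pi/2)))) {pi/2..3*pi/2}"
      by (rule fundamental_theorem_of_calculus) (auto intro!: derivative_eq_intros simp flip: has_real_derivative_iff_has_vector_derivative)
    fix t assume "t \<in> {pi/2..3*pi/2}"
    hence "cos (t - pi) \<ge> 0" by (intro cos_ge_zero) auto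
    thus "- cos t = \<bar>cos t\<bar>" by simp
  qed
  ultimately have "((\<lambda>t. \<bar>cos t\<bar>) has_integral
     ((sin (pi/2) - sin (-pi/2)) + ((- sin (3*pi/2)) - (- sin (pi/2))))) {-pi/2..3*pi/2}"
    by (intro has_integral_combine[of "-pi/2" "pi/2" "3*pi/2"]) auto
  moreover have "sin (3*pi/2) = -1" using sin_3over2_pi by (simp add: mult.commute)
  ultimately have "integral {-pi/2..-pi/2+2*pi} (\<lambda>t. \<bar>cos t\<bar>) = 4" by (auto simp: integral_unique)
  moreover have "continuous_on UNIV (\<lambda>t::real. \<bar>cos t\<bar>)" by (intro continuous_intros)
  ultimately show ?thesis using integral_periodic_shift[of "\<lambda>t. \<bar>cos t\<bar>" "2*pi" "-pi/2" 0] by simp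
qed

lemma integral_abs_inner_cis: "integral {0..2*pi} (\<lambda>t. \<bar>w \<bullet> cis t\<bar>) = 4 * norm w"
proof -
  have "w \<bullet> cis t = norm w * cos (t + - Arg2pi w)" for t
  proof -
    have "w = of_real (norm w) * cis (Arg2pi w)" using Arg2pi_eq[of w] by (simp add: cis_conv_exp)
    hence "w \<bullet> cis t = (of_real (norm w) * cis (Arg2pi w)) \<bullet> cis t" by simp
    thus ?thesis by (simp add: inner_complex_def cos_diff algebra_simps)
  qed
  hence "integral {0..2*pi} (\<lambda>t. \<bar>w \<bullet> cis t\<bar>) = norm w * integral {0..2*pi} (\<lambda>t. \<bar>cos (t + - Arg2pi w)\<bar>)"
    by (simp add: abs_mult)
  also have "integral {0..2*pi} (\<lambda>t. \<bar>cos (t + - Arg2pi w)\<bar>) = integral {- Arg2pi w..- Arg2pi w + 2*pi} (\<lambda>t. \<bar>cos t\<bar>)"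
    using integral_shift_real_ivl[of "- Arg2pi w" "- Arg2pi w" "2*pi - Arg2pi w" "\<lambda>t. \<bar>cos t\<bar>"] by simp
  also have "\<dots> = integral {0..0 + 2*pi} (\<lambda>t. \<bar>cos t\<bar>)"
    by (rule integral_periodic_shift) (use Arg2pi_ge_0[of w] Arg2pi_lt_2pi[of w] in \<open>auto intro!: continuous_intros\<close>)
  finally show ?thesis by (simp add: integral_abs_cos)
qed

lemma continuous_on_Max_image:
  fixes g :: "'b \<Rightarrow> 'a::topological_space \<Rightarrow> real"
  assumes "finite V" "V \<noteq> {}" "\<And>v. v \<in> V \<Longrightarrow> continuous_on T (g v)"
  shows "continuous_on T (\<lambda>t. Max ((\<lambda>v. g v t) ` V))"
  using assms
proof (induction V rule: finite_ne_induct)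
  case (insert x F)
  have "Max ((\<lambda>v. g v t) ` insert x F) = max (g x t) (Max ((\<lambda>v. g v t) ` F))" for t
    using insert by simp
  thus ?case using insert by (auto intro!: continuous_on_max)
qed auto

lemma diameter_segment: "diameter (closed_segment a b) = norm (a - b)" for a b :: complex
proof -
  have "aff_dim (closed_segment a b) \<noteq> 2"
    by (simp add: segment_convex_hull aff_dim_convex_hull)
  thus ?thesis using circumference_segment[of a b] by (simp add: circumference_def dist_norm)
qed

text \<open>The support function of the convex hull of \<open>V\<close>. Since
  \<open>cnj \<zeta> \<bullet> u = Re (\<zeta> * u)\<close>, its value at \<open>u = z ^ n\<close>
  is the growth exponent of an exponential sum with frequencies \<open>\<zeta>\<close>, which is why
  \<open>W\<close> consists of conjugates. The direction \<open>u\<close> is not normalised, so the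
  function is positively homogeneous.\<close>

definition support_fun :: "complex set \<Rightarrow> complex \<Rightarrow> real" where
  "support_fun V u = Max ((\<lambda>v. v \<bullet> u) ` V)"

text \<open>The width of the hull in direction \<open>t\<close> is \<open>h t + h (t + pi)\<close>,
  and twice the width is the sum of the projected edge lengths. A segment of length 1 has total
  projection 4 over all directions, so four times the perimeter equals four times the integral of
  \<open>h\<close>. If the hull is a segment, the width is its projection, and the integral is twice
  its length, in agreement with the degenerate case of \<open>circumference\<close>.\<close>

lemma circumference_eq_integral_support_fun:
  assumes V: "finite V" "V \<noteq> {}"
  shows "integral {0..2*pi} (\<lambda>t. support_fun V (cis t)) = circumference (convex hull V)"
proof -
  define h where "h = (\<lambda>t. support_fun V (cis t))"
  have conth: "continuous_on UNIV h" unfolding h_def support_fun_def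
    by (intro continuous_on_Max_image V continuous_intros)
  have hp: "h (x + 2 * pi) = h x" for x by (simp add: h_def cis.code)
  have ci: "continuous_on A g \<Longrightarrow> A = {x..y} \<Longrightarrow> g integrable_on {x..y}" for g :: "real \<Rightarrow> real" and A x y
    by (simp add: integrable_continuous_real)
  have hint: "h integrable_on {x..y}" for x y
    by (rule ci[OF continuous_on_subset[OF conth subset_UNIV] refl])
  have hshift: "integral {0..2*pi} (\<lambda>t. h (t + pi)) = integral {0..2*pi} h"
    using integral_shift_real_ivl[of pi pi "2*pi+pi" h] integral_periodic_shift[OF conth hp, of 0 pi]
    by (simp add: add.commute)
  have hsint: "(\<lambda>t. h (t + pi)) integrable_on {0..2*pi}"
    by (rule ci[OF _ refl]) (intro continuous_on_compose2[OF conth] continuous_intros; simp)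
  define w where "w = (\<lambda>t. Max ((\<lambda>v. v \<bullet> cis t) ` V) - Min ((\<lambda>v. v \<bullet> cis t) ` V))"
  have w: "w t = h t + h (t + pi)" for t
  proof -
    have "cis (t + pi) = - cis t" by (simp add: complex_eq_iff)
    hence "h (t + pi) = Max (uminus ` ((\<lambda>v. v \<bullet> cis t) ` V))" by (simp add: h_def support_fun_def image_image)
    also have "\<dots> = - Min ((\<lambda>v. v \<bullet> cis t) ` V)" using V by (subst minus_Min_eq_Max) auto
    finally show ?thesis by (simp add: w_def h_def support_fun_def)
  qed
  have intw: "integral {0..2*pi} w = 2 * integral {0..2*pi} h"
    unfolding w using hshift hint hsint by (simp add: integral_add)
  have cint: "(\<lambda>t. \<bar>c \<bullet> cis t\<bar>) integrable_on {0..2*pi}" for c :: complex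
    by (rule ci[OF _ refl]) (intro continuous_intros)
  show ?thesis
  proof (cases "aff_dim (convex hull V) = 2")
    case True
    define S where "S = convex hull V"
    have poly: "polytope S" unfolding S_def using V(1) by (rule polytope_convex_hull)
    note E = polygon_edges[OF poly True[folded S_def]]
    obtain p q where pq: "\<And>e. e edge_of S \<Longrightarrow> e = closed_segment (p e) (q e)" using E(3) by metis
    have "2 * w t = (\<Sum>e | e edge_of S. \<bar>(p e - q e) \<bullet> cis t\<bar>)" for t
      unfolding w_def S_def by (rule sum_edge_projections[symmetric]) (use V True pq in \<open>auto simp: S_def\<close>)
    hence "integral {0..2*pi} (\<lambda>t. 2 * w t) = (\<Sum>e | e edge_of S. integral {0..2*pi} (\<lambda>t. \<bar>(p e - q e) \<bullet> cis t\<bar>))"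
      by (simp add: integral_sum E(1) cint)
    also have "\<dots> = (\<Sum>e | e edge_of S. 4 * diameter e)"
    proof (intro sum.cong refl)
      fix e assume "e \<in> {e. e edge_of S}"
      hence "e = closed_segment (p e) (q e)" using pq by auto
      hence "diameter e = norm (p e - q e)" using diameter_segment by metis
      thus "integral {0..2*pi} (\<lambda>t. \<bar>(p e - q e) \<bullet> cis t\<bar>) = 4 * diameter e" by (simp add: integral_abs_inner_cis)
    qed
    also have "\<dots> = 4 * circumference S" using True by (simp add: circumference_def sum_distrib_left S_def)
    finally show ?thesis using intw by (simp add: h_def S_def)
  next
    case False
    have "aff_dim (convex hull V) \<le> 2" using aff_dim_le_DIM[of "convex hull V"] by simp
    hence "collinear (convex hull V)" using False by (simp add: collinear_aff_dim)
    then obtain a b where ab: "convex hull V = closed_segment a b"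
      using compact_convex_collinear_segment[of "convex hull V"] V by (auto simp: finite_imp_compact_convex_hull)
    have "w t = \<bar>(a - b) \<bullet> cis t\<bar>" for t
    proof -
      have mx: "Max ((\<lambda>v. v \<bullet> u) ` V) = max (a \<bullet> u) (b \<bullet> u)" for u
      proof (rule antisym)
        have "V \<subseteq> convex hull {a, b}" using ab hull_subset[of V convex] by (simp add: segment_convex_hull)
        also have "convex hull {a, b} \<subseteq> {x. u \<bullet> x \<le> max (a \<bullet> u) (b \<bullet> u)}"
          by (intro hull_minimal convex_halfspace_le) (auto simp: inner_commute)
        finally show "Max ((\<lambda>v. v \<bullet> u) ` V) \<le> max (a \<bullet> u) (b \<bullet> u)"
          using V by (auto simp: inner_commute)
        have "convex hull V \<subseteq> {x. u \<bullet> x \<le> Max ((\<lambda>v. v \<bullet> u) ` V)}"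
          by (intro hull_minimal convex_halfspace_le) (use V in \<open>auto simp: inner_commute[of u] intro!: Max_ge\<close>)
        moreover have "a \<in> convex hull V" "b \<in> convex hull V" by (auto simp: ab)
        ultimately show "max (a \<bullet> u) (b \<bullet> u) \<le> Max ((\<lambda>v. v \<bullet> u) ` V)" by (auto simp: inner_commute)
      qed
      have "w t = h t + h (t + pi)" by (rule w)
      moreover have "cis (t + pi) = - cis t" by (simp add: complex_eq_iff)
      ultimately show ?thesis
        by (simp add: h_def support_fun_def mx[of "cis t"] mx[of "- cis t", simplified] inner_diff_left max_def)
    qed
    hence "w = (\<lambda>t. \<bar>(a - b) \<bullet> cis t\<bar>)" by auto
    hence "integral {0..2*pi} w = 4 * norm (a - b)" by (simp only: integral_abs_inner_cis)
    moreover have "circumference (convex hull V) = 2 * norm (a - b)"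
      unfolding ab by (simp add: circumference_segment dist_norm)
    ultimately show ?thesis using intw by (simp add: h_def)
  qed
qed

section \<open>Solutions with few zeros\<close>

text \<open>Exponents are not tracked: in the final lower bound for the mean these quantities enter
  only through their logarithms, which are negligible against \<open>r ^ n\<close>. The bound is
  one-sided, hence the sign conditions for products and powers.\<close>

definition poly_bounded :: "(real \<Rightarrow> real) \<Rightarrow> bool" where
  "poly_bounded X \<longleftrightarrow> (\<exists>C\<ge>0. \<exists>K::nat. \<forall>R\<ge>1. X R \<le> C * R ^ K)"

lemma poly_boundedI: "C \<ge> 0 \<Longrightarrow> (\<And>R. R \<ge> 1 \<Longrightarrow> X R \<le> C * R ^ K) \<Longrightarrow> poly_bounded X"
  unfolding poly_bounded_def by blast

lemma poly_bounded_const: "poly_bounded (\<lambda>_. c)"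
  by (rule poly_boundedI[of "\<bar>c\<bar>" _ 0]) auto

lemma poly_bounded_id: "poly_bounded (\<lambda>R. R)"
  by (rule poly_boundedI[of 1 _ 1]) auto

lemma poly_bounded_mono:
  assumes "poly_bounded Y" "\<And>R. R \<ge> 1 \<Longrightarrow> X R \<le> Y R"
  shows "poly_bounded X"
  using assms unfolding poly_bounded_def by (meson order_trans)

lemma poly_bounded_add:
  assumes "poly_bounded X" "poly_bounded Y"
  shows "poly_bounded (\<lambda>R. X R + Y R)"
proof -
  obtain C K C' K' where C: "C \<ge> 0" "C' \<ge> 0" "\<And>R. R \<ge> 1 \<Longrightarrow> X R \<le> C * R ^ K" "\<And>R. R \<ge> 1 \<Longrightarrow> Y R \<le> C' * R ^ K'"
    using assms unfolding poly_bounded_def by metis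
  show ?thesis
  proof (rule poly_boundedI[of "C + C'" _ "K + K'"])
    fix R :: real assume R: "R \<ge> 1"
    have "X R + Y R \<le> C * R ^ K + C' * R ^ K'" using C R by (intro add_mono) auto
    also have "\<dots> \<le> C * R ^ (K + K') + C' * R ^ (K + K')"
      using C R by (intro add_mono mult_left_mono power_increasing) auto
    finally show "X R + Y R \<le> (C + C') * R ^ (K + K')" by (simp add: algebra_simps)
  qed (use C in auto)
qed

lemma poly_bounded_mult:
  assumes "poly_bounded X" "poly_bounded Y" "\<And>R. R \<ge> 1 \<Longrightarrow> 0 \<le> Y R"
  shows "poly_bounded (\<lambda>R. X R * Y R)"
proof -
  obtain C K C' K' where C: "C \<ge> 0" "C' \<ge> 0" "\<And>R. R \<ge> 1 \<Longrightarrow> X R \<le> C * R ^ K" "\<And>R. R \<ge> 1 \<Longrightarrow> Y R \<le> C' * R ^ K'"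
    using assms unfolding poly_bounded_def by metis
  show ?thesis
  proof (rule poly_boundedI[of "C * C'" _ "K + K'"])
    fix R :: real assume R: "R \<ge> 1"
    have "X R * Y R \<le> (C * R ^ K) * (C' * R ^ K')" using C R assms(3) by (intro mult_mono) auto
    thus "X R * Y R \<le> (C * C') * R ^ (K + K')" by (simp add: algebra_simps power_add)
  qed (use C in auto)
qed

lemma poly_bounded_power:
  assumes "poly_bounded X" "\<And>R. R \<ge> 1 \<Longrightarrow> 0 \<le> X R"
  shows "poly_bounded (\<lambda>R. X R ^ k)"
  by (induction k) (auto intro!: poly_bounded_const poly_bounded_mult assms simp: zero_le_power assms)

lemma poly_bounded_scale:
  assumes "poly_bounded X" "c \<ge> 1"
  shows "poly_bounded (\<lambda>R. X (c * R))"
proof -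
  obtain C K where C: "C \<ge> 0" "\<And>R. R \<ge> 1 \<Longrightarrow> X R \<le> C * R ^ K"
    using assms unfolding poly_bounded_def by metis
  show ?thesis
  proof (rule poly_boundedI[of "C * c ^ K" _ K])
    fix R :: real assume R: "R \<ge> 1"
    have "1 * 1 \<le> c * R" using R assms(2) by (intro mult_mono) auto
    thus "X (c * R) \<le> C * c ^ K * R ^ K" using C(2)[of "c * R"] by (simp add: power_mult_distrib mult.assoc)
  qed (use C assms in auto)
qed

lemmas poly_bounded_intros = poly_bounded_const poly_bounded_id poly_bounded_add poly_bounded_mult
  poly_bounded_power

lemma continuous_on_ln_norm:
  assumes "P holomorphic_on UNIV" "zero_free P r"
  shows "continuous_on (sphere 0 r) (\<lambda>z. ln (norm (P z)))"
  using assms by (auto intro!: continuous_intros holomorphic_on_imp_continuous_on holomorphic_on_subset[OF assms(1)]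
    simp: zero_free_def)

text \<open>Because \<open>\<bar>u\<bar> = 2 * max 0 u - u\<close>, a pointwise upper bound controls
  the absolute value in mean as soon as the mean itself is bounded below, which Jensen's formula
  provides.\<close>

lemma circle_mean_abs_le:
  assumes u: "continuous_on (sphere 0 r) u" and r: "r > 0" and le: "\<And>z. norm z = r \<Longrightarrow> max 0 (u z) \<le> B"
  shows "circle_mean (\<lambda>z. \<bar>u z\<bar>) r \<le> 2 * B - circle_mean u r"
proof -
  have "circle_mean (\<lambda>z. \<bar>u z\<bar>) r \<le> circle_mean (\<lambda>z. 2 * B - u z) r"
  proof (rule circle_mean_mono)
    show "\<bar>u z\<bar> \<le> 2 * B - u z" if "norm z = r" for z using le[OF that] by linarith
  qed (intro continuous_intros u r)+
  also have "\<dots> = 2 * B - circle_mean u r"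
    using u r by (subst circle_mean_diff) auto
  finally show ?thesis .
qed

text \<open>An upper model for the contribution of \<open>A^2 * E\<close> to a log modulus: twice ln
  |A| from the square, less the decay of \<open>E\<close> where \<open>A\<close> is large. It
  increases with ln |P|, with slope 2 or 3/2, so upper bounds for ln |A| carry over.\<close>

abbreviation damped_log :: "(complex \<Rightarrow> complex) \<Rightarrow> complex \<Rightarrow> real" where
  "damped_log P z \<equiv> 2 * ln (norm (P z)) - max 0 (ln (norm (P z))) / 2"

lemma Cauchy_deriv_bounds:
  assumes g: "g holomorphic_on ball a \<delta>" and \<delta>: "\<delta> > 0" and B: "\<And>z. z \<in> ball a \<delta> \<Longrightarrow> norm (g z) \<le> B"
  shows "norm (deriv g a) \<le> 2 * B / \<delta>" "norm (deriv (deriv g) a) \<le> 8 * B / \<delta>\<^sup>2"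
proof -
  have h: "g holomorphic_on ball a (\<delta>/2)" "continuous_on (cball a (\<delta>/2)) g"
    using \<delta> by (auto intro!: holomorphic_on_imp_continuous_on holomorphic_on_subset[OF g])
  have b: "norm (g x) \<le> B" if "norm (a - x) = \<delta>/2" for x using that \<delta> by (intro B) (auto simp: dist_norm)
  have "norm ((deriv ^^ k) g a) \<le> fact k * B / (\<delta>/2) ^ k" for k
    by (rule Cauchy_inequality[OF h _ b]) (use \<delta> in auto)
  from this[of 1] this[of 2] show "norm (deriv g a) \<le> 2 * B / \<delta>" "norm (deriv (deriv g) a) \<le> 8 * B / \<delta>\<^sup>2"
    by (simp_all add: numeral_2_eq_2 field_simps)
qed

text \<open>The maximum principle carries the bound inwards. The size of the circle is irrelevant
  because the bound is expressed in \<open>R\<close>, here \<open>1 + norm z\<close>.\<close>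

lemma poly_growth_from_circles:
  assumes P: "P holomorphic_on UNIV" and X: "poly_bounded X"
    and circles: "\<And>R. R \<ge> 1 \<Longrightarrow> \<exists>r\<ge>R. \<forall>z. norm z = r \<longrightarrow> norm (P z) \<le> X R"
  shows "\<exists>C\<ge>0. \<exists>K. \<forall>z. norm (P z) \<le> C * (1 + norm z) ^ K"
proof -
  obtain C K where C: "C \<ge> 0" "\<And>R. R \<ge> 1 \<Longrightarrow> X R \<le> C * R ^ K" using X unfolding poly_bounded_def by blast
  have "norm (P z) \<le> C * (1 + norm z) ^ K" for z
  proof -
    define R where "R = 1 + norm z"
    have R: "R \<ge> 1" by (simp add: R_def)
    obtain r where r: "r \<ge> R" "\<And>z. norm z = r \<Longrightarrow> norm (P z) \<le> X R" using circles[OF R] by blast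
    have "norm (P z) \<le> X R"
    proof (rule maximum_modulus_frontier[of P "cball 0 r"])
      show "P holomorphic_on interior (cball 0 r)" using P by (rule holomorphic_on_subset) auto
      show "continuous_on (closure (cball 0 r)) P"
        by (intro holomorphic_on_imp_continuous_on holomorphic_on_subset[OF P]) auto
      show "z \<in> cball 0 r" using r R_def by auto
    qed (use r R in auto)
    also have "\<dots> \<le> C * R ^ K" by (rule C(2)[OF R])
    finally show ?thesis by (simp add: R_def)
  qed
  thus ?thesis using C(1) by blast
qed

text \<open>The coarse exponent \<open>n\<close> serves for the growth of \<open>A\<close> and the
  zeros of \<open>f\<close>, which is enough for polynomial bounds. The sharper count, of order
  below \<open>n\<close>, is used at the end through the term \<open>zero_count f r\<close> of
  \<open>mean_log_A_lower\<close>.\<close>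

locale sparse_solution =
  fixes A f :: "complex \<Rightarrow> complex" and C0 :: real and n :: nat
  assumes A: "A holomorphic_on UNIV" "\<exists>z. A z \<noteq> 0"
    and f: "f holomorphic_on UNIV" "\<exists>z. f z \<noteq> 0"
    and ode: "\<And>z. deriv (deriv f) z + A z * f z = 0"
    and C0: "C0 \<ge> 0"
    and A_growth: "\<And>R z. R \<ge> 1 \<Longrightarrow> norm z \<le> R \<Longrightarrow> norm (A z) \<le> exp (C0 * R ^ n)"
    and f_zeros: "\<And>R. R \<ge> 1 \<Longrightarrow> zero_count f R \<le> C0 * R ^ n"
begin

section \<open>A priori bounds for a solution and its derivative\<close>

lemma f': "deriv f holomorphic_on UNIV" "\<exists>z. deriv f z \<noteq> 0"
proof -
  show "deriv f holomorphic_on UNIV" using f(1) by (rule holomorphic_deriv) auto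
  show "\<exists>z. deriv f z \<noteq> 0"
  proof (rule ccontr)
    assume "\<not> ?thesis"
    hence d: "deriv f = (\<lambda>_. 0)" by auto
    have "f constant_on UNIV"
    proof (rule has_field_derivative_0_imp_constant_on)
      show "(f has_field_derivative 0) (at z)" for z using holomorphic_derivI[OF f(1) open_UNIV, of z] d by simp
    qed auto
    then obtain c where c: "\<And>z. f z = c" by (auto simp: constant_on_def)
    with f(2) have "c \<noteq> 0" by auto
    moreover have "A z * c = 0" for z using ode[of z] d c by simp
    ultimately show False using A(2) by auto
  qed
qed

lemma A': "deriv A holomorphic_on UNIV" using A(1) by (rule holomorphic_deriv) auto

lemma count_f: "poly_bounded (zero_count f)"
  by (rule poly_boundedI[OF C0 f_zeros])

lemma f_growth:
  "\<exists>X. poly_bounded X \<and> (\<forall>R\<ge>1. X R \<ge> 0 \<and> (\<forall>z. norm z \<le> R \<longrightarrow> ln (max 1 (norm (f z))) \<le> exp (X R)))"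
proof -
  define V where "V = max 1 ((norm (f 0))\<^sup>2 + (norm (deriv f 0))\<^sup>2)"
  \<comment> \<open>The summands are the exponents obtained when the constant factor
    \<open>ln V + 2\<close>, the factor \<open>R\<close> and the bound for \<open>A\<close> are each
    written as, or bounded by, an exponential.\<close>
  define X where "X = (\<lambda>R::real. ln V + 2 + R + C0 * R ^ n)"
  have V: "V \<ge> 1" by (simp add: V_def)
  have "poly_bounded X" unfolding X_def using C0 by (intro poly_bounded_intros) auto
  moreover have "ln (max 1 (norm (f z))) \<le> exp (X R)" if R: "R \<ge> 1" "norm z \<le> R" for R z
  proof -
    define M where "M = exp (C0 * R ^ n)"
    have M: "M \<ge> 1" using C0 R by (simp add: M_def)
    have "(norm (f z))\<^sup>2 \<le> (norm (f z))\<^sup>2 + (norm (deriv f z))\<^sup>2" by simp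
    also have "\<dots> \<le> ((norm (f 0))\<^sup>2 + (norm (deriv f 0))\<^sup>2) * exp (R * (1 + M))"
      by (rule linear_ode_growth[OF f(1) ode]) (use A_growth[OF R(1)] R M in \<open>auto simp: M_def\<close>)
    also have "\<dots> \<le> V * exp (R * (1 + M))" by (intro mult_right_mono) (auto simp: V_def)
    finally have sq: "(norm (f z))\<^sup>2 \<le> V * exp (R * (1 + M))" .
    have one: "1 * 1 \<le> V * exp (R * (1 + M))" using V R M by (intro mult_mono) auto
    have "(max 1 (norm (f z)))\<^sup>2 \<le> V * exp (R * (1 + M))"
      using sq one by (auto simp: max_def)
    hence "ln ((max 1 (norm (f z)))\<^sup>2) \<le> ln (V * exp (R * (1 + M)))" by (subst ln_le_cancel_iff) (use V in auto)
    hence "2 * ln (max 1 (norm (f z))) \<le> ln V + R * (1 + M)" using V by (simp add: ln_mult ln_realpow)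
    moreover have "ln (max 1 (norm (f z))) \<ge> 0" by simp
    ultimately have "ln (max 1 (norm (f z))) \<le> ln V + R * (1 + M)" by linarith
    also have "\<dots> \<le> ln V * (R * M) + R * (2 * M)"
    proof (intro add_mono mult_left_mono)
      have "1 * 1 \<le> R * M" using R M by (intro mult_mono) auto
      thus "ln V \<le> ln V * (R * M)" using V mult_left_mono[of 1 "R * M" "ln V"] by simp
    qed (use R M in auto)
    also have "\<dots> = (ln V + 2) * (R * M)" by (simp add: algebra_simps)
    also have "\<dots> \<le> exp (ln V + 2) * (exp R * exp (C0 * R ^ n))"
      unfolding M_def using V R
      by (intro mult_mono) (auto intro: order_trans[OF _ exp_ge_add_one_self])
    also have "\<dots> = exp (X R)" by (simp add: X_def exp_add)
    finally show ?thesis .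
  qed
  moreover have "X R \<ge> 0" if "R \<ge> 1" for R using that V C0 by (simp add: X_def)
  ultimately show ?thesis by blast
qed

text \<open>First pass, with ln |f| bounded merely by an exponential. The bound obtained for f'/f is
  the exponential of a polynomial, which suffices because only its logarithm is used
  afterwards.\<close>

lemma log_deriv_f_bound:
  "\<exists>X. poly_bounded X \<and> (\<forall>R\<ge>1. X R \<ge> 0 \<and> (\<exists>\<rho>. R \<le> \<rho> \<and> \<rho> \<le> 2 * R \<and> zero_free f \<rho> \<and> zero_free (deriv f) \<rho> \<and>
     (\<forall>z. norm z = \<rho> \<longrightarrow> norm (deriv f z / f z) \<le> exp (X R))))"
proof -
  obtain Y where Y: "poly_bounded Y" "\<And>R. R \<ge> 1 \<Longrightarrow> Y R \<ge> 0"
    "\<And>R z. R \<ge> 1 \<Longrightarrow> norm z \<le> R \<Longrightarrow> ln (max 1 (norm (f z))) \<le> exp (Y R)"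
    using f_growth by blast
  obtain C where C: "C \<ge> 0" "\<And>R. R \<ge> 1 \<Longrightarrow> zero_free f R \<Longrightarrow> mean_log f R \<ge> - C"
    using Jensen_bounds[OF f] by blast
  define N where "N = (\<lambda>R. zero_count f (8 * R))"
  have N0: "N R \<ge> 0" for R unfolding N_def by (rule zero_count_nonneg[OF f])
  have pN: "poly_bounded N" unfolding N_def by (intro poly_bounded_scale[OF count_f]) auto
  define Z where "Z = (\<lambda>R. 16 + 8 * C + 8 * (32 * R * N R) + N R * (4 * (N R + 1)))"
  define X where "X = (\<lambda>R. Y (8 * R) + Z R)"
  have Z0: "Z R \<ge> 0" if "R \<ge> 1" for R using that N0 C by (simp add: Z_def)
  have pX: "poly_bounded X" unfolding X_def Z_def
    using N0 by (intro poly_bounded_intros pN poly_bounded_scale[OF Y(1)]) auto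
  have main: "\<exists>\<rho>. R \<le> \<rho> \<and> \<rho> \<le> 2 * R \<and> zero_free f \<rho> \<and> zero_free (deriv f) \<rho> \<and>
     (\<forall>z. norm z = \<rho> \<longrightarrow> norm (deriv f z / f z) \<le> exp (X R))" if R: "R \<ge> 1" for R
  proof -
    \<comment> \<open>Starting at \<open>4 * R\<close> places all circles of radius at most
      \<open>2 * R\<close> in the disc of half the radius \<open>R'\<close>; the zeros of
      \<open>f\<close> in question are all counted by \<open>N\<close>, at radius
      \<open>8 * R\<close>.\<close>
    obtain R' where R': "4 * R \<le> R'" "R' \<le> 2 * (4 * R)" and zfR': "zero_free f R'"
      using exists_zero_free_radius[OF f, of "4 * R"] R by auto
    define S where "S = norm ` (zeros_in f (8*R))"
    have fS: "finite S" unfolding S_def using entire_finite_zeros(2)[OF f] by auto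
    have "card S \<le> card (zeros_in f (8*R))" unfolding S_def
      by (rule card_image_le[OF entire_finite_zeros(2)[OF f]])
    hence cS: "real (card S) \<le> N R" using card_zeros_le_zero_count[OF f, of "8*R"] unfolding N_def by linarith
    define B where "B = 4 * (N R + 1)"
    have B: "B > 0" using N0[of R] by (simp add: B_def)
    have \<delta>: "1 / B \<le> R / (4 * (real (card S) + 1))" unfolding B_def using cS R by (intro frac_le) auto
    \<comment> \<open>The zeros of \<open>deriv f\<close> are avoided without a margin, as no bound
      on their number is available yet.\<close>
    have "finite (norm ` {a \<in> cball 0 (2*R). deriv f a = 0})" using entire_finite_zeros(1)[OF f'] by auto
    from radius_avoiding_points[OF fS order_refl this, of R] R
    obtain \<rho> where \<rho>: "R \<le> \<rho>" "\<rho> \<le> 2 * R" "\<And>s. s \<in> S \<Longrightarrow> \<bar>s - \<rho>\<bar> \<ge> R / (4 * (real (card S) + 1))"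
      "\<rho> \<notin> norm ` {a \<in> cball 0 (2*R). deriv f a = 0}" by auto
    have far: "1 / B \<le> norm (z - a)" if "norm z = \<rho>" "norm a < 8 * R" "f a = 0" for z a
    proof -
      have "\<bar>norm a - \<rho>\<bar> \<ge> 1 / B" using that by (intro order_trans[OF \<delta>] \<rho>) (auto simp: S_def)
      thus ?thesis using norm_triangle_ineq3[of z a] that by (simp add: abs_minus_commute)
    qed
    have zf: "zero_free f \<rho>" using far[of a a for a] B \<rho> R unfolding zero_free_def by force
    have zf': "zero_free (deriv f) \<rho>" by (rule zero_freeI[OF \<rho>(4)]) (use \<rho> in auto)
    have "norm (deriv f z / f z) \<le> exp (X R)" if z: "norm z = \<rho>" for z
    proof -
      have cont: "continuous_on (sphere 0 R') (\<lambda>z. ln (norm (f z)))" by (rule continuous_on_ln_norm[OF f(1) zfR'])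
      have mean: "circle_mean (\<lambda>w. \<bar>ln (norm (f w))\<bar>) R' \<le> 2 * exp (Y (8 * R)) + C"
      proof -
        have "circle_mean (\<lambda>w. \<bar>ln (norm (f w))\<bar>) R' \<le> 2 * exp (Y (8 * R)) - mean_log f R'"
        proof (rule circle_mean_abs_le[OF cont])
          fix w :: complex assume w: "norm w = R'"
          have "max 0 (ln (norm (f w))) \<le> ln (max 1 (norm (f w)))"
            using zfR' w by (auto simp: max_def zero_free_def)
          also have "\<dots> \<le> exp (Y (8 * R))" using w R R' by (intro Y(3)) auto
          finally show "max 0 (ln (norm (f w))) \<le> exp (Y (8 * R))" .
        qed (use R R' in auto)
        thus ?thesis using C(2)[OF _ zfR'] R R' by auto
      qed
      have cnt: "zero_count f R' \<le> N R" unfolding N_def using R' by (intro zero_count_mono f) auto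
      have "norm (deriv f z / f z) \<le> 8 * ((2 * exp (Y (8 * R)) + C) + 4 * R' * N R) + N R * B"
        by (rule log_deriv_bound_entire[OF f zfR' _ _ B _ cnt mean]) (use R R' z \<rho> far in auto)
      also have "\<dots> \<le> 8 * ((2 * exp (Y (8 * R)) + C) + 4 * (8 * R) * N R) + N R * B"
        using N0[of R] R' by (intro add_mono mult_left_mono mult_right_mono) auto
      also have "\<dots> = 16 * exp (Y (8 * R)) + (Z R - 16)" by (simp add: Z_def B_def)
      also have "\<dots> \<le> 16 * exp (Y (8 * R)) + (Z R - 16) * exp (Y (8 * R))"
      proof -
        have "Z R - 16 \<ge> 0" using R N0[of R] C by (simp add: Z_def)
        moreover have "exp (Y (8 * R)) \<ge> 1" using Y(2)[of "8*R"] R by simp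
        ultimately show ?thesis using mult_left_mono[of 1 "exp (Y (8 * R))" "Z R - 16"] by simp
      qed
      also have "\<dots> = Z R * exp (Y (8 * R))" by (simp add: algebra_simps)
      also have "\<dots> \<le> exp (Z R) * exp (Y (8 * R))"
        using exp_ge_add_one_self[of "Z R"] by (intro mult_right_mono) (linarith | simp)+
      also have "\<dots> = exp (X R)" by (simp add: X_def exp_add)
      finally show ?thesis .
    qed
    thus ?thesis using \<rho> zf zf' by blast
  qed
  have X0: "X R \<ge> 0" if "R \<ge> 1" for R using that Y(2)[of "8*R"] Z0[OF that] by (simp add: X_def)
  show ?thesis by (intro exI[of _ X] conjI allI impI pX main X0; assumption)
qed

lemma ln_f_le_log_deriv:
  assumes "f z \<noteq> 0" "deriv f z \<noteq> 0" "norm (deriv f z / f z) \<le> exp X"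
  shows "ln (norm (deriv f z)) - ln (norm (f z)) \<le> X"
proof -
  have "ln (norm (deriv f z / f z)) \<le> ln (exp X)"
    using assms by (subst ln_le_cancel_iff) auto
  thus ?thesis using assms by (simp add: norm_divide ln_div)
qed

text \<open>Second pass: Jensen's formula bounds the mean of ln |f'| from below and,
  \<open>f\<close> having few zeros, that of ln |f| from above. So the mean of ln |f'/f| is not too
  negative, and the crude pointwise upper bound then controls its absolute value in mean.\<close>

lemma mean_log_deriv_f:
  "\<exists>X. poly_bounded X \<and> (\<forall>R\<ge>1. \<exists>\<rho>. R \<le> \<rho> \<and> \<rho> \<le> 2 * R \<and> zero_free f \<rho> \<and> zero_free (deriv f) \<rho> \<and>
     mean_log_ratio (deriv f) f \<rho> \<le> X R \<and>
     mean_log (deriv f) \<rho> \<le> X R)"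
proof -
  obtain Y where Y: "poly_bounded Y" "\<And>R. R \<ge> 1 \<Longrightarrow> Y R \<ge> 0"
    "\<And>R. R \<ge> 1 \<Longrightarrow> \<exists>\<rho>. R \<le> \<rho> \<and> \<rho> \<le> 2 * R \<and> zero_free f \<rho> \<and> zero_free (deriv f) \<rho> \<and>
     (\<forall>z. norm z = \<rho> \<longrightarrow> norm (deriv f z / f z) \<le> exp (Y R))"
    using log_deriv_f_bound by blast
  obtain C where C: "C \<ge> 0"
    "\<And>R. R \<ge> 1 \<Longrightarrow> zero_free f R \<Longrightarrow> mean_log f R \<le> C + zero_count f R * (ln R + C)"
    using Jensen_bounds[OF f] by blast
  obtain C' where C': "C' \<ge> 0"
    "\<And>R. R \<ge> 1 \<Longrightarrow> zero_free (deriv f) R \<Longrightarrow> mean_log (deriv f) R \<ge> - C'"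
    using Jensen_bounds[OF f'] by blast
  define X where "X = (\<lambda>R. 2 * Y R + C' + (C + zero_count f (2 * R) * (2 * R + C)))"
  have pX: "poly_bounded X" unfolding X_def using C Y(2)
    by (intro poly_bounded_intros Y(1) poly_bounded_scale[OF count_f]) auto
  have main: "\<exists>\<rho>. R \<le> \<rho> \<and> \<rho> \<le> 2 * R \<and> zero_free f \<rho> \<and> zero_free (deriv f) \<rho> \<and>
     mean_log_ratio (deriv f) f \<rho> \<le> X R \<and>
     mean_log (deriv f) \<rho> \<le> X R" if R: "R \<ge> 1" for R
  proof -
    obtain \<rho> where \<rho>: "R \<le> \<rho>" "\<rho> \<le> 2 * R" "zero_free f \<rho>" "zero_free (deriv f) \<rho>"
      "\<And>z. norm z = \<rho> \<Longrightarrow> norm (deriv f z / f z) \<le> exp (Y R)" using Y(3)[OF R] by blast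
    have \<rho>0: "\<rho> > 0" "\<rho> \<ge> 1" using \<rho> R by auto
    note c = continuous_on_ln_norm[OF f(1) \<rho>(3)] continuous_on_ln_norm[OF f'(1) \<rho>(4)]
    have le: "ln (norm (deriv f z)) - ln (norm (f z)) \<le> Y R" if "norm z = \<rho>" for z
      using ln_f_le_log_deriv[of z "Y R"] \<rho>(3,4,5) that by (auto simp: zero_free_def)
    have diff: "circle_mean (\<lambda>z. ln (norm (deriv f z)) - ln (norm (f z))) \<rho> =
       mean_log (deriv f) \<rho> - mean_log f \<rho>"
      by (rule circle_mean_diff[OF c(2,1) \<rho>0(1)])
    have diffY: "circle_mean (\<lambda>z. ln (norm (deriv f z)) - ln (norm (f z))) \<rho> \<le> Y R"
      by (rule circle_mean_le_const[OF continuous_on_diff[OF c(2,1)] \<rho>0(1) le])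
    have mf: "mean_log f \<rho> \<le> C + zero_count f (2 * R) * (2 * R + C)"
    proof -
      have "zero_count f \<rho> * (ln \<rho> + C) \<le> zero_count f (2 * R) * (2 * R + C)"
        using \<rho> \<rho>0 C(1) ln_le_minus_one[of \<rho>] zero_count_mono[OF f \<rho>(2)] zero_count_nonneg[OF f]
        by (intro mult_mono) auto
      thus ?thesis using C(2)[OF \<rho>0(2) \<rho>(3)] by linarith
    qed
    have "mean_log_ratio (deriv f) f \<rho> \<le>
      2 * Y R - circle_mean (\<lambda>z. ln (norm (deriv f z)) - ln (norm (f z))) \<rho>"
      by (rule circle_mean_abs_le[OF continuous_on_diff[OF c(2,1)] \<rho>0(1)]) (use le Y(2)[OF R] in auto)
    also have "\<dots> \<le> X R" unfolding diff X_def using C'(2)[OF \<rho>0(2) \<rho>(4)] mf by linarith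
    finally have "mean_log_ratio (deriv f) f \<rho> \<le> X R" .
    moreover have "mean_log (deriv f) \<rho> \<le> X R"
      using diff diffY mf C'(1) Y(2)[OF R] unfolding X_def by linarith
    ultimately show ?thesis using \<rho> by blast
  qed
  show ?thesis by (intro exI[of _ X] conjI allI impI pX main; assumption)
qed

text \<open>Jensen's formula converts the mean of ln |f'| on a circle of radius at least
  \<open>3 * R\<close> into a count of zeros.\<close>

lemma count_f': "poly_bounded (zero_count (deriv f))"
proof -
  obtain Y where Y: "poly_bounded Y" "\<And>R. R \<ge> 1 \<Longrightarrow> \<exists>\<rho>. R \<le> \<rho> \<and> \<rho> \<le> 2 * R \<and> zero_free (deriv f) \<rho> \<and>
     mean_log (deriv f) \<rho> \<le> Y R"
    using mean_log_deriv_f by blast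
  obtain C where C: "C \<ge> 0" "\<And>r R. r \<ge> 1 \<Longrightarrow> R \<ge> 3 * r \<Longrightarrow> zero_free (deriv f) R \<Longrightarrow>
       zero_count (deriv f) r \<le> mean_log (deriv f) R + C"
    using Jensen_bounds[OF f'] by blast
  show ?thesis
  proof (rule poly_bounded_mono)
    show "poly_bounded (\<lambda>R. Y (3 * R) + C)" by (intro poly_bounded_intros poly_bounded_scale[OF Y(1)]) auto
    fix R :: real assume R: "R \<ge> 1"
    obtain \<rho> where \<rho>: "3 * R \<le> \<rho>" "zero_free (deriv f) \<rho>" "mean_log (deriv f) \<rho> \<le> Y (3 * R)"
      using Y(2)[of "3 * R"] R by auto
    show "zero_count (deriv f) R \<le> Y (3 * R) + C" using C(2)[OF R \<rho>(1,2)] \<rho>(3) by linarith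
  qed
qed

lemma ln_norm_A_le: "ln (norm (A z)) \<le> C0 * R ^ n" if "R \<ge> 1" "norm z \<le> R" "A z \<noteq> 0"
proof -
  have "ln (norm (A z)) \<le> ln (exp (C0 * R ^ n))" using A_growth[OF that(1,2)] that(3) by (subst ln_le_cancel_iff) auto
  thus ?thesis by simp
qed

lemma count_A: "poly_bounded (zero_count A)"
proof -
  obtain C where C: "C \<ge> 0" "\<And>r R. r \<ge> 1 \<Longrightarrow> R \<ge> 3 * r \<Longrightarrow> zero_free A R \<Longrightarrow>
       zero_count A r \<le> mean_log A R + C"
    using Jensen_bounds[OF A] by blast
  show ?thesis
  proof (rule poly_bounded_mono)
    show "poly_bounded (\<lambda>R. C0 * (6 * R) ^ n + C)" by (intro poly_bounded_intros) auto
    fix R :: real assume R: "R \<ge> 1"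
    obtain \<rho> where \<rho>: "3 * R \<le> \<rho>" "\<rho> \<le> 2 * (3 * R)" and zf: "zero_free A \<rho>"
      using exists_zero_free_radius[OF A, of "3 * R"] R by auto
    have "mean_log A \<rho> \<le> C0 * (6 * R) ^ n"
    proof (rule circle_mean_le_const[OF continuous_on_ln_norm[OF A(1) zf]])
      show "ln (norm (A z)) \<le> C0 * (6 * R) ^ n" if "norm z = \<rho>" for z
        by (rule ln_norm_A_le) (use R \<rho> zf that in \<open>auto simp: zero_free_def\<close>)
    qed (use R \<rho> in auto)
    thus "zero_count A R \<le> C0 * (6 * R) ^ n + C" using C(2)[OF R \<rho>(1) zf] by linarith
  qed
qed

lemma mean_log_A:
  obtains C where "C \<ge> 0" "\<And>r. r \<ge> 1 \<Longrightarrow> zero_free A r \<Longrightarrow>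
     circle_mean (\<lambda>z. \<bar>ln (norm (A z))\<bar>) r \<le> 2 * (C0 * r ^ n) + C"
proof -
  obtain C where C: "C \<ge> 0" "\<And>R. R \<ge> 1 \<Longrightarrow> zero_free A R \<Longrightarrow> mean_log A R \<ge> - C"
    using Jensen_bounds[OF A] by blast
  show ?thesis
  proof (rule that[OF C(1)])
    fix r :: real assume r: "r \<ge> 1" "zero_free A r"
    have "circle_mean (\<lambda>z. \<bar>ln (norm (A z))\<bar>) r \<le> 2 * (C0 * r ^ n) - mean_log A r"
      by (rule circle_mean_abs_le[OF continuous_on_ln_norm[OF A(1) r(2)]])
         (use r C0 ln_norm_A_le[of r] in \<open>auto simp: zero_free_def\<close>)
    thus "circle_mean (\<lambda>z. \<bar>ln (norm (A z))\<bar>) r \<le> 2 * (C0 * r ^ n) + C" using C(2)[OF r] by linarith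
  qed
qed

text \<open>With \<open>y = f' / f\<close>, one has \<open>y' = q y\<close> and \<open>A' = w A\<close>. The functions \<open>D\<close> and \<open>E\<close> are differential
  polynomials in \<open>q\<close> and \<open>w\<close> alone, hence small, although \<open>D = 2 y' - w y\<close> and \<open>y E = w D - 2 D'\<close>.\<close>

definition y where "y z = deriv f z / f z"
definition q where "q z = deriv (deriv f) z / deriv f z - deriv f z / f z"
definition w where "w z = deriv A z / A z"
definition D where "D z = w z * q z - deriv q z - (q z)\<^sup>2"
definition E where "E z = 4 * D z - (w z)\<^sup>2 + 2 * deriv w z"

text \<open>An annulus rather than a circle, since \<open>D\<close>, \<open>E\<close> and the
  derivative of \<open>D\<close> involve derivatives of \<open>q\<close> and \<open>w\<close>, which
  Cauchy's estimates bound on discs of radius \<open>\<delta>\<close>.\<close>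

definition good_annulus where
  "good_annulus B r \<delta> \<longleftrightarrow> \<delta> > 0 \<and> 1 / \<delta> \<le> B \<and> (\<forall>z. \<bar>norm z - r\<bar> < \<delta> \<longrightarrow>
     f z \<noteq> 0 \<and> deriv f z \<noteq> 0 \<and> A z \<noteq> 0 \<and> norm (q z) \<le> B \<and> norm (w z) \<le> B)"

text \<open>Since \<open>q\<close> is the logarithmic derivative of f'/f,
  \<open>log_deriv_bound\<close> applies to the pair \<open>deriv f\<close>, \<open>f\<close> and
  asks only for the mean and the zero counts already obtained. The set \<open>T\<close> leaves
  freedom to avoid the zeros of a function built later from \<open>f\<close> and
  \<open>A\<close>.\<close>

lemma exists_good_annulus:
  "\<exists>X. poly_bounded X \<and> (\<forall>R\<ge>1. X R \<ge> 1 \<and> (\<forall>T. finite T \<longrightarrow>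
     (\<exists>r \<delta>. R \<le> r \<and> r \<le> 2 * R \<and> r \<notin> T \<and> good_annulus (X R) r \<delta>)))"
proof -
  obtain Y where Y: "poly_bounded Y" "\<And>R. R \<ge> 1 \<Longrightarrow> \<exists>\<rho>. R \<le> \<rho> \<and> \<rho> \<le> 2 * R \<and> zero_free f \<rho> \<and> zero_free (deriv f) \<rho> \<and>
     mean_log_ratio (deriv f) f \<rho> \<le> Y R"
    using mean_log_deriv_f by blast
  obtain C where C: "C \<ge> 0" "\<And>r. r \<ge> 1 \<Longrightarrow> zero_free A r \<Longrightarrow>
     circle_mean (\<lambda>z. \<bar>ln (norm (A z))\<bar>) r \<le> 2 * (C0 * r ^ n) + C"
    using mean_log_A by blast
  define N where "N = (\<lambda>R. zero_count f (16 * R) + zero_count (deriv f) (16 * R) + zero_count A (16 * R))"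
  have cnn: "zero_count f R \<ge> 0" "zero_count (deriv f) R \<ge> 0" "zero_count A R \<ge> 0" for R
    using zero_count_nonneg f f' A by auto
  have N0: "N R \<ge> 0" for R using cnn[of "16*R"] by (simp add: N_def)
  have pN: "poly_bounded N" unfolding N_def by (intro poly_bounded_add poly_bounded_scale[OF count_f] poly_bounded_scale[OF count_f']
      poly_bounded_scale[OF count_A]) auto
  define M where "M = (\<lambda>R. max 0 (Y (8 * R)) + (2 * (C0 * (16 * R) ^ n) + C))"
  have M0: "M R \<ge> 0" if "R \<ge> 1" for R using that C0 C by (simp add: M_def)
  have pM: "poly_bounded M"
  proof -
    obtain C1 K1 where C1: "C1 \<ge> 0" "\<And>R. R \<ge> 1 \<Longrightarrow> Y R \<le> C1 * R ^ K1" using Y(1) unfolding poly_bounded_def by blast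
    have "poly_bounded (\<lambda>R. C1 * (8 * R) ^ K1 + (2 * (C0 * (16 * R) ^ n) + C))"
      using C0 by (intro poly_bounded_intros) auto
    thus ?thesis
    proof (rule poly_bounded_mono)
      fix R :: real assume "R \<ge> 1"
      thus "M R \<le> C1 * (8 * R) ^ K1 + (2 * (C0 * (16 * R) ^ n) + C)" using C1(1) C1(2)[of "8*R"] by (simp add: M_def)
    qed
  qed
  define X where "X = (\<lambda>R. 1 + 8 * (M R + 64 * R * N R) + (N R + 1) * (8 * (N R + 1)))"
  have pX: "poly_bounded X" unfolding X_def using N0 M0
    by (intro poly_bounded_intros pN pM) (auto intro!: add_nonneg_nonneg mult_nonneg_nonneg)
  have X1: "X R \<ge> 1" if "R \<ge> 1" for R using N0[of R] M0[OF that] that by (simp add: X_def)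
  have main: "\<exists>r \<delta>. R \<le> r \<and> r \<le> 2 * R \<and> r \<notin> T \<and> good_annulus (X R) r \<delta>" if R: "R \<ge> 1" and T: "finite T" for R T
  proof -
    define Z where "Z = zeros_in f (16*R) \<union> zeros_in (deriv f) (16*R) \<union> zeros_in A (16*R)"
    have fZ: "finite Z" unfolding Z_def using entire_finite_zeros(2) f f' A by auto
    have "real (card Z) \<le> N R"
    proof -
      have "card Z \<le> card (zeros_in f (16*R)) + card (zeros_in (deriv f) (16*R)) + card (zeros_in A (16*R))"
        unfolding Z_def by (meson card_Un_le add_right_mono order_trans)
      thus ?thesis using card_zeros_le_zero_count[OF f, of "16*R"] card_zeros_le_zero_count[OF f', of "16*R"]
        card_zeros_le_zero_count[OF A, of "16*R"] unfolding N_def by linarith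
    qed
    moreover have "card (norm ` Z) \<le> card Z" by (rule card_image_le[OF fZ])
    ultimately have cS: "real (card (norm ` Z)) \<le> N R" by linarith
    define B where "B = 8 * (N R + 1)"
    have B: "B \<ge> 1" using N0[of R] by (simp add: B_def)
    \<comment> \<open>The moduli of the zeros stay \<open>2 * \<delta>\<close> away from
      \<open>r\<close>, so that every point of the annulus keeps the distance
      \<open>\<delta>\<close>. This is why \<open>B\<close> has the factor 8, twice the 4 of
      \<open>radius_avoiding_points\<close>.\<close>
    define \<delta> where "\<delta> = 1 / B"
    have "1 / B \<le> 1" using B by simp
    moreover have "1 / B > 0" using B by simp
    ultimately have \<delta>: "\<delta> > 0" "\<delta> \<le> R" using R unfolding \<delta>_def by linarith+
    have "2 * \<delta> = 1 / (4 * (N R + 1))" using N0[of R] by (auto simp: \<delta>_def B_def divide_simps)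
    also have "\<dots> \<le> R / (4 * (real (card (norm ` Z)) + 1))" using cS R by (intro frac_le) auto
    finally have d2: "2 * \<delta> \<le> R / (4 * (real (card (norm ` Z)) + 1))" .
    obtain r where r: "R \<le> r" "r \<le> 2 * R" "r \<notin> T" "\<And>s. s \<in> norm ` Z \<Longrightarrow> \<bar>s - r\<bar> \<ge> R / (4 * (real (card (norm ` Z)) + 1))"
      using radius_avoiding_points[of "norm ` Z" "card (norm ` Z)" T R] fZ T R by auto
    have "1 * B \<le> (N R + 1) * B" using N0[of R] B by (intro mult_right_mono) auto
    moreover have MN: "0 \<le> M R" "0 \<le> R * N R" using N0[of R] M0[OF R] R by auto
    ultimately have inv\<delta>X: "1 / \<delta> \<le> X R" unfolding X_def \<delta>_def B_def by simp
    have far: "\<delta> \<le> norm (z - a)" if "\<bar>norm z - r\<bar> < \<delta>" "norm a < 16 * R" "f a = 0 \<or> deriv f a = 0 \<or> A a = 0" for z a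
    proof -
      have "\<bar>norm a - r\<bar> \<ge> 2 * \<delta>" using that by (intro order_trans[OF d2] r) (auto simp: Z_def)
      thus ?thesis using norm_triangle_ineq3[of z a] that(1) by linarith
    qed
    have bound: "8 * (M R + 4 * \<rho> * N R) + N R * B \<le> X R" if "\<rho> \<le> 2 * (8 * R)" for \<rho>
    proof -
      have "8 * (M R + 4 * \<rho> * N R) + N R * B \<le> 8 * (M R + 4 * (2 * (8 * R)) * N R) + (N R + 1) * B"
        using N0[of R] that B by (intro add_mono mult_left_mono mult_right_mono) auto
      thus ?thesis by (simp add: X_def B_def)
    qed
    \<comment> \<open>Radii from \<open>8 * R\<close> on, so that the annulus, which lies in the
      disc of radius \<open>4 * R\<close>, is inside the disc of half the radius.\<close>
    obtain \<rho> where \<rho>: "8 * R \<le> \<rho>" "\<rho> \<le> 2 * (8 * R)" "zero_free f \<rho>" "zero_free (deriv f) \<rho>"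
       "mean_log_ratio (deriv f) f \<rho> \<le> Y (8 * R)"
      using Y(2)[of "8 * R"] R by auto
    obtain \<sigma> where \<sigma>: "8 * R \<le> \<sigma>" "\<sigma> \<le> 2 * (8 * R)" and zf\<sigma>: "zero_free A \<sigma>"
      using exists_zero_free_radius[OF A, of "8 * R"] R by auto
    have "f z \<noteq> 0 \<and> deriv f z \<noteq> 0 \<and> A z \<noteq> 0 \<and> norm (q z) \<le> X R \<and> norm (w z) \<le> X R" if z: "\<bar>norm z - r\<bar> < \<delta>" for z
    proof -
      have z4: "norm z \<le> 4 * R" using z \<delta> r R by linarith
      have nz: "f z \<noteq> 0" "deriv f z \<noteq> 0" "A z \<noteq> 0" using far[OF z, of z] z4 R \<delta> by auto
      have "norm (q z) \<le> 8 * (M R + 4 * \<rho> * N R) + N R * B" unfolding q_def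
      proof (rule log_deriv_bound[OF f' f \<rho>(4,3)])
        have "0 \<le> 2 * (C0 * (16 * R) ^ n) + C" using C0 C R by simp
        thus "mean_log_ratio (deriv f) f \<rho> \<le> M R" using \<rho>(5) unfolding M_def by linarith
        show "zero_count (deriv f) \<rho> + zero_count f \<rho> \<le> N R"
          using zero_count_mono[OF f, of \<rho> "16*R"] zero_count_mono[OF f', of \<rho> "16*R"] \<rho> cnn(3)[of "16*R"] by (simp add: N_def)
      qed (use R \<rho> z4 B far[OF z] in \<open>auto simp: \<delta>_def\<close>)
      moreover have "norm (w z) \<le> 8 * (M R + 4 * \<sigma> * N R) + N R * B" unfolding w_def
      proof (rule log_deriv_bound_entire[OF A zf\<sigma>])
        have "circle_mean (\<lambda>z. \<bar>ln (norm (A z))\<bar>) \<sigma> \<le> 2 * (C0 * \<sigma> ^ n) + C" using C(2)[OF _ zf\<sigma>] R \<sigma> by auto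
        also have "\<dots> \<le> 2 * (C0 * (16 * R) ^ n) + C" using R \<sigma> C0 by (intro add_mono mult_left_mono power_mono) auto
        also have "\<dots> \<le> M R" by (simp add: M_def)
        finally show "circle_mean (\<lambda>z. \<bar>ln (norm (A z))\<bar>) \<sigma> \<le> M R" .
        show "zero_count A \<sigma> \<le> N R"
          using zero_count_mono[OF A, of \<sigma> "16*R"] \<sigma> cnn(1,2)[of "16*R"] by (simp add: N_def)
      qed (use R \<sigma> z4 B far[OF z] in \<open>auto simp: \<delta>_def\<close>)
      ultimately show ?thesis using nz bound[OF \<rho>(2)] bound[OF \<sigma>(2)] by auto
    qed
    thus ?thesis using r(1,2,3) \<delta>(1) inv\<delta>X unfolding good_annulus_def by blast
  qed
  show ?thesis by (intro exI[of _ X] conjI allI impI pX X1 main; assumption)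
qed

section \<open>Differential identities relating y, q, w, D and E\<close>

definition regular where
  "regular U \<longleftrightarrow> open U \<and> (\<forall>z\<in>U. f z \<noteq> 0 \<and> deriv f z \<noteq> 0 \<and> A z \<noteq> 0)"

lemma regularD:
  assumes "regular U" "z \<in> U"
  shows "open U" "f z \<noteq> 0" "deriv f z \<noteq> 0" "A z \<noteq> 0" "y z \<noteq> 0"
  using assms by (auto simp: regular_def y_def)

lemma entire_derivs:
  "(f has_field_derivative deriv f z) (at z)" "(deriv f has_field_derivative - A z * f z) (at z)"
  "(A has_field_derivative deriv A z) (at z)" "(deriv A has_field_derivative deriv (deriv A) z) (at z)"
proof -
  have "deriv (deriv f) z = - A z * f z" using ode[of z] by (simp add: add_eq_0_iff)
  thus "(deriv f has_field_derivative - A z * f z) (at z)" using holomorphic_derivI[OF f'(1) open_UNIV, of z] by simp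
  show "(f has_field_derivative deriv f z) (at z)"
    "(A has_field_derivative deriv A z) (at z)" "(deriv A has_field_derivative deriv (deriv A) z) (at z)"
    using holomorphic_derivI[OF f(1)] holomorphic_derivI[OF A(1)] holomorphic_derivI[OF A'] by auto
qed

lemma deriv2_f: "deriv (deriv f) z = - A z * f z"
  using DERIV_imp_deriv entire_derivs(2) by blast

lemma holomorphic_yqw:
  assumes "regular U"
  shows "y holomorphic_on U" "q holomorphic_on U" "w holomorphic_on U" "D holomorphic_on U" "E holomorphic_on U"
proof -
  note U = regularD[OF assms]
  have oU: "open U" using assms by (simp add: regular_def)
  have h: "f holomorphic_on U" "deriv f holomorphic_on U" "A holomorphic_on U" "deriv A holomorphic_on U"
    using f(1) f'(1) A(1) A' by (auto intro: holomorphic_on_subset)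
  have h2: "deriv (deriv f) holomorphic_on U" using h(2) oU by (rule holomorphic_deriv)
  show y: "y holomorphic_on U" unfolding y_def[abs_def] by (intro holomorphic_intros h) (use U in auto)
  show q: "q holomorphic_on U" unfolding q_def[abs_def] by (intro holomorphic_intros h h2) (use U in auto)
  show w: "w holomorphic_on U" unfolding w_def[abs_def] by (intro holomorphic_intros h) (use U in auto)
  have q': "deriv q holomorphic_on U" "deriv w holomorphic_on U" using q w oU by (auto intro: holomorphic_deriv)
  show D: "D holomorphic_on U" unfolding D_def[abs_def] by (intro holomorphic_intros q w q')
  show "E holomorphic_on U" unfolding E_def[abs_def] by (intro holomorphic_intros D w q')
qed

lemma derivs_yqw:
  assumes "regular U" "z \<in> U"
  shows "(y has_field_derivative y z * q z) (at z)" "(q has_field_derivative deriv q z) (at z)"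
    "(w has_field_derivative deriv w z) (at z)" "(D has_field_derivative deriv D z) (at z)"
    "(A has_field_derivative w z * A z) (at z)"
proof -
  note nz = regularD[OF assms]
  note h = holomorphic_yqw[OF assms(1)]
  show "(q has_field_derivative deriv q z) (at z)" "(w has_field_derivative deriv w z) (at z)" "(D has_field_derivative deriv D z) (at z)"
    using holomorphic_derivI[OF h(2) nz(1) assms(2)] holomorphic_derivI[OF h(3) nz(1) assms(2)]
      holomorphic_derivI[OF h(4) nz(1) assms(2)] by auto
  show "(A has_field_derivative w z * A z) (at z)" using entire_derivs(3)[of z] nz by (simp add: w_def)
  have "(y has_field_derivative (- A z * f z * f z - deriv f z * deriv f z) / (f z * f z)) (at z)"
    unfolding y_def[abs_def] using entire_derivs[of z] nz by (intro DERIV_divide) auto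
  also have "(- A z * f z * f z - deriv f z * deriv f z) / (f z * f z) = y z * q z"
    unfolding y_def q_def deriv2_f using nz by (simp add: field_simps)
  finally show "(y has_field_derivative y z * q z) (at z)" .
qed

lemma riccati: "y z * q z = - A z - (y z)\<^sup>2" if "regular U" "z \<in> U"
  unfolding y_def q_def deriv2_f using regularD[OF that] by (simp add: field_simps power2_eq_square)

text \<open>Differentiate \<open>y * q = - A - y^2\<close>, replace the derivative of
  \<open>A\<close> by \<open>w * A\<close> and then \<open>A\<close> by
  \<open>- y^2 - y * q\<close>. Everything is divisible by \<open>y\<close>, and the part of the
  quotient free of \<open>y\<close> is \<open>D\<close>.\<close>

lemma D_eq:
  assumes "regular U" "z \<in> U"
  shows "D z = y z * (2 * q z - w z)"
proof -
  note nz = regularD[OF assms]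
  note d = derivs_yqw[OF assms]
  have "((\<lambda>z. y z * q z) has_field_derivative y z * q z * q z + y z * deriv q z) (at z)"
    by (rule derivative_eq_intros d refl)+ (simp add: algebra_simps)
  moreover have "((\<lambda>z. y z * q z) has_field_derivative - (w z * A z) - 2 * y z * (y z * q z)) (at z)"
  proof (rule has_field_derivative_transform_within_open[of "\<lambda>z. - A z - (y z)\<^sup>2"])
    show "((\<lambda>z. - A z - (y z)\<^sup>2) has_field_derivative - (w z * A z) - 2 * y z * (y z * q z)) (at z)"
      by (rule derivative_eq_intros d refl)+ (simp add: algebra_simps)
  qed (use nz assms riccati[OF assms(1)] in auto)
  ultimately have "y z * q z * q z + y z * deriv q z = - (w z * A z) - 2 * y z * (y z * q z)" by (rule DERIV_unique)
  moreover have "A z = - (y z)\<^sup>2 - y z * q z" unfolding riccati[OF assms] by simp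
  ultimately have "y z * (q z * q z + deriv q z) = y z * (w z * (y z + q z) - 2 * y z * q z)"
    by (simp add: algebra_simps power2_eq_square)
  hence "q z * q z + deriv q z = w z * (y z + q z) - 2 * y z * q z" using nz by simp
  thus ?thesis by (simp add: D_def algebra_simps power2_eq_square)
qed

text \<open>Every combination of \<open>D\<close> and its derivative has the factor
  \<open>y\<close>, since the derivative of \<open>y\<close> is \<open>y * q\<close>. This
  combination is the one for which \<open>- D / A\<close> times it is the derivative of
  \<open>D^2 / A\<close>, so that the case \<open>E = 0\<close> can be integrated.\<close>

lemma y_E:
  assumes "regular U" "z \<in> U"
  shows "y z * E z = w z * D z - 2 * deriv D z"
proof -
  note nz = regularD[OF assms]
  note d = derivs_yqw[OF assms]
  have "(D has_field_derivative y z * q z * (2 * q z - w z) + y z * (2 * deriv q z - deriv w z)) (at z)"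
  proof (rule has_field_derivative_transform_within_open[of "\<lambda>z. y z * (2 * q z - w z)"])
    show "((\<lambda>z. y z * (2 * q z - w z)) has_field_derivative y z * q z * (2 * q z - w z) + y z * (2 * deriv q z - deriv w z)) (at z)"
      by (rule derivative_eq_intros d refl)+ (simp add: algebra_simps)
  qed (use nz assms D_eq[OF assms(1)] in auto)
  hence D': "deriv D z = y z * q z * (2 * q z - w z) + y z * (2 * deriv q z - deriv w z)" by (rule DERIV_imp_deriv)
  have "w z * D z - 2 * deriv D z = y z * (w z * (2 * q z - w z) - 2 * q z * (2 * q z - w z) - 4 * deriv q z + 2 * deriv w z)"
    unfolding D' D_eq[OF assms] by (simp add: algebra_simps)
  also have "\<dots> = y z * E z" by (simp add: E_def D_def algebra_simps power2_eq_square)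
  finally show ?thesis ..
qed

text \<open>\<open>y * E\<close> is estimated through \<open>w * D - 2 * deriv D\<close>, so no
  bound for \<open>y\<close> itself enters. The constant 36 is the 4 of \<open>w * D\<close> plus
  the 32 of \<open>2 * deriv D\<close>, and it covers the other two estimates.\<close>

lemma regular_bounds:
  assumes U: "regular (ball a \<delta>)" and \<delta>: "\<delta> > 0" "1 / \<delta> \<le> B" and B: "B \<ge> 1"
    and qw: "\<And>z. z \<in> ball a \<delta> \<Longrightarrow> norm (q z) \<le> B \<and> norm (w z) \<le> B"
  shows "norm (D a) \<le> 36 * B ^ 3" "norm (E a) \<le> 36 * B ^ 3" "norm (y a * E a) \<le> 36 * B ^ 3"
proof -
  have a: "a \<in> ball a \<delta>" using \<delta> by simp
  note h = holomorphic_yqw[OF U]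
  have c1: "2 * B / \<delta> \<le> 2 * B^2"
    using mult_left_mono[OF \<delta>(2), of "2*B"] B by (simp add: power2_eq_square)
  have "1 / \<delta>^2 \<le> B^2" using power_mono[OF \<delta>(2), of 2] \<delta>(1) by (simp add: power_divide)
  hence c2: "8 * B / \<delta>^2 \<le> 8 * B^3"
    using mult_left_mono[of "1/\<delta>^2" "B^2" "8*B"] B by (simp add: power2_eq_square power3_eq_cube)
  have q0: "norm (q a) \<le> B" "norm (w a) \<le> B" using qw[OF a] by auto
  have q1: "norm (deriv q a) \<le> 2 * B^2" and q2: "norm (deriv (deriv q) a) \<le> 8 * B^3"
    using Cauchy_deriv_bounds[OF h(2) \<delta>(1), of B] qw c1 c2 by fastforce+
  have w1: "norm (deriv w a) \<le> 2 * B^2"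
    using Cauchy_deriv_bounds[OF h(3) \<delta>(1), of B] qw c1 by fastforce
  have pB: "B^2 \<le> B^3" "0 \<le> B^2" using B by (auto intro: power_increasing)
  have m: "norm (u * v) \<le> s * t" if "norm u \<le> s" "norm v \<le> t" for u v :: complex and s t
    unfolding norm_mult using that by (intro mult_mono) (auto intro: order_trans[OF norm_ge_zero])
  have D: "norm (D a) \<le> 4 * B^2"
  proof -
    have "norm (D a) \<le> norm (w a * q a) + norm (deriv q a) + norm (q a * q a)"
      unfolding D_def power2_eq_square
      by (rule order_trans[OF norm_triangle_ineq4 add_right_mono[OF norm_triangle_ineq4]])
    also have "\<dots> \<le> B * B + 2 * B^2 + B * B" by (intro add_mono m q0 q1)
    finally show ?thesis by (simp add: power2_eq_square)
  qed
  thus "norm (D a) \<le> 36 * B ^ 3" using pB by linarith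
  have "norm (E a) \<le> norm (4 * D a) + norm (w a * w a) + norm (2 * deriv w a)"
    unfolding E_def power2_eq_square
    by (rule order_trans[OF norm_triangle_ineq add_right_mono[OF norm_triangle_ineq4]])
  also have "\<dots> \<le> 4 * (4 * B^2) + B * B + 2 * (2 * B^2)"
    by (intro add_mono m q0) (use D w1 in \<open>auto simp: norm_mult\<close>)
  finally have "norm (E a) \<le> 21 * B^2" by (simp add: power2_eq_square)
  thus "norm (E a) \<le> 36 * B ^ 3" using pB by linarith
  have q': "deriv q holomorphic_on ball a \<delta>" using h(2) by (rule holomorphic_deriv) auto
  have "(D has_field_derivative deriv w a * q a + w a * deriv q a - deriv (deriv q) a - 2 * (q a * deriv q a)) (at a)"
    unfolding D_def[abs_def]
    by (rule derivative_eq_intros derivs_yqw[OF U a] holomorphic_derivI[OF q' open_ball a] refl)+ (simp add: algebra_simps)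
  hence "deriv D a = deriv w a * q a + w a * deriv q a - deriv (deriv q) a - 2 * (q a * deriv q a)" by (rule DERIV_imp_deriv)
  hence "norm (deriv D a) \<le> norm (deriv w a * q a) + norm (w a * deriv q a) + norm (deriv (deriv q) a) + norm (2 * (q a * deriv q a))"
    by (simp only:) (rule order_trans[OF norm_triangle_ineq4 add_right_mono[OF order_trans[OF norm_triangle_ineq4 add_right_mono[OF norm_triangle_ineq]]]])
  also have "norm (2 * (q a * deriv q a)) = 2 * norm (q a * deriv q a)" by (simp add: norm_mult)
  also have "norm (deriv w a * q a) + norm (w a * deriv q a) + norm (deriv (deriv q) a) + 2 * norm (q a * deriv q a)
     \<le> 2 * B^2 * B + B * (2 * B^2) + 8 * B^3 + 2 * (B * (2 * B^2))"
    by (intro add_mono m q0 q1 q2 w1 mult_left_mono) auto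
  finally have D': "norm (deriv D a) \<le> 16 * B^3" by (simp add: power2_eq_square power3_eq_cube)
  have "norm (y a * E a) \<le> norm (w a * D a) + norm (2 * deriv D a)"
    unfolding y_E[OF U a] by (rule norm_triangle_ineq4)
  also have "\<dots> \<le> B * (4 * B^2) + 2 * (16 * B^3)"
    by (intro add_mono m q0 D) (use D' in \<open>auto simp: norm_mult\<close>)
  finally show "norm (y a * E a) \<le> 36 * B ^ 3" by (simp add: power2_eq_square power3_eq_cube)
qed

section \<open>Circles that carry all estimates, and the two cases for E\<close>

definition good_circle where
  "good_circle B r U \<longleftrightarrow> regular U \<and> sphere 0 r \<subseteq> U \<and> (\<forall>z. norm z = r \<longrightarrow> norm (q z) \<le> B \<and>
     norm (w z) \<le> B \<and> norm (D z) \<le> B \<and> norm (E z) \<le> B \<and> norm (y z * E z) \<le> B)"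

lemma exists_good_circle:
  "\<exists>X. poly_bounded X \<and> (\<forall>R\<ge>1. X R \<ge> 1 \<and> (\<forall>T. finite T \<longrightarrow>
     (\<exists>r U. R \<le> r \<and> r \<le> 2 * R \<and> r \<notin> T \<and> good_circle (X R) r U)))"
proof -
  obtain B where B: "poly_bounded B" "\<And>R. R \<ge> 1 \<Longrightarrow> B R \<ge> 1"
    "\<And>R T. R \<ge> 1 \<Longrightarrow> finite T \<Longrightarrow> \<exists>r \<delta>. R \<le> r \<and> r \<le> 2 * R \<and> r \<notin> T \<and> good_annulus (B R) r \<delta>"
    using exists_good_annulus by blast
  define X where "X = (\<lambda>R. 36 * B R ^ 3)"
  have B0: "B R \<ge> 0" if "R \<ge> 1" for R using B(2)[OF that] by linarith
  have pX: "poly_bounded X" unfolding X_def using B0 by (intro poly_bounded_intros B(1)) auto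
  have X1: "X R \<ge> 1" "X R \<ge> B R" if "R \<ge> 1" for R
  proof -
    have "B R ^ 1 \<le> B R ^ 3" using B(2)[OF that] by (intro power_increasing) auto
    thus "X R \<ge> B R" "X R \<ge> 1" using B(2)[OF that] by (auto simp: X_def)
  qed
  have main: "\<exists>r U. R \<le> r \<and> r \<le> 2 * R \<and> r \<notin> T \<and> good_circle (X R) r U" if R: "R \<ge> 1" and T: "finite T" for R T
  proof -
    obtain r \<delta> where r: "R \<le> r" "r \<le> 2 * R" "r \<notin> T" and \<delta>: "\<delta> > 0" "1 / \<delta> \<le> B R"
      and nz: "\<And>z. \<bar>norm z - r\<bar> < \<delta> \<Longrightarrow> f z \<noteq> 0 \<and> deriv f z \<noteq> 0 \<and> A z \<noteq> 0 \<and> norm (q z) \<le> B R \<and> norm (w z) \<le> B R"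
      using B(3)[OF R T] unfolding good_annulus_def by blast
    define U where "U = {z::complex. \<bar>norm z - r\<bar> < \<delta>}"
    have "open U" unfolding U_def by (intro open_Collect_less continuous_intros)
    hence regU: "regular U" using nz by (auto simp: regular_def U_def)
    have sU: "sphere 0 r \<subseteq> U" using \<delta> by (auto simp: U_def)
    have "norm (q z) \<le> X R \<and> norm (w z) \<le> X R \<and> norm (D z) \<le> X R \<and> norm (E z) \<le> X R \<and> norm (y z * E z) \<le> X R"
      if z: "norm z = r" for z
    proof -
      have sub: "ball z \<delta> \<subseteq> U"
      proof
        fix u assume "u \<in> ball z \<delta>"
        hence "norm (u - z) < \<delta>" by (simp add: dist_norm norm_minus_commute)
        thus "u \<in> U" using norm_triangle_ineq3[of u z] z by (auto simp: U_def)
      qed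
      have reg: "regular (ball z \<delta>)" using regU sub by (auto simp: regular_def)
      have "norm (q u) \<le> B R \<and> norm (w u) \<le> B R" if "u \<in> ball z \<delta>" for u using sub that nz by (auto simp: U_def)
      from regular_bounds[OF reg \<delta> B(2)[OF R] this]
      have "norm (D z) \<le> X R" "norm (E z) \<le> X R" "norm (y z * E z) \<le> X R" by (auto simp: X_def)
      moreover have "norm (q z) \<le> B R" "norm (w z) \<le> B R" using nz[of z] z \<delta> by auto
      ultimately show ?thesis using X1[OF R] by auto
    qed
    thus ?thesis using r regU sU unfolding good_circle_def by blast
  qed
  show ?thesis by (intro exI[of _ X] conjI allI impI pX X1 main; assumption)
qed

text \<open>Cleared denominators: \<open>F\<close> is \<open>f^2 * A * D\<close> and
  \<open>G\<close> below is \<open>f^2 * A^2 * E\<close> wherever \<open>f\<close>,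
  \<open>deriv f\<close> and \<open>A\<close> do not vanish. Jensen's formula and analytic
  continuation to the plane are applied to entire functions, whereas \<open>D\<close> and
  \<open>E\<close> are meromorphic.\<close>

definition F where
  "F z = 2 * A z * (- A z * (f z)\<^sup>2 - (deriv f z)\<^sup>2) - deriv A z * deriv f z * f z"

definition G where
  "G z = 4 * A z * F z + (f z)\<^sup>2 * (2 * A z * deriv (deriv A) z - 3 * (deriv A z)\<^sup>2)"

lemma holomorphic_FG: "F holomorphic_on UNIV" "G holomorphic_on UNIV"
proof -
  have "deriv (deriv A) holomorphic_on UNIV" using A' by (rule holomorphic_deriv) auto
  thus "F holomorphic_on UNIV" "G holomorphic_on UNIV" unfolding G_def[abs_def] F_def[abs_def]
    by (auto intro!: holomorphic_intros f(1) f'(1) A(1) A')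
qed

lemma F_eq: "F z = (f z)\<^sup>2 * A z * D z" if "regular U" "z \<in> U"
  unfolding D_eq[OF that] unfolding F_def q_def w_def y_def deriv2_f using regularD[OF that]
  by (simp add: field_simps power2_eq_square)

lemma G_eq: "G z = (f z)\<^sup>2 * (A z)\<^sup>2 * E z" if "regular U" "z \<in> U"
proof -
  note nz = regularD[OF that]
  have "(w has_field_derivative (deriv (deriv A) z * A z - deriv A z * deriv A z) / (A z * A z)) (at z)"
    unfolding w_def[abs_def] using entire_derivs[of z] nz by (intro DERIV_divide) auto
  hence w': "deriv w z = (deriv (deriv A) z * A z - deriv A z * deriv A z) / (A z * A z)" by (rule DERIV_imp_deriv)
  have "(A z)\<^sup>2 * ((w z)\<^sup>2 - 2 * deriv w z) = 3 * (deriv A z)\<^sup>2 - 2 * A z * deriv (deriv A) z"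
    unfolding w' w_def using nz by (simp add: field_simps power2_eq_square)
  note Aw = this
  have "(f z)\<^sup>2 * (A z)\<^sup>2 * E z = 4 * A z * ((f z)\<^sup>2 * A z * D z) - (f z)\<^sup>2 * ((A z)\<^sup>2 * ((w z)\<^sup>2 - 2 * deriv w z))"
    by (simp add: E_def algebra_simps power2_eq_square)
  also have "\<dots> = G z" unfolding Aw by (simp add: G_def F_eq[OF that] algebra_simps)
  finally show ?thesis ..
qed

text \<open>Jensen's formula for \<open>G\<close> bounds its log mean from below, and Jensen's
  formula for \<open>f\<close> bounds the share of \<open>f\<close> in it by the zero count up to
  logarithms, regardless of the growth of \<open>f\<close>. The remainder has to come from
  \<open>A\<close>.\<close>

lemma mean_log_A_lower:
  assumes G0: "\<exists>z. G z \<noteq> 0"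
  shows "\<exists>C\<ge>0. \<forall>R\<ge>1. \<exists>r. R \<le> r \<and> r \<le> 2 * R \<and> zero_free A r \<and>
    - C * (1 + ln r) * (1 + zero_count f r) \<le> circle_mean (damped_log A) r"
proof -
  obtain X where X: "poly_bounded X" "\<And>R. R \<ge> 1 \<Longrightarrow> X R \<ge> 1"
    "\<And>R T. R \<ge> 1 \<Longrightarrow> finite T \<Longrightarrow> \<exists>r U. R \<le> r \<and> r \<le> 2 * R \<and> r \<notin> T \<and> good_circle (X R) r U"
    using exists_good_circle by blast
  obtain C1 where C1: "C1 \<ge> 0" "\<And>R. R \<ge> 1 \<Longrightarrow> zero_free G R \<Longrightarrow> mean_log G R \<ge> - C1"
    using Jensen_bounds[OF holomorphic_FG(2) G0] by blast
  obtain C2 where C2: "C2 \<ge> 0"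
    "\<And>R. R \<ge> 1 \<Longrightarrow> zero_free f R \<Longrightarrow> mean_log f R \<le> C2 + zero_count f R * (ln R + C2)"
    using Jensen_bounds[OF f] by blast
  obtain C3 K where C3: "C3 \<ge> 0" "\<And>R. R \<ge> 1 \<Longrightarrow> X R \<le> C3 * R ^ K" using X(1) unfolding poly_bounded_def by blast
  define C4 where "C4 = max 1 C3"
  define C where "C = C1 + 2 * (1 + C2) + (2 * (ln C4 + real K) + 1)"
  have C4: "C4 \<ge> 1" by (simp add: C4_def)
  have C0': "C \<ge> 0" using C1 C2 C4 by (simp add: C_def)
  have "\<exists>r. R \<le> r \<and> r \<le> 2 * R \<and> zero_free A r \<and>
    - C * (1 + ln r) * (1 + zero_count f r) \<le> circle_mean (damped_log A) r"
    if R: "R \<ge> 1" for R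
  proof -
    have "finite (norm ` {a \<in> cball 0 (2*R). G a = 0})" using entire_finite_zeros(1)[OF holomorphic_FG(2) G0] by auto
    from X(3)[OF R this] obtain r U where r: "R \<le> r" "r \<le> 2 * R" "r \<notin> norm ` {a \<in> cball 0 (2*R). G a = 0}"
      and U: "regular U" "sphere 0 r \<subseteq> U"
      and b: "\<And>z. norm z = r \<Longrightarrow> norm (q z) \<le> X R \<and> norm (E z) \<le> X R \<and> norm (y z * E z) \<le> X R" unfolding good_circle_def by blast
    have r0: "r > 0" "r \<ge> 1" using r R by auto
    have zf: "zero_free G r" by (rule zero_freeI[OF r(3,2)])
    have nz: "f z \<noteq> 0" "A z \<noteq> 0" if "norm z = r" for z using regularD[OF U(1), of z] U(2) that by auto
    have zfA: "zero_free A r" "zero_free f r" using nz by (auto simp: zero_free_def)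
    define L where "L = 2 * ln (X R) + 1"
    have pw: "ln (norm (G z)) \<le> 2 * ln (norm (f z)) + (damped_log A z) + L"
      if z: "norm z = r" for z
    proof -
      have zU: "z \<in> U" using z U by auto
      \<comment> \<open>The truncation at 1 merges the bounds for \<open>E\<close> and
        \<open>y * E\<close> into the single inequality
        \<open>Y * norm (E z) \<le> X R\<close>.\<close>
      define Y where "Y = max 1 (norm (y z))"
      have Y: "Y \<ge> 1" "norm (y z) \<le> Y" by (auto simp: Y_def)
      have X1: "X R \<ge> 1" by (rule X(2)[OF R])
      have E0: "E z \<noteq> 0" using zf z G_eq[OF U(1) zU] by (auto simp: zero_free_def)
      have "Y * norm (E z) \<le> X R" using b[OF z] by (auto simp: Y_def max_def norm_mult)
      hence "ln (Y * norm (E z)) \<le> ln (X R)" using Y E0 X1 by (subst ln_le_cancel_iff) (auto intro!: mult_pos_pos)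
      hence lnE: "ln (norm (E z)) \<le> ln (X R) - ln Y" using Y E0 by (simp add: ln_mult)
      \<comment> \<open>The Riccati equation makes \<open>y\<close> large where \<open>A\<close> is
        large: it yields \<open>norm (A z) \<le> 2 * X R * Y^2\<close>, hence the exponent
        1/2.\<close>
      have "A z = - (y z * (y z + q z))" by (simp add: distrib_left riccati[OF U(1) zU] power2_eq_square)
      hence "norm (A z) = norm (y z) * norm (y z + q z)" by (simp add: norm_mult)
      also have "\<dots> \<le> Y * (Y + X R)"
        using Y b[OF z] by (intro mult_mono order_trans[OF norm_triangle_ineq] add_mono) auto
      also have "\<dots> \<le> Y * (Y * (2 * X R))"
      proof (intro mult_left_mono)
        have "Y * 1 \<le> Y * X R" "1 * X R \<le> Y * X R" using Y X1 by (auto intro!: mult_left_mono mult_right_mono)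
        thus "Y + X R \<le> Y * (2 * X R)" by simp
      qed (use Y in auto)
      finally have "ln (norm (A z)) \<le> ln (Y * (Y * (2 * X R)))"
        using nz[OF z] Y X1 by (subst ln_le_cancel_iff) (auto intro!: mult_pos_pos)
      also have "\<dots> = 2 * ln Y + (ln 2 + ln (X R))" using Y X1 by (simp add: ln_mult)
      also have "\<dots> \<le> 2 * ln Y + (1 + ln (X R))" using ln_2_less_1 by simp
      finally have "max 0 (ln (norm (A z))) \<le> 2 * ln Y + (1 + ln (X R))" using Y X1 by simp
      moreover have "ln (norm (G z)) = 2 * ln (norm (f z)) + 2 * ln (norm (A z)) + ln (norm (E z))"
        using nz[OF z] E0 by (simp add: G_eq[OF U(1) zU] norm_mult norm_power ln_mult ln_realpow)
      moreover have "ln (X R) \<ge> 0" using X1 by simp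
      ultimately show ?thesis using lnE unfolding L_def by linarith
    qed
    have cA: "continuous_on (sphere 0 r) (damped_log A)"
      by (intro continuous_intros continuous_on_max continuous_on_ln_norm[OF A(1) zfA(1)]) auto
    note cf = continuous_on_ln_norm[OF f(1) zfA(2)]
    let ?mA = "circle_mean (damped_log A) r"
    have "- C1 \<le> mean_log G r" by (rule C1(2)[OF r0(2) zf])
    also have "\<dots> \<le> circle_mean (\<lambda>z. (2 * ln (norm (f z)) + (damped_log A z)) + L) r"
      by (rule circle_mean_mono[OF continuous_on_ln_norm[OF holomorphic_FG(2) zf] _ r0(1) pw])
         (intro continuous_on_add continuous_on_mult cA cf continuous_on_const)
    also have "\<dots> = circle_mean (\<lambda>z. 2 * ln (norm (f z)) + (damped_log A z)) r + L"
      by (subst circle_mean_add) (auto intro!: continuous_on_add continuous_on_mult cA cf r0)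
    also have "circle_mean (\<lambda>z. 2 * ln (norm (f z)) + (damped_log A z)) r =
        2 * mean_log f r + ?mA"
      by (subst circle_mean_add[OF _ cA r0(1)]) (auto intro!: continuous_on_mult cf simp: circle_mean_cmult)
    finally have 1: "- C1 \<le> 2 * mean_log f r + ?mA + L" .
    define a where "a = ln r"
    define c where "c = zero_count f r"
    have a: "a \<ge> 0" and c: "c \<ge> 0" using r0 zero_count_nonneg[OF f] by (auto simp: a_def c_def)
    have 2: "mean_log f r \<le> C2 + c * (a + C2)"
      unfolding a_def c_def by (rule C2(2)[OF r0(2) zfA(2)])
    have "X R \<le> C4 * r ^ K"
    proof -
      have "X R \<le> C3 * R ^ K" by (rule C3(2)[OF R])
      also have "\<dots> \<le> C4 * r ^ K" using C4 R r by (intro mult_mono power_mono) (auto simp: C4_def)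
      finally show ?thesis .
    qed
    hence "ln (X R) \<le> ln (C4 * r ^ K)" using X(2)[OF R] by (subst ln_le_cancel_iff) (use C4 r0 in auto)
    also have "\<dots> = ln C4 + real K * a" using C4 r0 by (simp add: ln_mult ln_realpow a_def)
    finally have 3: "L \<le> 2 * (ln C4 + real K * a) + 1" by (simp add: L_def)
    \<comment> \<open>Each error term is at most a constant multiple of this product.\<close>
    define s where "s = (1 + a) * (1 + c)"
    have s: "s = 1 + a + c + a * c" "a * c \<ge> 0" using a c by (auto simp: s_def algebra_simps)
    have s1: "1 \<le> s" "a \<le> s" using s a c by auto
    have "2 * (C2 + c * (a + C2)) \<le> 2 * (1 + C2) * s"
    proof -
      have "2 * (1 + C2) * s = 2 * (C2 + c * (a + C2)) + 2 * (1 + a + c + C2 * a + C2 * (a * c))"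
        unfolding s(1) by (simp add: algebra_simps)
      moreover have "0 \<le> 2 * (1 + a + c + C2 * a + C2 * (a * c))" using a c C2(1) s(2) by simp
      ultimately show ?thesis by linarith
    qed
    moreover have "2 * (ln C4 + real K * a) + 1 \<le> (2 * (ln C4 + real K) + 1) * s"
    proof -
      have "ln C4 * 1 \<le> ln C4 * s" "real K * a \<le> real K * s" using s1 C4 by (intro mult_left_mono; simp)+
      thus ?thesis using s1 by (simp add: algebra_simps)
    qed
    moreover have "C1 * 1 \<le> C1 * s" using s1 C1(1) by (intro mult_left_mono) auto
    ultimately have "- ?mA \<le> C * s" using 1 2 3 unfolding C_def by (simp add: distrib_right)
    hence "- C * (1 + ln r) * (1 + zero_count f r) \<le> ?mA" unfolding s_def a_def c_def by (simp add: mult.assoc)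
    thus ?thesis using r zfA(1) by blast
  qed
  thus ?thesis using C0' by blast
qed

lemma poly_growth_A:
  assumes G0: "\<And>z. G z = 0"
  shows "\<exists>C\<ge>0. \<exists>K. \<forall>z. norm (A z) \<le> C * (1 + norm z) ^ K"
proof -
  obtain X where X: "poly_bounded X" "\<And>R. R \<ge> 1 \<Longrightarrow> X R \<ge> 1"
    "\<And>R T. R \<ge> 1 \<Longrightarrow> finite T \<Longrightarrow> \<exists>r U. R \<le> r \<and> r \<le> 2 * R \<and> r \<notin> T \<and> good_circle (X R) r U"
    using exists_good_circle by blast
  have circles: "\<exists>r U. R \<le> r \<and> regular U \<and> sphere 0 r \<subseteq> U \<and> (\<forall>z. norm z = r \<longrightarrow> norm (w z) \<le> X R \<and> norm (D z) \<le> X R)"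
    if "R \<ge> 1" for R using X(3)[OF that, of "{}"] unfolding good_circle_def by blast
  have X0: "X R \<ge> 0" if "R \<ge> 1" for R using X(2)[OF that] by linarith
  have E0: "E z = 0" if "regular U" "z \<in> U" for z U
    using G0[of z] G_eq[OF that] regularD[OF that] by simp
  obtain r0 U0 where r0: "1 \<le> r0" "regular U0" "sphere 0 r0 \<subseteq> U0" using circles[of 1] by auto
  have "complex_of_real r0 \<in> U0" using r0 by auto
  then obtain \<delta> where \<delta>: "\<delta> > 0" "ball (of_real r0) \<delta> \<subseteq> U0" using r0(2) unfolding regular_def open_contains_ball by blast
  \<comment> \<open>The neighbourhoods of different good circles need not be connected to each
    other, so a constant found on one of them does not transfer directly. The relations are
    therefore derived on one ball, rewritten between entire functions and continued to the whole
    plane.\<close>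
  define B where "B = ball (complex_of_real r0) \<delta>"
  have B: "regular B" "open B" "connected B" "B \<noteq> {}" using r0(2) \<delta> by (auto simp: regular_def B_def)
  have cont: "u z = v z" if "\<And>z. z \<in> B \<Longrightarrow> u z = v z" "u holomorphic_on UNIV" "v holomorphic_on UNIV" for u v z
    using analytic_continuation_open[of B UNIV u v z] B that by auto
  have hol: "(\<lambda>z. (F z)\<^sup>2) holomorphic_on UNIV" "(\<lambda>z. c * (f z ^ 4 * A z ^ 3)) holomorphic_on UNIV"
     "(\<lambda>z. (deriv A z)\<^sup>2) holomorphic_on UNIV" "(\<lambda>z. c * (A z ^ 3)) holomorphic_on UNIV" for c
    by (intro holomorphic_intros holomorphic_FG f(1) A(1) A')+
  \<comment> \<open>\<open>E = 0\<close> turns \<open>y E = w D - 2 D'\<close> into \<open>(D\<^sup>2 / A)' = 0\<close>.\<close>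
  have "((\<lambda>z. (D z)\<^sup>2 / A z) has_field_derivative 0) (at z)" if z: "z \<in> B" for z
  proof -
    have "w z * D z = 2 * deriv D z" using y_E[OF B(1) z] E0[OF B(1) z] by simp
    thus ?thesis using regularD[OF B(1) z]
      by (auto intro!: derivative_eq_intros derivs_yqw[OF B(1) z] simp: power2_eq_square field_simps)
  qed
  hence "(\<lambda>z. (D z)\<^sup>2 / A z) constant_on B" using B by (intro has_field_derivative_0_imp_constant_on) auto
  then obtain c where c: "\<And>z. z \<in> B \<Longrightarrow> (D z)\<^sup>2 / A z = c" by (auto simp: constant_on_def)
  have Fc: "(F z)\<^sup>2 = c * (f z ^ 4 * A z ^ 3)" for z
  proof (rule cont[OF _ hol(1,2)])
    fix z assume z: "z \<in> B"
    have "(D z)\<^sup>2 = c * A z" using c[OF z] regularD[OF B(1) z] by (simp add: field_simps)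
    thus "(F z)\<^sup>2 = c * (f z ^ 4 * A z ^ 3)" unfolding F_eq[OF B(1) z]
      by (simp add: power_mult_distrib power2_eq_square power3_eq_cube power4_eq_xxxx)
  qed
  have Dc: "(D z)\<^sup>2 = c * A z" if "regular U" "z \<in> U" for z U
  proof -
    have "(f z ^ 4 * A z ^ 2) * (D z)\<^sup>2 = (f z ^ 4 * A z ^ 2) * (c * A z)"
      using Fc[of z] unfolding F_eq[OF that]
      by (simp add: power_mult_distrib power2_eq_square power3_eq_cube power4_eq_xxxx algebra_simps)
    thus ?thesis using regularD[OF that] by simp
  qed
  \<comment> \<open>Serves for \<open>H = D\<close> and for \<open>H = w\<close>, both polynomially
    bounded on the good circles: a relation \<open>H^2 = d * A\<close> with
    \<open>d \<noteq> 0\<close> then bounds \<open>A\<close>.\<close>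
  have bound: ?thesis if d: "d \<noteq> 0" and H: "\<And>z U. regular U \<Longrightarrow> z \<in> U \<Longrightarrow> (H z)\<^sup>2 = d * A z"
     and HX: "\<And>z R. norm (w z) \<le> X R \<Longrightarrow> norm (D z) \<le> X R \<Longrightarrow> norm (H z) \<le> X R" for d :: complex and H
  proof (rule poly_growth_from_circles[OF A(1)])
    show "poly_bounded (\<lambda>R. X R ^ 2 * (1 / norm d))" using X0 by (intro poly_bounded_intros X(1)) auto
    fix R :: real assume R: "R \<ge> 1"
    obtain r U where r: "R \<le> r" "regular U" "sphere 0 r \<subseteq> U" "\<And>z. norm z = r \<Longrightarrow> norm (w z) \<le> X R \<and> norm (D z) \<le> X R"
      using circles[OF R] by blast
    have "norm (A z) \<le> X R ^ 2 * (1 / norm d)" if z: "norm z = r" for z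
    proof -
      have "norm (H z) ^ 2 \<le> X R ^ 2" using HX[of z R] r(4)[OF z] by (intro power_mono) auto
      moreover have "norm (H z) ^ 2 = norm d * norm (A z)"
        using H[OF r(2), of z] r(3) z by (simp flip: norm_power norm_mult) auto
      ultimately show ?thesis using d by (simp add: field_simps)
    qed
    thus "\<exists>r\<ge>R. \<forall>z. norm z = r \<longrightarrow> norm (A z) \<le> X R ^ 2 * (1 / norm d)" using r(1) by blast
  qed
  show ?thesis
  proof (cases "c = 0")
    case False
    thus ?thesis by (rule bound[of c D]) (use Dc in auto)
  next
    case True
    \<comment> \<open>Now \<open>E = 0\<close> reads \<open>2 * deriv w z = (w z)^2\<close>, and the
      derivative of \<open>w^2 / A\<close>, which is \<open>w * (2 * deriv w - w^2) / A\<close>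
      pointwise, vanishes.\<close>
    hence D0: "D z = 0" if "z \<in> B" for z using Dc[OF B(1) that] by simp
    have "((\<lambda>z. (w z)\<^sup>2 / A z) has_field_derivative 0) (at z)" if z: "z \<in> B" for z
    proof -
      have "2 * deriv w z = (w z)\<^sup>2" using E0[OF B(1) z] D0[OF z] by (simp add: E_def)
      hence "2 * w z * deriv w z * A z - (w z)\<^sup>2 * (w z * A z) = 0" by (simp add: power2_eq_square algebra_simps)
      thus ?thesis using regularD[OF B(1) z]
        by (auto intro!: derivative_eq_intros derivs_yqw[OF B(1) z] simp: power2_eq_square)
    qed
    hence "(\<lambda>z. (w z)\<^sup>2 / A z) constant_on B" using B by (intro has_field_derivative_0_imp_constant_on) auto
    then obtain d where d: "\<And>z. z \<in> B \<Longrightarrow> (w z)\<^sup>2 / A z = d" by (auto simp: constant_on_def)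
    have Ad: "(deriv A z)\<^sup>2 = d * (A z ^ 3)" for z
    proof (rule cont[OF _ hol(3,4)])
      fix z assume z: "z \<in> B"
      note nz = regularD[OF B(1) z]
      have "deriv A z = w z * A z" using nz by (simp add: w_def)
      moreover have "(w z)\<^sup>2 = d * A z" using d[OF z] nz by (simp add: field_simps)
      ultimately show "(deriv A z)\<^sup>2 = d * (A z ^ 3)" by (simp add: power_mult_distrib power2_eq_square power3_eq_cube)
    qed
    show ?thesis
    proof (cases "d = 0")
      case False
      have "(w z)\<^sup>2 = d * A z" if "regular U" "z \<in> U" for z U
        using Ad[of z] regularD[OF that] by (simp add: w_def power_divide field_simps power2_eq_square power3_eq_cube)
      thus ?thesis using bound[OF False, of w] by blast
    next
      case True
      hence "deriv A z = 0" for z using Ad[of z] by simp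
      hence "(A has_field_derivative 0) (at z)" for z using entire_derivs(3)[of z] by simp
      hence "A constant_on UNIV" by (intro has_field_derivative_0_imp_constant_on) auto
      then obtain a where "\<And>z. A z = a" by (auto simp: constant_on_def)
      thus ?thesis by (intro exI[of _ "norm a"] conjI exI[of _ 0]) auto
    qed
  qed
qed

end

section \<open>Growth of exponential sums\<close>

text \<open>Half of the gap between \<open>s\<close> and \<open>N\<close> pays for the logarithm, by
  \<open>ln r \<le> r powr e / e\<close>; the other half beats the constants.\<close>

lemma powr_eventually_dominates:
  fixes s N \<kappa> C1 C2 C3 :: real
  assumes "0 < s" "s < N" "\<kappa> > 0" "C1 \<ge> 0" "C2 \<ge> 0" "C3 \<ge> 0"
  shows "\<exists>R\<ge>1. \<forall>r\<ge>R. C1 * (1 + ln r) * (1 + C2 * r powr s) + C3 * r powr s < \<kappa> * r powr N"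
proof -
  define e where "e = (N - s) / 2"
  have e: "e > 0" "N = e + (s + e)" using assms by (auto simp: e_def field_simps)
  define B where "B = (C1 * (1 + 1 / e) * (1 + C2) + C3) / \<kappa>"
  have B: "B \<ge> 0" using assms e by (simp add: B_def)
  define R where "R = max 1 ((B + 1) powr (1 / e))"
  have "C1 * (1 + ln r) * (1 + C2 * r powr s) + C3 * r powr s < \<kappa> * r powr N" if r: "r \<ge> R" for r
  proof -
    have r1: "r \<ge> 1" "(B + 1) powr (1 / e) \<le> r" using r by (auto simp: R_def)
    have "B + 1 = ((B + 1) powr (1 / e)) powr e" using e B by (simp add: powr_powr)
    also have "\<dots> \<le> r powr e" using r1 e B by (intro powr_mono2) auto
    finally have Br: "B < r powr e" by simp
    have re: "r powr e \<ge> 1" "r powr s \<ge> 1" using r1 e assms by (auto intro!: ge_one_powr_ge_zero)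
    have "ln r * e = ln (r powr e)" using r1 by (simp add: ln_powr)
    also have "\<dots> \<le> r powr e" using ln_le_minus_one[of "r powr e"] r1 by simp
    finally have "ln r \<le> 1 / e * r powr e" using e by (simp add: field_simps)
    hence l: "1 + ln r \<le> (1 + 1 / e) * r powr e" using re by (simp add: algebra_simps)
    have "C1 * (1 + ln r) * (1 + C2 * r powr s) + C3 * r powr s \<le>
          C1 * ((1 + 1 / e) * r powr e) * ((1 + C2) * r powr s) + C3 * (r powr e * r powr s)"
    proof (intro add_mono mult_mono mult_left_mono l)
      show "1 + C2 * r powr s \<le> (1 + C2) * r powr s" using re by (simp add: algebra_simps)
      show "r powr s \<le> r powr e * r powr s" using re mult_right_mono[of 1 "r powr e" "r powr s"] by simp
    qed (use assms re e r1 in auto)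
    also have "\<dots> = (C1 * (1 + 1 / e) * (1 + C2) + C3) * (r powr e * r powr s)"
      by (simp add: algebra_simps add_divide_distrib)
    also have "\<dots> = \<kappa> * B * r powr (s + e)" using assms(3) by (simp add: B_def powr_add)
    also have "\<dots> < \<kappa> * r powr e * r powr (s + e)"
      using Br assms(3) r1 by (intro mult_strict_right_mono mult_strict_left_mono) auto
    also have "\<dots> = \<kappa> * r powr N" unfolding e(2) powr_add[of r e "s + e"] by (simp only: mult.assoc)
    finally show ?thesis .
  qed
  moreover have "R \<ge> 1" by (simp add: R_def)
  ultimately show ?thesis by blast
qed

text \<open>Follows from \<open>x ^ d = exp (d * ln x)\<close> and
  \<open>s * ln x = ln (x powr s) \<le> x powr s\<close>. Polynomial bounds thereby take the same
  form as the bounds for coefficients of smaller order.\<close>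

lemma power_le_exp_powr:
  fixes B x s :: real
  assumes "B \<ge> 0" "x \<ge> 1" "s > 0"
  shows "B * (1 + x) ^ d \<le> exp ((B * 2 ^ d + real d / s) * x powr s)"
proof -
  define p where "p = x powr s"
  have p: "p \<ge> 1" using assms by (auto simp: p_def intro!: ge_one_powr_ge_zero)
  have "B * (1 + x) ^ d \<le> B * (2 * x) ^ d" using assms by (intro mult_left_mono power_mono) auto
  also have "\<dots> = (B * 2 ^ d) * x ^ d" by (simp add: power_mult_distrib)
  also have "\<dots> \<le> exp (B * 2 ^ d * p) * exp (real d / s * p)"
  proof (rule mult_mono)
    have "B * 2 ^ d * 1 \<le> B * 2 ^ d * p" using p assms by (intro mult_left_mono) auto
    thus "B * 2 ^ d \<le> exp (B * 2 ^ d * p)" using exp_ge_add_one_self[of "B * 2 ^ d * p"] by linarith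
    have "s * ln x = ln p" using assms by (simp add: p_def ln_powr)
    also have "\<dots> \<le> p" using ln_le_minus_one[of p] p by simp
    finally have l: "ln x \<le> p / s" using assms by (simp add: field_simps)
    have "x ^ d = exp (real d * ln x)" using assms by (simp add: exp_of_nat_mult)
    also have "\<dots> \<le> exp (real d * (p / s))" using l by (intro exp_mono mult_left_mono) auto
    finally show "x ^ d \<le> exp (real d / s * p)" by simp
  qed (use assms in auto)
  also have "\<dots> = exp ((B * 2 ^ d + real d / s) * p)" by (simp add: exp_add[symmetric] distrib_right)
  finally show ?thesis by (simp add: p_def)
qed

text \<open>The exponent 1/2 is chosen as a positive number below every integer
  \<open>n \<ge> 1\<close>.\<close>

lemma exp_growth_of_polynomial:
  fixes p :: "complex poly"
  shows "\<exists>C\<ge>0. \<forall>z. norm z \<ge> 1 \<longrightarrow> norm (poly p z) \<le> exp (C * norm z powr (1/2))"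
proof -
  define B where "B = (\<Sum>i\<le>degree p. norm (coeff p i))"
  have B: "B \<ge> 0" unfolding B_def by (intro sum_nonneg) auto
  have "norm (poly p z) \<le> exp ((B * 2 ^ degree p + real (degree p) / (1/2)) * norm z powr (1/2))" if z: "norm z \<ge> 1" for z
  proof -
    have "norm (poly p z) \<le> (\<Sum>i\<le>degree p. norm (coeff p i) * norm z ^ i)"
      unfolding poly_altdef by (intro sum_norm_le) (auto simp: norm_mult norm_power)
    also have "\<dots> \<le> (\<Sum>i\<le>degree p. norm (coeff p i) * (1 + norm z) ^ degree p)"
      using z by (intro sum_mono mult_left_mono order_trans[OF power_mono power_increasing]) auto
    also have "\<dots> = B * (1 + norm z) ^ degree p" by (simp add: B_def sum_distrib_right)
    also have "\<dots> \<le> exp ((B * 2 ^ degree p + real (degree p) / (1/2)) * norm z powr (1/2))"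
      by (rule power_le_exp_powr) (use B z in auto)
    finally show ?thesis .
  qed
  thus ?thesis using B by (intro exI[of _ "B * 2 ^ degree p + real (degree p) / (1/2)"]) auto
qed

text \<open>Order below \<open>N\<close> in explicit instead of asymptotic form. The condition
  \<open>norm z \<ge> 1\<close> excludes the origin, where the right-hand side would be 1.\<close>

abbreviation exp_order_less :: "(complex \<Rightarrow> complex) \<Rightarrow> real \<Rightarrow> bool" where
  "exp_order_less h N \<equiv> \<exists>s C. 0 < s \<and> s < N \<and> C \<ge> 0 \<and> (\<forall>z. norm z \<ge> 1 \<longrightarrow> norm (h z) \<le> exp (C * norm z powr s))"

lemma exp_growth_of_order:
  assumes h: "h holomorphic_on UNIV" and ord: "entire_order h < ereal (real n)" and n: "n > 0"
  shows "exp_order_less h (real n)"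
proof -
  obtain s0 where s0: "entire_order h < ereal s0" "ereal s0 < ereal (real n)" using ereal_dense2[OF ord] by blast
  \<comment> \<open>The maximum makes the exponent positive without appeal to a lower bound for the
    order.\<close>
  define s where "s = max s0 (1/2)"
  have s: "0 < s" "s < real n" "s0 \<le> s" using s0 n by (auto simp: s_def)
  have "eventually (\<lambda>r. ereal (log_plus (log_plus (max_modulus h r)) / ln r) < ereal s0) at_top"
    by (rule Limsup_lessD) (use s0 in \<open>simp add: entire_order_def\<close>)
  then obtain r0 where r0: "\<And>r. r \<ge> r0 \<Longrightarrow> log_plus (log_plus (max_modulus h r)) / ln r < s0"
    by (auto simp: eventually_at_top_linorder)
  define R where "R = max 2 r0"
  have ch: "continuous_on S h" for S using holomorphic_on_imp_continuous_on holomorphic_on_subset[OF h] by blast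
  have big: "norm (h z) \<le> exp (norm z powr s)" if z: "norm z \<ge> R" for z
  proof -
    define r where "r = norm z"
    have r: "r > 1" "r \<ge> r0" "r > 0" using z by (auto simp: R_def r_def)
    have "bdd_above ((\<lambda>z. norm (h z)) ` sphere 0 r)"
      by (intro bounded_imp_bdd_above compact_imp_bounded compact_continuous_image continuous_on_norm ch) auto
    hence hM: "norm (h z) \<le> max_modulus h r" unfolding max_modulus_def
      by (intro cSUP_upper) (auto simp: r_def)
    define L where "L = max 1 (max_modulus h r)"
    have L: "L \<ge> 1" by (simp add: L_def)
    have "ln (max 1 (ln L)) < s0 * ln r"
      using r0[OF r(2)] r(1) by (simp add: log_plus_def L_def field_simps)
    also have "\<dots> \<le> s * ln r" using s r by (intro mult_right_mono) auto
    also have "\<dots> = ln (r powr s)" using r by (simp add: ln_powr)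
    finally have "max 1 (ln L) < r powr s" using r by (subst (asm) ln_less_cancel_iff) auto
    hence "exp (ln L) \<le> exp (r powr s)" by (intro exp_mono) auto
    hence "L \<le> exp (r powr s)" using L by simp
    thus ?thesis using hM by (simp add: L_def r_def)
  qed
  have "bounded (h ` cball 0 R)" by (intro compact_imp_bounded compact_continuous_image ch) auto
  then obtain B where "\<forall>x\<in>h ` cball 0 R. norm x \<le> B" unfolding bounded_iff by blast
  hence B: "norm (h z) \<le> B" if "norm z \<le> R" for z using that by auto
  define C where "C = 1 + \<bar>B\<bar>"
  have "norm (h z) \<le> exp (C * norm z powr s)" if z: "norm z \<ge> 1" for z
  proof (cases "norm z \<ge> R")
    case True
    have "1 * norm z powr s \<le> C * norm z powr s" by (intro mult_right_mono) (auto simp: C_def)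
    thus ?thesis using big[OF True] by (smt (verit) exp_le_cancel_iff)
  next
    case False
    have "norm z powr s \<ge> 1" using z s by (auto intro!: ge_one_powr_ge_zero)
    hence "C * 1 \<le> C * norm z powr s" by (intro mult_left_mono) (auto simp: C_def)
    moreover have "norm (h z) \<le> B" using B False by auto
    moreover have "B + 1 \<le> C" by (simp add: C_def)
    ultimately show ?thesis using exp_ge_add_one_self[of "C * norm z powr s"] by linarith
  qed
  moreover have "C \<ge> 0" by (simp add: C_def)
  ultimately show ?thesis using s(1,2) by blast
qed

text \<open>A Chebyshev-type count: for a zero with \<open>0 < norm a < R\<close>, its term of the
  series times \<open>R powr s\<close> is at least the multiplicity. The origin is not part of the
  series and is counted apart.\<close>

lemma zero_count_le_of_exponent:
  assumes f: "f holomorphic_on UNIV" "\<exists>z. f z \<noteq> 0" and ex: "zeros_exponent f < ereal N"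
  shows "\<exists>s C. 0 < s \<and> s < N \<and> C \<ge> 0 \<and> (\<forall>R\<ge>1. zero_count f R \<le> C * R powr s)"
proof -
  obtain s where s: "0 < s" "s < N"
    "(\<lambda>z. real_of_int (zorder f z) * norm z powr (- s)) summable_on {z. f z = 0 \<and> z \<noteq> 0}"
    using ex unfolding zeros_exponent_def Inf_less_iff by auto
  define t where "t = (\<lambda>z. real_of_int (zorder f z) * norm z powr (- s))"
  define C where "C = \<bar>real_of_int (zorder f 0)\<bar> + infsum t {z. f z = 0 \<and> z \<noteq> 0}"
  have zo: "real_of_int (zorder f a) \<ge> 0" if "f a = 0" for a using entire_zorder_pos[OF f that] by simp
  have t0: "t a \<ge> 0" if "a \<in> {z. f z = 0 \<and> z \<noteq> 0}" for a using zo that by (simp add: t_def)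
  have inf0: "infsum t {z. f z = 0 \<and> z \<noteq> 0} \<ge> 0" by (rule infsum_nonneg[OF t0])
  have "zero_count f R \<le> C * R powr s" if R: "R \<ge> 1" for R
  proof -
    define Z where "Z = zeros_in f R"
    have fZ: "finite Z" unfolding Z_def by (rule entire_finite_zeros(2)[OF f])
    have Rs: "R powr s \<ge> 1" using R s by (auto intro!: ge_one_powr_ge_zero)
    have "zero_count f R \<le> \<bar>real_of_int (zorder f 0)\<bar> + (\<Sum>a\<in>Z-{0}. real_of_int (zorder f a))"
    proof (cases "0 \<in> Z")
      case True
      thus ?thesis unfolding zero_count_def Z_def[symmetric] by (subst sum.remove[OF fZ True]) auto
    next
      case False
      thus ?thesis unfolding zero_count_def Z_def[symmetric] by simp
    qed
    also have "(\<Sum>a\<in>Z-{0}. real_of_int (zorder f a)) \<le> (\<Sum>a\<in>Z-{0}. t a * R powr s)"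
    proof (rule sum_mono)
      fix a assume a: "a \<in> Z - {0}"
      hence "norm a powr s \<le> R powr s" using s by (intro powr_mono2) (auto simp: Z_def)
      hence "t a * norm a powr s \<le> t a * R powr s" using t0[of a] a by (intro mult_left_mono) (auto simp: Z_def)
      thus "real_of_int (zorder f a) \<le> t a * R powr s" using a by (simp add: t_def powr_minus field_simps)
    qed
    also have "\<dots> = (\<Sum>a\<in>Z-{0}. t a) * R powr s" by (simp add: sum_distrib_right)
    also have "(\<Sum>a\<in>Z-{0}. t a) \<le> infsum t {z. f z = 0 \<and> z \<noteq> 0}"
      by (rule finite_sum_le_infsum) (use s(3) fZ t0 in \<open>auto simp: t_def[abs_def] Z_def\<close>)
    also have "\<bar>real_of_int (zorder f 0)\<bar> \<le> \<bar>real_of_int (zorder f 0)\<bar> * R powr s"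
      using Rs mult_left_mono[of 1 "R powr s" "\<bar>real_of_int (zorder f 0)\<bar>"] by simp
    finally show ?thesis using Rs by (simp add: C_def distrib_right mult_right_mono)
  qed
  thus ?thesis using s(1,2) inf0 by (intro exI[of _ s] exI[of _ C]) (auto simp: C_def)
qed

section \<open>Circle means of support functions and bounds for exponential sums\<close>

lemma support_fun_scale:
  assumes "finite V" "V \<noteq> {}" "r \<ge> 0"
  shows "support_fun V (of_real r * u) = r * support_fun V u"
proof -
  have "(\<lambda>v. v \<bullet> (of_real r * u)) ` V = (*) r ` ((\<lambda>v. v \<bullet> u) ` V)"
    by (simp add: image_image inner_complex_def algebra_simps)
  moreover have "mono ((*) r)" using assms(3) by (auto simp: mono_def mult_left_mono)
  ultimately show ?thesis unfolding support_fun_def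
    using mono_Max_commute[of "(*) r" "(\<lambda>v. v \<bullet> u) ` V"] assms by simp
qed

lemma continuous_support_fun:
  assumes "finite V" "V \<noteq> {}" "continuous_on S u"
  shows "continuous_on S (\<lambda>x. support_fun V (u x))"
  unfolding support_fun_def by (intro continuous_on_Max_image assms continuous_intros)

lemma support_fun_insert_0: "finite V \<Longrightarrow> V \<noteq> {} \<Longrightarrow> support_fun (insert 0 V) u = max 0 (support_fun V u)"
  by (simp add: support_fun_def)

text \<open>Homogeneity extracts the factor \<open>r ^ n\<close>, and periodicity removes the
  \<open>n\<close> turns of \<open>z ^ n\<close>. The two functions \<open>g\<close> of interest are
  \<open>min 0 x\<close> and \<open>2 * x - max 0 x / 2\<close>.\<close>

lemma circle_mean_support_fun_power:
  fixes g :: "real \<Rightarrow> real"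
  assumes V: "finite V" "V \<noteq> {}" and n: "n > 0" and g: "continuous_on UNIV g"
    and hom: "\<And>c x. c > 0 \<Longrightarrow> g (c * x) = c * g x" and r: "r > 0"
  shows "circle_mean (\<lambda>z. g (support_fun V (z ^ n))) r =
     r ^ n * (integral {0..2*pi} (\<lambda>t. g (support_fun V (cis t))) / (2*pi))"
proof -
  have pw: "(of_real r * cis t) ^ n = of_real (r ^ n) * cis (real n * t)" for t
    by (simp add: power_mult_distrib Complex.DeMoivre)
  have "support_fun V ((of_real r * cis t) ^ n) = r ^ n * support_fun V (cis (real n * t))" for t
    unfolding pw using r by (intro support_fun_scale V) auto
  hence "circle_mean (\<lambda>z. g (support_fun V (z ^ n))) r =
     r ^ n * (integral {0..2*pi} (\<lambda>t. g (support_fun V (cis (real n * t)))) / (2*pi))"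
    using hom r by (simp add: circle_mean_def)
  also have "integral {0..2*pi} (\<lambda>t. g (support_fun V (cis (real n * t)))) =
     integral {0..2*pi} (\<lambda>t. g (support_fun V (cis t)))"
  proof (rule integral_periodic_stretch)
    show "continuous_on UNIV (\<lambda>t. g (support_fun V (cis t)))"
      by (intro continuous_on_compose2[OF g] continuous_support_fun[OF V] continuous_intros) auto
    have "cis (x + 2 * pi) = cis x" for x by (simp add: complex_eq_iff)
    thus "g (support_fun V (cis (x + 2 * pi))) = g (support_fun V (cis x))" for x by simp
  qed (use n in auto)
  finally show ?thesis .
qed

text \<open>Jensen's formula keeps the mean of ln |P| bounded below, whereas the two bounds together
  put ln |P| below the negative part of the support function, up to lower order; the mean of that
  negative part is a negative multiple of \<open>r ^ n\<close>. The lemma is used for the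
  nonvanishing of exponential sums and for the case where \<open>A\<close> is polynomially
  bounded.\<close>

lemma no_exponential_decay_in_mean:
  fixes s C :: real and n :: nat
  assumes P: "P holomorphic_on UNIV" "\<exists>z. P z \<noteq> 0" and V: "finite V" "V \<noteq> {}"
    and n: "n > 0" and s: "0 < s" "s < real n" and C: "C \<ge> 0"
    and neg: "integral {0..2*pi} (\<lambda>t. min 0 (support_fun V (cis t))) < 0"
    and le: "\<And>z. norm z \<ge> 1 \<Longrightarrow> norm (P z) \<le> exp (C * norm z powr s)"
      "\<And>z. norm z \<ge> 1 \<Longrightarrow> norm (P z) \<le> exp (support_fun V (z ^ n) + C * norm z powr s)"
  shows False
proof -
  define \<phi> where "\<phi> = (\<lambda>z::complex. min 0 (support_fun V (z ^ n)))"
  have \<phi>: "continuous_on UNIV \<phi>" unfolding \<phi>_def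
    by (intro continuous_on_min continuous_on_const continuous_support_fun[OF V] continuous_intros)
  have hom: "circle_mean \<phi> r = r ^ n * (integral {0..2*pi} (\<lambda>t. min 0 (support_fun V (cis t))) / (2*pi))" if "r > 0" for r
    unfolding \<phi>_def by (rule circle_mean_support_fun_power[OF V n _ _ that, of "\<lambda>x. min 0 x"])
      (auto intro!: continuous_intros continuous_on_min simp: min_mult_distrib_left)
  define \<kappa> where "\<kappa> = - (integral {0..2*pi} (\<lambda>t. min 0 (support_fun V (cis t))) / (2*pi))"
  have \<kappa>: "\<kappa> > 0" using neg by (simp add: \<kappa>_def divide_neg_pos)
  obtain C1 where C1: "C1 \<ge> 0" "\<And>R. R \<ge> 1 \<Longrightarrow> zero_free P R \<Longrightarrow> mean_log P R \<ge> - C1"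
    using Jensen_bounds[OF P] by blast
  obtain R where R: "R \<ge> 1"
    "\<And>r. r \<ge> R \<Longrightarrow> C1 * (1 + ln r) * (1 + 0 * r powr s) + C * r powr s < \<kappa> * r powr real n"
    using powr_eventually_dominates[OF s \<kappa> C1(1), of 0 C] C by auto
  obtain r where r: "R \<le> r" and zf: "zero_free P r" using exists_zero_free_radius[OF P, of R] R by auto
  have r1: "r \<ge> 1" "r > 0" using r R by auto
  have c\<phi>: "continuous_on (sphere 0 r) \<phi>" by (rule continuous_on_subset[OF \<phi>]) auto
  have "- C1 \<le> mean_log P r" by (rule C1(2)[OF r1(1) zf])
  also have "\<dots> \<le> circle_mean (\<lambda>z. \<phi> z + C * r powr s) r"
  proof (rule circle_mean_mono[OF continuous_on_ln_norm[OF P(1) zf] _ r1(2)])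
    fix z :: complex assume z: "norm z = r"
    have "P z \<noteq> 0" using zf z by (auto simp: zero_free_def)
    hence "ln (norm (P z)) \<le> t" if "norm (P z) \<le> exp t" for t
      using that ln_le_cancel_iff[of "norm (P z)" "exp t"] by simp
    hence "ln (norm (P z)) \<le> C * norm z powr s" "ln (norm (P z)) \<le> support_fun V (z ^ n) + C * norm z powr s"
      using le z r1 by auto
    thus "ln (norm (P z)) \<le> \<phi> z + C * r powr s" using z by (simp add: \<phi>_def)
  qed (intro continuous_intros c\<phi>)
  also have "\<dots> = circle_mean \<phi> r + C * r powr s" using r1 c\<phi> by (subst circle_mean_add) auto
  also have "circle_mean \<phi> r = r ^ n * - \<kappa>" unfolding \<kappa>_def by (simp add: hom[OF r1(2)])
  also have "r ^ n = r powr real n" using r1 by (simp add: powr_realpow)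
  finally have "- C1 \<le> r powr real n * - \<kappa> + C * r powr s" .
  moreover have "C1 * 1 \<le> C1 * (1 + ln r)" using C1(1) r1 by (intro mult_left_mono) auto
  ultimately show False using R(2)[OF r] by (simp add: algebra_simps)
qed

text \<open>The number of terms is absorbed by
  \<open>real (card J) \<le> exp (real (card J) * x)\<close>, which keeps the bound a single
  exponential.\<close>

lemma exponential_sum_bound:
  fixes h :: "'i \<Rightarrow> complex" and x C :: real
  assumes J: "finite J" and x: "x \<ge> 1" and h: "\<And>j. j \<in> J \<Longrightarrow> norm (h j) \<le> exp (C * x)"
  shows "norm (\<Sum>j\<in>J. h j * exp (\<xi> j * u)) \<le> exp (support_fun ((\<lambda>j. cnj (\<xi> j)) ` J) u + (C + real (card J)) * x)"
proof -
  let ?k = "support_fun ((\<lambda>j. cnj (\<xi> j)) ` J) u"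
  have "norm (\<Sum>j\<in>J. h j * exp (\<xi> j * u)) \<le> (\<Sum>j\<in>J. exp (C * x) * exp ?k)"
  proof (rule sum_norm_le)
    fix j assume j: "j \<in> J"
    have "cnj (\<xi> j) \<bullet> u \<le> ?k" unfolding support_fun_def using J j by (intro Max_ge) auto
    hence "Re (\<xi> j * u) \<le> ?k" by (simp add: inner_complex_def)
    thus "norm (h j * exp (\<xi> j * u)) \<le> exp (C * x) * exp ?k"
      unfolding norm_mult norm_exp_eq_Re using h[OF j] by (intro mult_mono) auto
  qed
  also have "\<dots> = real (card J) * (exp (C * x) * exp ?k)" by simp
  also have "\<dots> \<le> exp (real (card J) * x) * (exp (C * x) * exp ?k)"
  proof (intro mult_right_mono)
    have "real (card J) * 1 \<le> real (card J) * x" using x by (intro mult_left_mono) auto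
    thus "real (card J) \<le> exp (real (card J) * x)" using exp_ge_add_one_self[of "real (card J) * x"] by linarith
  qed auto
  also have "\<dots> = exp (?k + (C + real (card J)) * x)" by (simp add: exp_add[symmetric] algebra_simps)
  finally show ?thesis .
qed

text \<open>Needed because Jensen's formula is applied to \<open>A\<close>. If the sum vanished
  identically, solving for one coefficient would write \<open>H k\<close> as a sum of terms that all
  decay exponentially in a common sector, which is impossible for a nonzero function of order below
  \<open>n\<close>.\<close>

lemma exponential_sum_nonzero:
  fixes H :: "nat \<Rightarrow> complex \<Rightarrow> complex" and \<zeta> :: "nat \<Rightarrow> complex" and s C :: real
  assumes n: "n > 0" and m: "m > 0"
    and H: "\<And>j. j \<in> {1..m} \<Longrightarrow> H j holomorphic_on UNIV" "\<And>j. j \<in> {1..m} \<Longrightarrow> \<exists>z. H j z \<noteq> 0"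
    and s: "0 < s" "s < real n" and C: "C \<ge> 0"
    and Hle: "\<And>j z. j \<in> {1..m} \<Longrightarrow> norm z \<ge> 1 \<Longrightarrow> norm (H j z) \<le> exp (C * norm z powr s)"
    and inj: "inj_on \<zeta> {1..m}" and nz: "\<And>j. j \<in> {1..m} \<Longrightarrow> \<zeta> j \<noteq> 0"
  shows "\<exists>z. (\<Sum>j=1..m. H j z * exp (\<zeta> j * z ^ n)) \<noteq> 0"
proof (rule ccontr)
  assume "\<not> ?thesis"
  hence sum0: "(\<Sum>j=1..m. H j z * exp (\<zeta> j * z ^ n)) = 0" for z by auto
  define J where "J = {1..m}"
  have J: "finite J" "J \<noteq> {}" using m by (auto simp: J_def)
  \<comment> \<open>An exponent of maximal modulus strictly dominates all the others in its own direction.\<close>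
  define M where "M = Max ((\<lambda>j. norm (\<zeta> j)) ` J)"
  have "M \<in> (\<lambda>j. norm (\<zeta> j)) ` J" unfolding M_def using J by (intro Max_in) auto
  then obtain k where k: "k \<in> J" "norm (\<zeta> k) = M" by auto
  have Mle: "norm (\<zeta> j) \<le> norm (\<zeta> k)" if "j \<in> J" for j unfolding k(2) M_def using J that by (intro Max_ge) auto
  define J' where "J' = J - {k}"
  have Hk: "H k z = - (\<Sum>j\<in>J'. H j z * exp ((\<zeta> j - \<zeta> k) * z ^ n))" for z
  proof -
    have "0 = exp (- \<zeta> k * z ^ n) * (\<Sum>j\<in>J. H j z * exp (\<zeta> j * z ^ n))" using sum0[of z] by (simp add: J_def)
    also have "\<dots> = (\<Sum>j\<in>J. H j z * exp ((\<zeta> j - \<zeta> k) * z ^ n))"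
      unfolding sum_distrib_left by (intro sum.cong refl) (simp add: left_diff_distrib exp_diff exp_minus field_simps)
    also have "\<dots> = H k z + (\<Sum>j\<in>J'. H j z * exp ((\<zeta> j - \<zeta> k) * z ^ n))"
      unfolding J'_def by (subst sum.remove[OF J(1) k(1)]) simp
    finally show ?thesis by (simp add: add_eq_0_iff2)
  qed
  have J': "finite J'" "J' \<noteq> {}"
  proof -
    show "finite J'" using J by (simp add: J'_def)
    show "J' \<noteq> {}"
    proof
      assume "J' = {}"
      hence "H k z = 0" for z using Hk[of z] by simp
      thus False using H(2)[of k] k by (auto simp: J_def)
    qed
  qed
  define V where "V = (\<lambda>j. cnj (\<zeta> j - \<zeta> k)) ` J'"
  have V: "finite V" "V \<noteq> {}" using J' by (auto simp: V_def)
  show False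
  proof (rule no_exponential_decay_in_mean[OF _ _ V n s, of "H k" "C + real (card J')"])
    show "H k holomorphic_on UNIV" "\<exists>z. H k z \<noteq> 0" using H k by (auto simp: J_def)
    show "C + real (card J') \<ge> 0" using C by simp
    fix z :: complex assume z: "norm z \<ge> 1"
    have x: "norm z powr s \<ge> 1" using z s by (auto intro!: ge_one_powr_ge_zero)
    have "C * norm z powr s \<le> (C + real (card J')) * norm z powr s" by (intro mult_right_mono) auto
    moreover have "norm (H k z) \<le> exp (C * norm z powr s)" using Hle[of k z] k(1) z by (simp add: J_def)
    ultimately show "norm (H k z) \<le> exp ((C + real (card J')) * norm z powr s)" by (meson exp_le_cancel_iff order_trans)
    have "norm (H j z) \<le> exp (C * norm z powr s)" if "j \<in> J'" for j
      using Hle[of j z] z that by (auto simp: J'_def J_def)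
    from exponential_sum_bound[OF J'(1) x this]
    show "norm (H k z) \<le> exp (support_fun V (z ^ n) + (C + real (card J')) * norm z powr s)"
      unfolding Hk norm_minus_cancel V_def .
  next
    define \<phi> where "\<phi> = (\<lambda>t. min 0 (support_fun V (cis t)))"
    have c\<phi>: "continuous_on S \<phi>" for S unfolding \<phi>_def
      by (intro continuous_on_min continuous_on_const continuous_support_fun[OF V] continuous_intros)
    have int: "\<phi> integrable_on {0..2*pi}" by (rule integrable_continuous_real[OF c\<phi>])
    have \<phi>0: "\<phi> t \<le> 0" for t by (simp add: \<phi>_def)
    define t0 where "t0 = Arg2pi (cnj (\<zeta> k))"
    have t0: "t0 \<in> {0..2*pi}" using Arg2pi_ge_0[of "cnj (\<zeta> k)"] Arg2pi_lt_2pi[of "cnj (\<zeta> k)"] by (simp add: t0_def)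
    have kpos: "norm (\<zeta> k) > 0" using nz[of k] k(1) by (simp add: J_def)
    have ck: "cnj (\<zeta> k) = of_real (norm (\<zeta> k)) * cis t0"
      using Arg2pi_eq[of "cnj (\<zeta> k)"] by (simp add: cis_conv_exp t0_def)
    have "cnj (\<zeta> j - \<zeta> k) \<bullet> cis t0 < 0" if "j \<in> J'" for j
    proof -
      have jk: "j \<in> J" "j \<noteq> k" using that by (auto simp: J'_def)
      hence ne: "\<zeta> j \<noteq> \<zeta> k" using inj_onD[OF inj] k(1) unfolding J_def by blast
      \<comment> \<open>Expanding the square shows that the inner product must be negative when the
        vectors differ and \<open>\<zeta> k\<close> has the larger or an equal modulus.\<close>
      have "norm (\<zeta> j - \<zeta> k) ^ 2 = norm (\<zeta> j) ^ 2 - norm (\<zeta> k) ^ 2 - 2 * (cnj (\<zeta> j - \<zeta> k) \<bullet> cnj (\<zeta> k))"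
        unfolding cmod_power2 by (simp add: inner_complex_def power2_eq_square algebra_simps)
      moreover have "norm (\<zeta> j - \<zeta> k) ^ 2 > 0" using ne by simp
      moreover have "norm (\<zeta> j) ^ 2 \<le> norm (\<zeta> k) ^ 2" using Mle[OF jk(1)] by (intro power_mono) auto
      ultimately have "cnj (\<zeta> j - \<zeta> k) \<bullet> cnj (\<zeta> k) < 0" by linarith
      moreover have "cnj (\<zeta> j - \<zeta> k) \<bullet> cnj (\<zeta> k) = norm (\<zeta> k) * (cnj (\<zeta> j - \<zeta> k) \<bullet> cis t0)"
        unfolding ck by (simp add: inner_complex_def algebra_simps)
      ultimately show ?thesis using kpos by (simp add: mult_less_0_iff)
    qed
    hence neg: "\<phi> t0 < 0" unfolding \<phi>_def support_fun_def V_def using J' by simp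
    have "integral {0..2*pi} \<phi> \<le> integral {0..2*pi} (\<lambda>_. 0)"
      by (rule integral_le[OF int]) (auto simp: \<phi>0)
    hence "integral {0..2*pi} \<phi> \<le> 0" by simp
    \<comment> \<open>A continuous nonpositive function with integral 0 vanishes everywhere, in
      particular at \<open>t0\<close>.\<close>
    moreover have "integral {0..2*pi} \<phi> \<noteq> 0"
    proof
      assume "integral {0..2*pi} \<phi> = 0"
      hence "((\<lambda>t. - \<phi> t) has_integral 0) (cbox 0 (2*pi))" using int has_integral_neg[of \<phi> 0 "{0..2*pi}"] by (simp add: has_integral_iff)
      from has_integral_0_cbox_imp_0[OF continuous_on_minus[OF c\<phi>] _ this _, of t0] have "- \<phi> t0 = 0"
        using \<phi>0 t0 pi_gt_zero by auto
      thus False using neg by simp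
    qed
    ultimately show "integral {0..2*pi} (\<lambda>t. min 0 (support_fun V (cis t))) < 0" by (simp add: \<phi>_def)
  qed
qed

section \<open>Growth and perimeter data of the theorem, and its proof\<close>

lemma exp_growth_of_coefficient:
  assumes "(exponential_polynomial h \<and> entire_order h < ereal (real n)) \<or> (\<exists>p :: complex poly. \<forall>z. h z = poly p z)"
    and n: "n > 0"
  shows "h holomorphic_on UNIV"
    and "exp_order_less h (real n)"
proof -
  consider (ep) "exponential_polynomial h" "entire_order h < ereal (real n)" | (p) p where "h = poly p"
    using assms(1) by (auto simp: fun_eq_iff)
  hence "h holomorphic_on UNIV \<and>
    (exp_order_less h (real n))"
  proof cases
    case ep
    obtain k P Q where "\<And>z. h z = (\<Sum>j=1..k::nat. poly (P j) z * exp (poly (Q j) z))"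
      using ep(1) unfolding exponential_polynomial_def by blast
    hence "h = (\<lambda>z. \<Sum>j=1..k. poly (P j) z * exp (poly (Q j) z))" by auto
    hence "h holomorphic_on UNIV" by (auto intro!: holomorphic_intros)
    thus ?thesis using exp_growth_of_order[OF _ ep(2) n] by blast
  next
    case p
    obtain C where "C \<ge> 0" "\<forall>z. norm z \<ge> 1 \<longrightarrow> norm (h z) \<le> exp (C * norm z powr (1/2))"
      using exp_growth_of_polynomial[of p] p by blast
    moreover have "(1/2::real) < real n" using n by simp
    moreover have "h holomorphic_on UNIV" unfolding p by (intro holomorphic_intros)
    ultimately show ?thesis by (intro conjI exI[of _ "1/2"] exI[of _ C]) auto
  qed
  thus "h holomorphic_on UNIV"
    "exp_order_less h (real n)" by auto
qed

text \<open>The floor \<open>s0\<close> will be the exponent of the zero count of \<open>f\<close>,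
  so that one \<open>s\<close> below \<open>N\<close> dominates both the coefficients and the
  zeros.\<close>

lemma exp_growth_uniform:
  fixes H :: "'i \<Rightarrow> complex \<Rightarrow> complex"
  assumes "finite J" "s0 > 0" "s0 < N"
    and "\<And>j. j \<in> J \<Longrightarrow> exp_order_less (H j) N"
  shows "\<exists>s C. s0 \<le> s \<and> s < N \<and> C \<ge> 0 \<and> (\<forall>j\<in>J. \<forall>z. norm z \<ge> 1 \<longrightarrow> norm (H j z) \<le> exp (C * norm z powr s))"
  using assms(1,4)
proof (induction J rule: finite_induct)
  case empty
  thus ?case using assms by (intro exI[of _ s0] exI[of _ 0]) auto
next
  case (insert i J)
  obtain s C where 1: "s0 \<le> s" "s < N" "C \<ge> 0"
    "\<And>j z. j \<in> J \<Longrightarrow> norm z \<ge> 1 \<Longrightarrow> norm (H j z) \<le> exp (C * norm z powr s)"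
    using insert.IH insert.prems by blast
  obtain s' C' where 2: "s' < N" "C' \<ge> 0"
    "\<And>z. norm z \<ge> 1 \<Longrightarrow> norm (H i z) \<le> exp (C' * norm z powr s')"
    using insert.prems[of i] by blast
  have le: "exp (a * x powr t) \<le> exp (max C C' * x powr max s s')"
    if "x \<ge> 1" "0 \<le> a" "a \<le> max C C'" "t \<le> max s s'" for a x t :: real
    using that by (auto intro!: mult_mono powr_mono simp del: max.coboundedI1 max.coboundedI2)
  have "norm (H j z) \<le> exp (max C C' * norm z powr max s s')" if "j \<in> insert i J" "norm z \<ge> 1" for j z
  proof (cases "j = i")
    case True
    thus ?thesis using 2(3)[OF that(2)] le[of "norm z" C' s'] 2(2) that(2) by (auto intro: order_trans)
  next
    case False
    thus ?thesis using 1(4)[of j z] le[of "norm z" C s] 1(3) that by (auto intro: order_trans)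
  qed
  thus ?case using 1(1,2,3) 2(1) by (intro exI[of _ "max s s'"] exI[of _ "max C C'"]) auto
qed

text \<open>By Cauchy's formula the integrals are 2 C(co W) - C(co W0) / 2 and C(co W) - C(co W0),
  where W0 is \<open>insert 0 W\<close>. The hypothesis on the perimeters says exactly that the
  first is negative; with C(co W0) nonnegative it makes the second negative too.\<close>

lemma integral_support_fun_excess:
  fixes W :: "complex set"
  assumes W: "finite W" "W \<noteq> {}"
    and circ: "circumference (convex hull (insert 0 W)) > 4 * circumference (convex hull W)"
  shows "integral {0..2*pi} (\<lambda>t. 2 * support_fun W (cis t) - max 0 (support_fun W (cis t)) / 2) < 0"
    and "integral {0..2*pi} (\<lambda>t. min 0 (support_fun W (cis t))) < 0"
proof -
  define h where "h = (\<lambda>t. support_fun W (cis t))"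
  have ch: "continuous_on S h" for S unfolding h_def
    by (intro continuous_support_fun[OF W] continuous_intros)
  have i: "h integrable_on {0..2*pi}" "(\<lambda>t. max 0 (h t)) integrable_on {0..2*pi}"
    by (intro integrable_continuous_real continuous_on_max continuous_on_const ch)+
  have I: "integral {0..2*pi} h = circumference (convex hull W)"
    unfolding h_def by (rule circumference_eq_integral_support_fun[OF W])
  have I0: "integral {0..2*pi} (\<lambda>t. max 0 (h t)) = circumference (convex hull (insert 0 W))"
    using circumference_eq_integral_support_fun[of "insert 0 W"] W by (simp add: support_fun_insert_0 h_def)
  have "integral {0..2*pi} (\<lambda>t. 2 * h t - max 0 (h t) / 2) = 2 * integral {0..2*pi} h - integral {0..2*pi} (\<lambda>t. max 0 (h t)) / 2"
    using i by (subst integral_diff) (auto intro!: integrable_on_cmult_left)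
  thus "integral {0..2*pi} (\<lambda>t. 2 * support_fun W (cis t) - max 0 (support_fun W (cis t)) / 2) < 0"
    using I I0 circ by (simp add: h_def)
  have "min 0 (h t) = h t - max 0 (h t)" for t by (simp add: min_def max_def)
  hence "integral {0..2*pi} (\<lambda>t. min 0 (h t)) = integral {0..2*pi} h - integral {0..2*pi} (\<lambda>t. max 0 (h t))"
    using i by (simp add: integral_diff)
  moreover have "integral {0..2*pi} (\<lambda>t. max 0 (h t)) \<ge> 0" by (rule integral_nonneg[OF i(2)]) auto
  ultimately show "integral {0..2*pi} (\<lambda>t. min 0 (support_fun W (cis t))) < 0"
    using I I0 circ by (simp add: h_def)
qed

theorem corollary1:
  fixes n m :: nat
    and H :: "nat \<Rightarrow> complex \<Rightarrow> complex"
    and \<zeta> :: "nat \<Rightarrow> complex"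
    and A f :: "complex \<Rightarrow> complex"
    and W W0 :: "complex set"
  assumes "n > 0" and "m > 0"
    and "\<And>z. A z = (\<Sum>j=1..m. H j z * exp (\<zeta> j * z ^ n))"
    and "\<And>j. j \<in> {1..m} \<Longrightarrow> \<exists>z. H j z \<noteq> 0"
    and "\<And>j. j \<in> {1..m} \<Longrightarrow>
           (exponential_polynomial (H j) \<and> entire_order (H j) < ereal (real n)) \<or>
           (\<exists>p :: complex poly. \<forall>z. H j z = poly p z)"
    and "inj_on \<zeta> {1..m}"
    and "\<And>j. j \<in> {1..m} \<Longrightarrow> \<zeta> j \<noteq> 0"
    and "W = (\<lambda>j. cnj (\<zeta> j)) ` {1..m}"
    and "W0 = W \<union> {0}"
    and "circumference (convex hull W0) > 4 * circumference (convex hull W)"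
    and "f holomorphic_on UNIV"
    and "\<And>z. deriv (deriv f) z + A z * f z = 0"
    and "\<exists>z. f z \<noteq> 0"
  shows "zeros_exponent f \<ge> ereal (real n)"
proof (rule ccontr)
  assume "\<not> ?thesis"
  hence lt: "zeros_exponent f < ereal (real n)" by simp
  obtain s0 Cf where s0: "0 < s0" "s0 < real n" and Cf: "Cf \<ge> 0" "\<And>R. R \<ge> 1 \<Longrightarrow> zero_count f R \<le> Cf * R powr s0"
    using zero_count_le_of_exponent[OF assms(11,13) lt] by blast
  note Hj = exp_growth_of_coefficient[OF assms(5) assms(1)]
  obtain s CH where s: "s0 \<le> s" "s < real n" and CH: "CH \<ge> 0"
    "\<And>j z. j \<in> {1..m} \<Longrightarrow> norm z \<ge> 1 \<Longrightarrow> norm (H j z) \<le> exp (CH * norm z powr s)"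
    using exp_growth_uniform[of "{1..m}" s0 "real n" H, OF finite_atLeastAtMost s0 Hj(2)] by blast
  have s_pos: "0 < s" using s0 s by linarith
  have A_nz: "\<exists>z. A z \<noteq> 0" unfolding assms(3)
    by (rule exponential_sum_nonzero[OF assms(1,2) Hj(1) assms(4) s_pos s(2) CH(1,2) assms(6,7)])
  have A_hol: "A holomorphic_on UNIV"
  proof -
    have "A = (\<lambda>z. \<Sum>j=1..m. H j z * exp (\<zeta> j * z ^ n))" using assms(3) by auto
    thus ?thesis using Hj(1) by (auto intro!: holomorphic_intros)
  qed
  have W: "finite W" "W \<noteq> {}" using assms(2,8) by auto
  have W0: "W0 = insert 0 W" using assms(9) by auto
  define K where "K = (\<lambda>z. support_fun W (z ^ n))"
  have cK: "continuous_on S K" for S unfolding K_def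
    by (intro continuous_support_fun[OF W] continuous_intros)
  define C where "C = CH + real m"
  have C: "C \<ge> 0" using CH by (simp add: C_def)
  have A_le: "norm (A z) \<le> exp (K z + C * norm z powr s)" if z: "norm z \<ge> 1" for z
  proof -
    have x: "norm z powr s \<ge> 1" using z s_pos by (auto intro!: ge_one_powr_ge_zero)
    have "norm (H j z) \<le> exp (CH * norm z powr s)" if "j \<in> {1..m}" for j by (rule CH(2)[OF that z])
    from exponential_sum_bound[of "{1..m}" "norm z powr s" "\<lambda>j. H j z" CH \<zeta> "z ^ n", OF finite_atLeastAtMost x this]
    show ?thesis unfolding assms(3) K_def C_def assms(8) by simp
  qed
  have K_le: "K z \<le> (\<Sum>w\<in>W. norm w) * norm z ^ n" for z
    unfolding K_def support_fun_def
  proof (rule Max.boundedI)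
    fix x assume "x \<in> (\<lambda>v. v \<bullet> z ^ n) ` W"
    then obtain v where v: "v \<in> W" "x = v \<bullet> z ^ n" by auto
    have "x \<le> norm v * norm z ^ n" using norm_cauchy_schwarz[of v "z ^ n"] v by (simp add: norm_power)
    also have "\<dots> \<le> (\<Sum>w\<in>W. norm w) * norm z ^ n"
      using W(1) v(1) by (intro mult_right_mono member_le_sum) auto
    finally show "x \<le> (\<Sum>w\<in>W. norm w) * norm z ^ n" .
  qed (use W in auto)
  have "bounded (A ` cball 0 1)"
    by (intro compact_imp_bounded compact_continuous_image holomorphic_on_imp_continuous_on holomorphic_on_subset[OF A_hol]) auto
  then obtain B where "\<forall>x\<in>A ` cball 0 1. norm x \<le> B" unfolding bounded_iff by blast
  hence B: "norm (A z) \<le> B" if "norm z \<le> 1" for z using that by auto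
  \<comment> \<open>One constant for the whole locale: zeros of \<open>f\<close>, support function,
    lower-order terms, and through \<open>B\<close> the unit disc, which the bound
    \<open>A_le\<close> leaves out.\<close>
  define C0 where "C0 = Cf + (\<Sum>w\<in>W. norm w) + C + \<bar>B\<bar>"
  have W_nonneg: "(\<Sum>w\<in>W. norm w) \<ge> 0" by (intro sum_nonneg) auto
  have powr_le: "R powr t \<le> R ^ n" if "R \<ge> 1" "t \<le> real n" for R t
    using that powr_mono[of t "real n" R] by (simp add: powr_realpow)
  interpret sparse_solution A f C0 n
  proof
    show "A holomorphic_on UNIV" "\<exists>z. A z \<noteq> 0" by (fact A_hol A_nz)+
    show "f holomorphic_on UNIV" "\<exists>z. f z \<noteq> 0" "\<And>z. deriv (deriv f) z + A z * f z = 0" by (fact assms)+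
    show "C0 \<ge> 0" using Cf W_nonneg C by (simp add: C0_def)
    show "norm (A z) \<le> exp (C0 * R ^ n)" if R: "R \<ge> 1" "norm z \<le> R" for R z
    proof (cases "norm z \<ge> 1")
      case True
      have zR: "norm z ^ n \<le> R ^ n" using R by (intro power_mono) auto
      have "K z + C * norm z powr s \<le> (\<Sum>w\<in>W. norm w) * norm z ^ n + C * norm z ^ n"
        using True s(2) C by (intro add_mono K_le mult_left_mono powr_le) auto
      also have "\<dots> = ((\<Sum>w\<in>W. norm w) + C) * norm z ^ n" by (simp add: algebra_simps)
      also have "\<dots> \<le> C0 * R ^ n" using zR W_nonneg C Cf(1) by (intro mult_mono) (auto simp: C0_def)
      finally show ?thesis using A_le[OF True] by (meson exp_le_cancel_iff order_trans)
    next
      case False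
      have Rn: "R ^ n \<ge> 1" using R by simp
      have "norm (A z) \<le> \<bar>B\<bar> * 1" using B[of z] False by auto
      also have "\<dots> \<le> C0 * R ^ n" using Rn W_nonneg C Cf(1) by (intro mult_mono) (auto simp: C0_def)
      also have "\<dots> \<le> exp (C0 * R ^ n)" using exp_ge_add_one_self[of "C0 * R ^ n"] by linarith
      finally show ?thesis .
    qed
    show "zero_count f R \<le> C0 * R ^ n" if R: "R \<ge> 1" for R
    proof -
      have "zero_count f R \<le> Cf * R powr s0" by (rule Cf(2)[OF R])
      also have "\<dots> \<le> C0 * R ^ n" using R s0 Cf(1) W_nonneg C
        by (intro mult_mono powr_le) (auto simp: C0_def)
      finally show ?thesis .
    qed
  qed
  define \<kappa> where "\<kappa> = - (integral {0..2*pi} (\<lambda>t. 2 * support_fun W (cis t) - max 0 (support_fun W (cis t)) / 2) / (2*pi))"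
  note circ = integral_support_fun_excess[OF W assms(10)[unfolded W0]]
  have \<kappa>: "\<kappa> > 0" using circ(1) by (simp add: \<kappa>_def divide_neg_pos)
  show False
  proof (cases "\<exists>z. G z \<noteq> 0")
    case True
    from mean_log_A_lower[OF True] obtain C1 where C1: "C1 \<ge> 0"
      "\<And>R. R \<ge> 1 \<Longrightarrow> \<exists>r. R \<le> r \<and> r \<le> 2 * R \<and> zero_free A r \<and>
         - C1 * (1 + ln r) * (1 + zero_count f r) \<le> circle_mean (damped_log A) r"
      by blast
    \<comment> \<open>The error \<open>C * r powr s\<close> in the bound for ln |A| counts at most
      twice, since \<open>damped_log\<close> has slope at most 2 in ln |A|; hence
      \<open>2 * C\<close>.\<close>
    obtain R where R: "R \<ge> 1" "\<And>r. r \<ge> R \<Longrightarrow> C1 * (1 + ln r) * (1 + Cf * r powr s) + 2 * C * r powr s < \<kappa> * r powr real n"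
      using powr_eventually_dominates[OF s_pos s(2) \<kappa> C1(1) Cf(1), of "2 * C"] C by auto
    obtain r where r: "R \<le> r" "zero_free A r"
      "- C1 * (1 + ln r) * (1 + zero_count f r) \<le> circle_mean (damped_log A) r"
      using C1(2)[OF R(1)] by blast
    have r1: "r \<ge> 1" "r > 0" using r R by auto
    have "zero_count f r \<le> Cf * r powr s"
      using Cf(2)[OF r1(1)] mult_left_mono[OF powr_mono[OF s(1) r1(1)] Cf(1)] by linarith
    hence "C1 * (1 + ln r) * (1 + zero_count f r) \<le> C1 * (1 + ln r) * (1 + Cf * r powr s)"
      using C1(1) r1 by (intro mult_left_mono) auto
    hence "- (C1 * (1 + ln r) * (1 + Cf * r powr s)) \<le> circle_mean (damped_log A) r"
      using r(3) by simp
    also have "\<dots> \<le> circle_mean (\<lambda>z. (2 * K z - max 0 (K z) / 2) + 2 * C * r powr s) r"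
    proof (rule circle_mean_mono[OF _ _ r1(2)])
      fix z :: complex assume z: "norm z = r"
      have "A z \<noteq> 0" using r(2) z by (auto simp: zero_free_def)
      hence "ln (norm (A z)) \<le> ln (exp (K z + C * norm z powr s))" using A_le[of z] z r1 by (subst ln_le_cancel_iff) auto
      hence "ln (norm (A z)) \<le> K z + C * r powr s" using z by simp
      moreover have "C * r powr s \<ge> 0" using C by simp
      ultimately show "damped_log A z \<le> (2 * K z - max 0 (K z) / 2) + 2 * C * r powr s"
        unfolding mult.assoc by linarith
    qed (intro continuous_intros continuous_on_max cK continuous_on_ln_norm[OF A_hol r(2)]; simp)+
    also have "\<dots> = circle_mean (\<lambda>z. 2 * K z - max 0 (K z) / 2) r + 2 * C * r powr s"
      using r1 by (subst circle_mean_add) (auto intro!: continuous_intros continuous_on_max cK)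
    also have "circle_mean (\<lambda>z. 2 * K z - max 0 (K z) / 2) r = r ^ n * - \<kappa>"
      unfolding K_def \<kappa>_def minus_minus
    proof (rule circle_mean_support_fun_power[OF W assms(1) _ _ r1(2), of "\<lambda>x. 2 * x - max 0 x / 2"])
      show "continuous_on UNIV (\<lambda>x::real. 2 * x - max 0 x / 2)"
        by (intro continuous_intros continuous_on_max) auto
    qed (auto simp: max_def zero_le_mult_iff algebra_simps)
    also have "r ^ n = r powr real n" using r1 by (simp add: powr_realpow)
    finally show False using R(2)[OF r(1)] by (simp add: algebra_simps)
  next
    case False
    then obtain CA Kd where CA: "CA \<ge> 0" "\<And>z. norm (A z) \<le> CA * (1 + norm z) ^ Kd"
      using poly_growth_A by blast
    \<comment> \<open>The polynomial bound is recast with the exponent \<open>s\<close> fixed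
      before, so that it can be paired with \<open>A_le\<close>: one bound says that
      \<open>A\<close> grows slowly, the other that it decays in a sector.\<close>
    obtain Cp where Cp: "Cp \<ge> 0" "\<And>z :: complex. norm z \<ge> 1 \<Longrightarrow> CA * (1 + norm z) ^ Kd \<le> exp (Cp * norm z powr s)"
    proof (rule that)
      show "CA * 2 ^ Kd + real Kd / s \<ge> 0" using CA(1) s_pos by simp
      show "CA * (1 + norm z) ^ Kd \<le> exp ((CA * 2 ^ Kd + real Kd / s) * norm z powr s)" if "norm z \<ge> 1" for z :: complex
        by (rule power_le_exp_powr[OF CA(1) that s_pos])
    qed
    show False
    proof (rule no_exponential_decay_in_mean[OF A_hol A_nz W assms(1) s_pos s(2) _ circ(2), of "C + Cp"])
      show "C + Cp \<ge> 0" using C Cp by simp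
      fix z :: complex assume z: "norm z \<ge> 1"
      have x: "0 \<le> C * norm z powr s" "0 \<le> Cp * norm z powr s" using C Cp by auto
      hence "Cp * norm z powr s \<le> (C + Cp) * norm z powr s"
        "K z + C * norm z powr s \<le> K z + (C + Cp) * norm z powr s" by (simp_all add: distrib_right)
      moreover have "norm (A z) \<le> exp (Cp * norm z powr s)" using CA(2)[of z] Cp(2)[OF z] by linarith
      ultimately show "norm (A z) \<le> exp ((C + Cp) * norm z powr s)"
        "norm (A z) \<le> exp (support_fun W (z ^ n) + (C + Cp) * norm z powr s)"
        using A_le[OF z] unfolding K_def by (meson exp_le_cancel_iff order_trans)+
    qed
  qed
qed

end
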